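(* Let $\Omega=[0,1)$ with Lebesgue measure $\mathbb P$ and let $p(\cdot):[0,1)\to(0,\infty)$ be measurable with $p_-=\operatorname{ess\,inf}p$, $p_+=\operatorname{ess\,sup}p$, $0<p_-\le p_+<\infty$. Assume that there is a constant $K\ge 1$ such that $\mathbb P(A)^{p_-(A)-p_+(A)}\le K$ for every dyadic interval $A\subset[0,1)$, and that $\frac1{p_-}-\frac1{p_+}<1$. If $1/2<p_-<\infty$ and $0<q\le\infty$, then there is a constant $C$ (independent of $f$) such that $$\|\sigma_*f\|_{L_{p(\cdot),q}}\le C\,\|f\|_{H_{p(\cdot),q}}\qquad\text{for all } f\in H_{p(\cdot),q}.$$
   Context: For measurable $A\subset[0,1)$, $p_-(A)=\operatorname{ess\,inf}_{x\in A}p(x)$ and $p_+(A)=\operatorname{ess\,sup}_{x\in A}p(x)$. $\|f\|_{p(\cdot)}=\inf\{\lambda>0:\int_0^1(|f(x)|/\lambda)^{p(x)}dx\le1\}$. Variable Lorentz quasi-norm: $\|f\|_{L_{p(\cdot),q}}=\left(\int_0^\infty\lambda^q\|\chi_{\{|f|>\lambda\}}\|_{p(\cdot)}^q\frac{d\lambda}{\lambda}\right)^{1/q}$ for $q<\infty$ and $\|f\|_{L_{p(\cdot),\infty}}=\sup_{\lambda>0}\lambda\|\chi_{\{|f|>\lambda\}}\|_{p(\cdot)}$. Dyadic intervals are $[k2^{-n},(k+1)2^{-n})$, $n\in\mathbb N=\{0,1,2,\dots\}$, $0\le k<2^n$; $\mathcal F_n$ is the $\sigma$-algebra generated by the dyadic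 intervals of length $2^{-n}$. Martingales $f=(f_n)_{n\ge0}$ are taken with respect to $(\mathcal F_n)$. $M(f)=\sup_{n\ge0}|f_n|$. $H_{p(\cdot),q}$ is the space of martingales with $\|f\|_{H_{p(\cdot),q}}=\|M(f)\|_{L_{p(\cdot),q}}<\infty$ (the paper uses this notation for any of five martingale Hardy–Lorentz spaces, which coincide with equivalent quasi-norms in the dyadic setting; this is one of them). Walsh system: $r(x)=1$ on $[0,1/2)$, $r(x)=-1$ on $[1/2,1)$, extended with period 1; $r_n(x)=r(2^nx)$; for $n=\sum_{k\ge0}n_k2^k$ with $n_k\in\{0,1\}$, $w_n=\prod_{k\ge0}r_k^{n_k}$. For a martingale $f$, $\widehat f(n)=\lim_{k\to\infty}\mathbb E(f_kw_n)$ (the sequence is eventually constant). Partial sums: $s_nf=\sum_{k=0}^{n-1}\widehat f(k)w_k$. Fejér means: $\sigma_nf=\frac1n\sum_{k=1}^ns_kf$, $n\ge1$. Maximal Fejér operator: $\sigma_*f=\sup_{n\ge1}|\sigma_nf|$. *)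

theory Defs
  imports "HOL-Probability.Probability"
begin

abbreviation unit_leb :: "real measure" where
  "unit_leb \<equiv> lebesgue_on {0..<1}"

text \<open>Maximal functions and quasi-norms may be infinite, so they are \<^typ>\<open>ennreal\<close>-valued.
  The real power on \<^typ>\<open>ennreal\<close> below is used for positive exponents only.\<close>

definition ennpowr :: "ennreal \<Rightarrow> real \<Rightarrow> ennreal" where
  "ennpowr x a = (if x = \<infinity> then \<infinity> else ennreal (enn2real x powr a))"

subsection \<open>Variable exponents and Lorentz quasi-norms\<close>

definition p_plus :: "(real \<Rightarrow> real) \<Rightarrow> real set \<Rightarrow> ereal" where
  "p_plus p A = esssup (restrict_space unit_leb A) (\<lambda>x. ereal (p x))"

definition p_minus :: "(real \<Rightarrow> real) \<Rightarrow> real set \<Rightarrow> ereal" where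
  "p_minus p A = - esssup (restrict_space unit_leb A) (\<lambda>x. - ereal (p x))"

text \<open>In the quasi-norms the argument \<open>g\<close> stands for the absolute value \<open>\<bar>f\<bar>\<close>.\<close>

definition var_norm :: "(real \<Rightarrow> real) \<Rightarrow> (real \<Rightarrow> ennreal) \<Rightarrow> ennreal" where
  "var_norm p g =
     Inf {ennreal l | l. 0 < l \<and> (\<integral>\<^sup>+ x. ennpowr (g x / ennreal l) (p x) \<partial>unit_leb) \<le> 1}"

definition lorentz_norm :: "(real \<Rightarrow> real) \<Rightarrow> ennreal \<Rightarrow> (real \<Rightarrow> ennreal) \<Rightarrow> ennreal" where
  "lorentz_norm p q g =
     (if q = \<infinity>
      then SUP l\<in>{0<..}. ennreal l * var_norm p (indicator {x \<in> {0..<1}. ennreal l < g x})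
      else ennpowr
        (\<integral>\<^sup>+ l\<in>{0<..}. ennreal (l powr enn2real q)
            * ennpowr (var_norm p (indicator {x \<in> {0..<1}. ennreal l < g x})) (enn2real q)
            / ennreal l \<partial>lborel)
        (1 / enn2real q))"

subsection \<open>Dyadic martingales\<close>

definition dyadic_interval :: "nat \<Rightarrow> nat \<Rightarrow> real set" where
  "dyadic_interval n k = {real k / 2 ^ n ..< (real k + 1) / 2 ^ n}"

definition dyadic_algebra :: "nat \<Rightarrow> real measure" where
  "dyadic_algebra n = sigma {0..<1} {dyadic_interval n k | k. k < 2 ^ n}"

definition dyadic_martingale :: "(nat \<Rightarrow> real \<Rightarrow> real) \<Rightarrow> bool" where
  "dyadic_martingale f \<longleftrightarrow>
     (\<forall>n. f n \<in> borel_measurable (dyadic_algebra n) \<and> integrable unit_leb (f n)) \<and>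
     (\<forall>m n. m \<le> n \<longrightarrow> (AE x in unit_leb. real_cond_exp unit_leb (dyadic_algebra m) (f n) x = f m x))"

definition martingale_max :: "(nat \<Rightarrow> real \<Rightarrow> real) \<Rightarrow> real \<Rightarrow> ennreal" where
  "martingale_max f x = (SUP n. ennreal \<bar>f n x\<bar>)"

definition hardy_norm :: "(real \<Rightarrow> real) \<Rightarrow> ennreal \<Rightarrow> (nat \<Rightarrow> real \<Rightarrow> real) \<Rightarrow> ennreal" where
  "hardy_norm p q f = lorentz_norm p q (martingale_max f)"

definition hardy_space :: "(real \<Rightarrow> real) \<Rightarrow> ennreal \<Rightarrow> (nat \<Rightarrow> real \<Rightarrow> real) set" where
  "hardy_space p q = {f. dyadic_martingale f \<and> hardy_norm p q f < \<infinity>}"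

subsection \<open>Walsh--Fourier series\<close>

definition rademacher :: "nat \<Rightarrow> real \<Rightarrow> real" where
  "rademacher n x = (if frac (2 ^ n * x) < 1 / 2 then 1 else -1)"

definition walsh :: "nat \<Rightarrow> real \<Rightarrow> real" where
  "walsh n x = (\<Prod>k\<in>{k. bit n k}. rademacher k x)"

definition walsh_coeff :: "(nat \<Rightarrow> real \<Rightarrow> real) \<Rightarrow> nat \<Rightarrow> real" where
  "walsh_coeff f n = lim (\<lambda>k. LINT x|unit_leb. f k x * walsh n x)"

definition walsh_partial_sum :: "(nat \<Rightarrow> real \<Rightarrow> real) \<Rightarrow> nat \<Rightarrow> real \<Rightarrow> real" where
  "walsh_partial_sum f n x = (\<Sum>k<n. walsh_coeff f k * walsh k x)"

definition fejer_mean :: "(nat \<Rightarrow> real \<Rightarrow> real) \<Rightarrow> nat \<Rightarrow> real \<Rightarrow> real" where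
  "fejer_mean f n x = (\<Sum>k=1..n. walsh_partial_sum f k x) / real n"

definition fejer_max :: "(nat \<Rightarrow> real \<Rightarrow> real) \<Rightarrow> real \<Rightarrow> ennreal" where
  "fejer_max f x = (SUP n\<in>{1..}. ennreal \<bar>fejer_mean f n x\<bar>)"

end

theory Submission
  imports Defs
begin

text \<open>
  The proof decomposes the martingale into atoms at the heights \<open>c * 2 ^ l\<close>, \<open>l = 0, 1, \<dots>\<close>, for each
  level \<open>c > 0\<close> separately, and compares the level set \<open>{\<sigma>\<^sub>* f > 20 * c}\<close> with the level sets
  \<open>{M f > c * 2 ^ l}\<close>.

  A Fejer mean of order at most \<open>2 ^ T\<close> only sees the step function \<open>h = f T\<close>. Stopping \<open>h\<close> on the
  parents of the maximal dyadic intervals where its averages exceed \<open>c * 2 ^ l\<close> gives functions that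
  are bounded by \<open>c * 2 ^ l\<close>, unless the mean of \<open>h\<close> exceeds \<open>c\<close> in modulus; but then
  \<open>{M f > c}\<close> is everything and there is nothing to prove. The function stopped at level \<open>c\<close> has Fejer means bounded by \<open>8 * c\<close>,
  because the Walsh--Fejer kernels are bounded in \<open>L\<^sub>1\<close>. The differences of consecutive stopped
  functions are sums of atoms with mean zero on the stopping intervals. The kernel of order \<open>n\<close> with
  \<open>2 ^ N \<le> n < 2 ^ (N + 1)\<close> is at most \<open>2 * 2 ^ (j + i - N)\<close>, summed over \<open>j \<le> i \<le> N\<close> such that
  \<open>x\<close> and \<open>t\<close> agree in their first \<open>i\<close> binary digits except for the digit \<open>j\<close>
  (\<open>fejer_kernel_bound\<close>). Therefore all Fejer means of an atom on an interval of length \<open>2 ^ - n\<close> are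
  dominated, off the interval and up to a constant, by its shadow: the sum of \<open>2 ^ (j + i - 2 * n)\<close> over the intervals of
  length \<open>2 ^ - i\<close>, \<open>i \<le> n\<close>, that arise from the one around the atom by flipping the digit
  \<open>j \<le> i\<close> (\<open>fejer_op_pointwise\<close>).

  It remains to control the level sets of shadows in the variable Lebesgue space
  (\<open>shadow_weak_type\<close>). The quasi-norm of a set \<open>E\<close> is at most \<open>m\<close> if the integral of
  \<open>m powr - p x\<close> over \<open>E\<close>, its modular, is at most 1. Every stopping interval has a half in
  \<open>{M f > c * 2 ^ l}\<close>, so one has to compare the modular of the neighbours of an interval with that
  of its half. If the flipped digit \<open>j\<close> is large, both lie in a short interval; there the
  dyadic condition makes the oscillation of the exponent so small that its effect is beaten by the
  decay of the shadow, which is summable in the power \<open>r\<close> for \<open>1 / 2 < r < 1\<close>. This uses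
  \<open>p\<^sub>- > 1 / 2\<close>. For the finitely many remaining digits the exponents are unrelated, and the level
  set is estimated in Lebesgue measure; what is needed is exactly \<open>1 / p\<^sub>- - 1 / p\<^sub>+ < 1\<close> together
  with \<open>p\<^sub>- > 1 / 2\<close>. Both conditions are open, so one obtains the weak-type estimate with a power
  \<open>s powr - \<theta>\<close>, \<open>\<theta> < 1\<close>.

  As a consequence there is \<open>\<kappa> < 1\<close> such that the quasi-norm of \<open>{\<sigma>\<^sub>* f > 20 * c}\<close> is at most a
  constant times the supremum over \<open>l\<close> of \<open>2 powr (\<kappa> * l)\<close> times that of \<open>{M f > c * 2 ^ l}\<close>
  (\<open>level_norm_comparison\<close>). After multiplication by \<open>c\<close> the factor \<open>2 powr ((\<kappa> - 1) * l)\<close> remains,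
  which is summable, and this gives the inequality of the Lorentz quasi-norms for every \<open>q\<close>.
\<close>

section \<open>Dyadic cells described by signs of Rademacher functions\<close>

definition sign_cell :: "nat \<Rightarrow> (nat \<Rightarrow> real) \<Rightarrow> real set" where
  "sign_cell n s = {x \<in> {0..<1}. \<forall>l<n. rademacher l x = s l}"

text \<open>The dyadic interval of length \<open>2 ^ - i\<close> obtained from the one around \<open>t\<close> by changing its
  binary digit \<open>j\<close>. For \<open>j = i\<close> no digit is changed, so that the same family also contains the
  intervals around \<open>t\<close> themselves.\<close>

definition flip_cell :: "nat \<Rightarrow> nat \<Rightarrow> real \<Rightarrow> real set" where
  "flip_cell j i t = sign_cell i (\<lambda>l. (if l = j then - 1 else 1) * rademacher l t)"

definition cell :: "nat \<Rightarrow> real \<Rightarrow> real set" where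
  "cell n t = sign_cell n (\<lambda>l. rademacher l t)"

lemma rademacher_cases: "rademacher l x = 1 \<or> rademacher l x = - 1"
  by (simp add: rademacher_def)

lemma rademacher_sq [simp]: "rademacher l x * rademacher l x = 1"
  by (simp add: rademacher_def)

lemma flip_cell_diag: "flip_cell i i t = cell i t"
  by (auto simp: flip_cell_def cell_def sign_cell_def)

lemma mem_cell_iff: "x \<in> cell n t \<longleftrightarrow> x \<in> {0..<1} \<and> (\<forall>l<n. rademacher l x = rademacher l t)"
  by (auto simp: cell_def sign_cell_def)

lemma mem_flip_cell_iff:
  "x \<in> flip_cell j i t \<longleftrightarrow>
     x \<in> {0..<1} \<and> (\<forall>l<i. rademacher l x = (if l = j then - 1 else 1) * rademacher l t)"
  by (auto simp: flip_cell_def sign_cell_def)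

lemma cell_self [simp]: "t \<in> {0..<1} \<Longrightarrow> t \<in> cell n t"
  by (simp add: mem_cell_iff)

lemma cell_subset_unit: "cell n t \<subseteq> {0..<1}"
  by (auto simp: mem_cell_iff)

lemma cell_mono: "i \<le> n \<Longrightarrow> cell n t \<subseteq> cell i t"
  by (auto simp: mem_cell_iff)

lemma cell_eq: "u \<in> cell n t \<Longrightarrow> cell n u = cell n t"
  by (auto simp: mem_cell_iff)

lemma cell_0 [simp]: "cell 0 t = {0..<1}"
  by (auto simp: mem_cell_iff)

lemma flip_cell_coarser: "u \<in> cell n t \<Longrightarrow> i \<le> n \<Longrightarrow> flip_cell j i u = flip_cell j i t"
  by (auto simp: mem_cell_iff mem_flip_cell_iff)

lemma flip_cell_sym: "x \<in> {0..<1} \<Longrightarrow> t \<in> {0..<1} \<Longrightarrow> x \<in> flip_cell j i t \<longleftrightarrow> t \<in> flip_cell j i x"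
  by (auto simp: mem_flip_cell_iff)

lemma flip_cell_subset: "j \<le> i \<Longrightarrow> flip_cell j i t \<subseteq> cell j t"
  by (auto simp: mem_flip_cell_iff mem_cell_iff)

lemma rademacher_on_dyadic_interval:
  assumes "x \<in> dyadic_interval n k"
  shows "rademacher n x = 1 \<longleftrightarrow> x \<in> dyadic_interval (Suc n) (2 * k)"
    and "rademacher n x = - 1 \<longleftrightarrow> x \<in> dyadic_interval (Suc n) (2 * k + 1)"
proof -
  have b: "real k \<le> 2 ^ n * x" "2 ^ n * x < real k + 1"
    using assms by (auto simp: dyadic_interval_def field_simps)
  then have "\<lfloor>2 ^ n * x\<rfloor> = int k"
    by linarith
  then have "frac (2 ^ n * x) = 2 ^ n * x - real k"
    by (simp add: frac_def)
  then show "rademacher n x = 1 \<longleftrightarrow> x \<in> dyadic_interval (Suc n) (2 * k)"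
    and "rademacher n x = - 1 \<longleftrightarrow> x \<in> dyadic_interval (Suc n) (2 * k + 1)"
    using b by (auto simp: rademacher_def dyadic_interval_def field_simps)
qed

lemma dyadic_interval_halves:
  "dyadic_interval (Suc n) (2 * k) \<subseteq> dyadic_interval n k"
  "dyadic_interval (Suc n) (2 * k + 1) \<subseteq> dyadic_interval n k"
  by (auto simp: dyadic_interval_def field_simps)

lemma sign_cell_Suc: "sign_cell (Suc n) s = sign_cell n s \<inter> {x. rademacher n x = s n}"
  by (auto simp: sign_cell_def less_Suc_eq)

lemma sign_cell_is_dyadic_interval:
  assumes "\<And>l. l < n \<Longrightarrow> s l = 1 \<or> s l = - 1"
  shows "\<exists>k<2 ^ n. sign_cell n s = dyadic_interval n k"
  using assms
proof (induction n)
  case 0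
  then show ?case by (auto simp: sign_cell_def dyadic_interval_def)
next
  case (Suc n)
  then obtain k where k: "k < 2 ^ n" "sign_cell n s = dyadic_interval n k"
    by (metis less_SucI)
  from Suc.prems[of n] have "s n = 1 \<or> s n = - 1" by simp
  then show ?case
  proof
    assume s: "s n = 1"
    have "sign_cell (Suc n) s = dyadic_interval (Suc n) (2 * k)"
      using rademacher_on_dyadic_interval(1) dyadic_interval_halves(1)
      unfolding sign_cell_Suc k(2) s by blast
    moreover have "2 * k < 2 ^ Suc n" using k(1) by simp
    ultimately show ?thesis by blast
  next
    assume s: "s n = - 1"
    have "sign_cell (Suc n) s = dyadic_interval (Suc n) (2 * k + 1)"
      using rademacher_on_dyadic_interval(2) dyadic_interval_halves(2)
      unfolding sign_cell_Suc k(2) s by blast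
    moreover have "2 * k + 1 < 2 ^ Suc n" using k(1) by simp
    ultimately show ?thesis by blast
  qed
qed

lemma cell_is_dyadic_interval: "\<exists>k<2 ^ n. cell n t = dyadic_interval n k"
  unfolding cell_def by (rule sign_cell_is_dyadic_interval) (use rademacher_cases in blast)

lemma flip_cell_is_dyadic_interval: "\<exists>k<2 ^ i. flip_cell j i t = dyadic_interval i k"
  unfolding flip_cell_def
  by (rule sign_cell_is_dyadic_interval) (use rademacher_cases in \<open>force split: if_splits\<close>)

lemma dyadic_interval_subset_unit: "k < 2 ^ n \<Longrightarrow> dyadic_interval n k \<subseteq> {0..<1}"
proof -
  assume "k < 2 ^ n"
  then have "real (Suc k) \<le> 2 ^ n"
    by (metis Suc_leI of_nat_le_iff of_nat_numeral of_nat_power)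
  then have "(real k + 1) / 2 ^ n \<le> 1" by (simp add: field_simps)
  moreover have "0 \<le> real k / 2 ^ n" by simp
  ultimately show ?thesis unfolding dyadic_interval_def
    by (meson atLeastLessThan_iff less_le_trans order_trans subsetI)
qed

lemma dyadic_interval_unique:
  assumes "x \<in> dyadic_interval n k" "x \<in> dyadic_interval n k'"
  shows "k = k'"
proof -
  have "\<lfloor>2 ^ n * x\<rfloor> = int k" "\<lfloor>2 ^ n * x\<rfloor> = int k'"
    using assms by (auto simp: dyadic_interval_def field_simps floor_eq_iff)
  then show ?thesis by simp
qed

lemma dyadic_interval_eq_cell:
  assumes "k < 2 ^ n" "t \<in> dyadic_interval n k"
  shows "dyadic_interval n k = cell n t"
proof -
  obtain k' where k': "cell n t = dyadic_interval n k'" using cell_is_dyadic_interval by blast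
  have "t \<in> cell n t" using assms dyadic_interval_subset_unit by (metis cell_self subsetD)
  then show ?thesis using dyadic_interval_unique[OF assms(2), of k'] k' by simp
qed

lemma left_endpoint_mem: "real k / 2 ^ n \<in> dyadic_interval n k"
  by (auto simp: dyadic_interval_def divide_simps)

lemma left_endpoint_unit: "k < 2 ^ n \<Longrightarrow> real k / 2 ^ n \<in> {0..<1}"
  using left_endpoint_mem dyadic_interval_subset_unit by blast

lemma unit_leb_finite: "finite_measure unit_leb"
  by (rule finite_measureI) (simp add: emeasure_restrict_space)

lemma dyadic_interval_sets: "k < 2 ^ n \<Longrightarrow> dyadic_interval n k \<in> sets unit_leb"
  using dyadic_interval_subset_unit[of k n]
  by (subst sets_restrict_space_iff) (simp_all add: dyadic_interval_def)

lemma measure_dyadic_interval: "k < 2 ^ n \<Longrightarrow> measure unit_leb (dyadic_interval n k) = 1 / 2 ^ n"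
  using dyadic_interval_subset_unit[of k n]
  by (subst measure_restrict_space) (auto simp: dyadic_interval_def field_simps)

lemma cell_sets [measurable]: "cell n t \<in> sets unit_leb"
  using cell_is_dyadic_interval dyadic_interval_sets by metis

lemma flip_cell_sets [measurable]: "flip_cell j i t \<in> sets unit_leb"
  using flip_cell_is_dyadic_interval dyadic_interval_sets by metis

lemma measure_cell [simp]: "measure unit_leb (cell n t) = 1 / 2 ^ n"
  using cell_is_dyadic_interval measure_dyadic_interval by metis

lemma measure_flip_cell [simp]: "measure unit_leb (flip_cell j i t) = 1 / 2 ^ i"
  using flip_cell_is_dyadic_interval measure_dyadic_interval by metis

section \<open>The Walsh--Fejer kernel\<close>

text \<open>For points \<open>x\<close> and \<open>t\<close>, the kernels of the Walsh system depend only on the sequence of signs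
  \<open>rademacher l x * rademacher l t\<close>, so they are treated as functions of a sign sequence \<open>e\<close>.\<close>

definition walsh_sign :: "(nat \<Rightarrow> real) \<Rightarrow> nat \<Rightarrow> real" where
  "walsh_sign e k = (\<Prod>l\<in>{l. bit k l}. e l)"

definition dirichlet_sum :: "(nat \<Rightarrow> real) \<Rightarrow> nat \<Rightarrow> real" where
  "dirichlet_sum e m = (\<Sum>k<m. walsh_sign e k)"

definition fejer_sum :: "(nat \<Rightarrow> real) \<Rightarrow> nat \<Rightarrow> real" where
  "fejer_sum e n = (\<Sum>m=1..n. dirichlet_sum e m)"

lemma bit_lt_power: "k < 2 ^ N \<Longrightarrow> bit (k::nat) l \<Longrightarrow> l < N"
  by (metis bit_iff_odd div_less even_zero leI le_less_trans linorder_not_less nat_power_less_imp_less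
      pos2 power_strict_increasing_iff less_le_trans power_increasing one_le_numeral)

lemma finite_bits [simp]: "finite {l. bit (k::nat) l}"
  by (rule finite_subset[of _ "{..<k}"]) (use bit_lt_power[OF less_exp] in auto)

lemma bits_power_add: "k < 2 ^ N \<Longrightarrow> {l. bit (2 ^ N + k :: nat) l} = insert N {l. bit k l}"
proof -
  assume k: "k < 2 ^ N"
  have "\<not> bit k N" using bit_lt_power[OF k] by blast
  then have "2 ^ N + k = Bit_Operations.or (2 ^ N) k"
    by (intro disjunctive_add_eq_or bit_eqI) (auto simp: bit_simps)
  then show ?thesis by (auto simp: bit_simps)
qed

lemma walsh_sign_power_add: "k < 2 ^ N \<Longrightarrow> walsh_sign e (2 ^ N + k) = e N * walsh_sign e k"
  unfolding walsh_sign_def bits_power_add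
  by (subst prod.insert) (use bit_lt_power in auto)

lemma walsh_sign_cong:
  "k < 2 ^ N \<Longrightarrow> (\<And>l. l < N \<Longrightarrow> e l = e' l) \<Longrightarrow> walsh_sign e k = walsh_sign e' k"
  unfolding walsh_sign_def by (rule prod.cong) (use bit_lt_power in auto)

lemma fejer_sum_cong:
  "n \<le> 2 ^ N \<Longrightarrow> (\<And>l. l < N \<Longrightarrow> e l = e' l) \<Longrightarrow> fejer_sum e n = fejer_sum e' n"
  unfolding fejer_sum_def dirichlet_sum_def
  by (intro sum.cong refl walsh_sign_cong[of _ N]) auto

lemma dirichlet_sum_power_add:
  "m \<le> 2 ^ N \<Longrightarrow> dirichlet_sum e (2 ^ N + m) = dirichlet_sum e (2 ^ N) + e N * dirichlet_sum e m"
proof (induction m)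
  case 0
  then show ?case by (simp add: dirichlet_sum_def)
next
  case (Suc m)
  then have "walsh_sign e (2 ^ N + m) = e N * walsh_sign e m"
    by (intro walsh_sign_power_add) simp
  with Suc show ?case by (simp add: dirichlet_sum_def algebra_simps)
qed

lemma fejer_sum_Suc: "fejer_sum e (Suc n) = fejer_sum e n + dirichlet_sum e (Suc n)"
  by (simp add: fejer_sum_def)

lemma fejer_sum_power_add:
  "m \<le> 2 ^ N \<Longrightarrow> fejer_sum e (2 ^ N + m) =
     fejer_sum e (2 ^ N) + real m * dirichlet_sum e (2 ^ N) + e N * fejer_sum e m"
proof (induction m)
  case 0
  then show ?case by (simp add: fejer_sum_def)
next
  case (Suc m)
  then have "dirichlet_sum e (2 ^ N + Suc m) = dirichlet_sum e (2 ^ N) + e N * dirichlet_sum e (Suc m)"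
    using dirichlet_sum_power_add by blast
  with Suc show ?case by (simp add: fejer_sum_Suc algebra_simps)
qed

text \<open>For the sign sequence of \<open>x\<close> and \<open>t\<close> this says that \<open>t\<close> lies in
  \<open>flip_cell j i x\<close>.\<close>

definition flip_pattern :: "nat \<Rightarrow> nat \<Rightarrow> (nat \<Rightarrow> real) \<Rightarrow> bool" where
  "flip_pattern j i e \<longleftrightarrow> (\<forall>l<i. e l = (if l = j then - 1 else 1))"

lemma dirichlet_sum_power:
  assumes e: "\<And>l. e l = 1 \<or> e l = - 1"
  shows "dirichlet_sum e (2 ^ N) = 2 ^ N * of_bool (flip_pattern N N e)"
proof (induction N)
  case 0
  then show ?case by (simp add: dirichlet_sum_def walsh_sign_def flip_pattern_def)
next
  case (Suc N)
  have "dirichlet_sum e (2 ^ Suc N) = (1 + e N) * dirichlet_sum e (2 ^ N)"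
    using dirichlet_sum_power_add[of "2 ^ N" N e] by (simp add: algebra_simps mult_2)
  moreover have "flip_pattern (Suc N) (Suc N) e \<longleftrightarrow> flip_pattern N N e \<and> e N = 1"
    by (auto simp: flip_pattern_def less_Suc_eq)
  ultimately show ?case using Suc e[of N] by auto
qed

text \<open>At \<open>2 ^ N\<close> the doubling recursion
  \<open>F (2 ^ (N + 1)) = (1 + e N) F (2 ^ N) + 2 ^ N D (2 ^ N)\<close> keeps everything nonnegative and kills
  the kernel as soon as two signs are negative: the first negative sign stops the growth by factors
  of 4, and the second one annihilates the kernel.\<close>

lemma fejer_sum_power_bound:
  assumes e: "\<And>l. e l = 1 \<or> e l = - 1"
  shows "0 \<le> fejer_sum e (2 ^ N) \<and>
    fejer_sum e (2 ^ N) \<le> (\<Sum>j\<le>N. 2 ^ (j + N) * of_bool (flip_pattern j N e))"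
proof (induction N)
  case 0
  then show ?case
    by (simp add: fejer_sum_def dirichlet_sum_def walsh_sign_def flip_pattern_def)
next
  case (Suc N)
  have rec: "fejer_sum e (2 ^ Suc N) = (1 + e N) * fejer_sum e (2 ^ N) + 2 ^ N * dirichlet_sum e (2 ^ N)"
    using fejer_sum_power_add[of "2 ^ N" N e] by (simp add: algebra_simps mult_2)
  define B where "B = (\<Sum>j<N. 2 ^ (j + N) * of_bool (flip_pattern j N e) :: real)"
  have B0: "0 \<le> B" unfolding B_def by (intro sum_nonneg) auto
  have IH: "0 \<le> fejer_sum e (2 ^ N)" "fejer_sum e (2 ^ N) \<le> B + 2 ^ (N + N) * of_bool (flip_pattern N N e)"
    using Suc by (auto simp: B_def lessThan_Suc_atMost[symmetric])
  define X where "X = (\<Sum>j<N. 2 ^ (j + Suc N) * of_bool (flip_pattern j (Suc N) e) :: real)"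
  have X0: "0 \<le> X" unfolding X_def by (intro sum_nonneg) auto
  have S: "(\<Sum>j\<le>Suc N. 2 ^ (j + Suc N) * of_bool (flip_pattern j (Suc N) e) :: real) =
      X + 2 ^ (N + Suc N) * of_bool (flip_pattern N (Suc N) e)
      + 2 ^ (Suc N + Suc N) * of_bool (flip_pattern (Suc N) (Suc N) e)"
    unfolding X_def by (simp only: lessThan_Suc_atMost[symmetric] sum.lessThan_Suc)
  show ?case
  proof (cases "e N = 1")
    case True
    have p: "flip_pattern j (Suc N) e \<longleftrightarrow> flip_pattern j N e" if "j < N" for j
      using True that by (auto simp: flip_pattern_def less_Suc_eq)
    have p': "flip_pattern (Suc N) (Suc N) e \<longleftrightarrow> flip_pattern N N e"
      using True by (auto simp: flip_pattern_def less_Suc_eq)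
    have "X = 2 * B"
      unfolding X_def B_def sum_distrib_left by (intro sum.cong) (auto simp: p)
    moreover obtain a where a: "(2::real) ^ N * 2 ^ N = a" "0 \<le> a" by simp
    ultimately show ?thesis
      using IH True B0 unfolding rec S p' dirichlet_sum_power[where e = e, OF e]
      by (cases "flip_pattern N N e"; cases "flip_pattern N (Suc N) e") (auto simp: power_add a(1))
  next
    case False
    then have eN: "e N = - 1" using e by blast
    have p: "flip_pattern N (Suc N) e \<longleftrightarrow> flip_pattern N N e"
      using eN by (auto simp: flip_pattern_def less_Suc_eq)
    show ?thesis
      using eN X0 unfolding rec S p dirichlet_sum_power[where e = e, OF e]
      by (auto simp: power_add)
  qed
qed

text \<open>The binary expansion of \<open>n\<close> splits the kernel into pieces of the previous kind; the two
  leading terms of the recursion are both bounded by the same pattern sum, hence the factor 2.\<close>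

lemma fejer_sum_bound:
  assumes e: "\<And>l. e l = 1 \<or> e l = - 1"
  shows "n < 2 ^ Suc N \<Longrightarrow>
    \<bar>fejer_sum e n\<bar> \<le> 2 * (\<Sum>i\<le>N. \<Sum>j\<le>i. 2 ^ (j + i) * of_bool (flip_pattern j i e))"
proof (induction N arbitrary: n)
  case 0
  then have "n = 0 \<or> n = 1" by auto
  then show ?case
    by (auto simp: fejer_sum_def dirichlet_sum_def walsh_sign_def flip_pattern_def)
next
  case (Suc N)
  define S where "S i = (\<Sum>j\<le>i. 2 ^ (j + i) * of_bool (flip_pattern j i e) :: real)" for i
  have S0: "0 \<le> S i" for i unfolding S_def by (intro sum_nonneg) auto
  show ?case
  proof (cases "n < 2 ^ Suc N")
    case True
    then show ?thesis using Suc.IH[OF True] S0[of "Suc N"] unfolding S_def[symmetric] by simp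
  next
    case False
    define m where "m = n - 2 ^ Suc N"
    have n: "n = 2 ^ Suc N + m" and m: "m < 2 ^ Suc N" using False Suc.prems by (auto simp: m_def)
    have L: "fejer_sum e n = fejer_sum e (2 ^ Suc N) + real m * dirichlet_sum e (2 ^ Suc N)
        + e (Suc N) * fejer_sum e m"
      unfolding n using m by (intro fejer_sum_power_add) simp
    have a: "\<bar>fejer_sum e (2 ^ Suc N)\<bar> \<le> S (Suc N)"
      using fejer_sum_power_bound[where e = e and N = "Suc N", OF e] unfolding S_def by linarith
    have m': "real m \<le> 2 ^ Suc N"
      using m by (metis of_nat_le_iff of_nat_numeral of_nat_power less_imp_le)
    have "\<bar>real m * dirichlet_sum e (2 ^ Suc N)\<bar> \<le> 2 ^ Suc N * (2 ^ Suc N * of_bool (flip_pattern (Suc N) (Suc N) e))"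
      unfolding dirichlet_sum_power[where e = e, OF e] abs_mult using m'
      by (intro mult_mono) auto
    also have "\<dots> \<le> S (Suc N)"
      unfolding S_def by (subst sum.atMost_Suc) (auto simp: power_add intro!: add_increasing sum_nonneg)
    finally have b: "\<bar>real m * dirichlet_sum e (2 ^ Suc N)\<bar> \<le> S (Suc N)" .
    have c: "\<bar>e (Suc N) * fejer_sum e m\<bar> \<le> 2 * (\<Sum>i\<le>N. S i)"
      using Suc.IH[OF m] e[of "Suc N"] unfolding S_def by (auto simp: abs_mult)
    show ?thesis using a b c unfolding L S_def[symmetric] by simp
  qed
qed

definition fejer_kernel :: "nat \<Rightarrow> real \<Rightarrow> real \<Rightarrow> real" where
  "fejer_kernel n x t = fejer_sum (\<lambda>l. rademacher l x * rademacher l t) n / real n"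

lemma flip_pattern_iff:
  "t \<in> {0..<1} \<Longrightarrow> flip_pattern j i (\<lambda>l. rademacher l x * rademacher l t) \<longleftrightarrow> t \<in> flip_cell j i x"
  unfolding flip_pattern_def mem_flip_cell_iff using rademacher_cases
  by (auto split: if_splits) (metis mult_cancel_right1 mult_minus1_right rademacher_sq mult_minus1 mult.right_neutral minus_minus rademacher_cases)+

lemma fejer_kernel_bound:
  assumes "2 ^ N \<le> n" "n < 2 ^ Suc N" "t \<in> {0..<1}"
  shows "\<bar>fejer_kernel n x t\<bar> \<le> 2 * (\<Sum>i\<le>N. \<Sum>j\<le>i. 2 ^ (j + i) / 2 ^ N * indicator (flip_cell j i x) t)"
proof -
  have e: "rademacher l x * rademacher l t = 1 \<or> rademacher l x * rademacher l t = - 1" for l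
    using rademacher_cases[of l x] rademacher_cases[of l t] by auto
  have "\<bar>fejer_sum (\<lambda>l. rademacher l x * rademacher l t) n\<bar>
      \<le> 2 * (\<Sum>i\<le>N. \<Sum>j\<le>i. 2 ^ (j + i) * indicator (flip_cell j i x) t)" (is "?a \<le> ?b")
    using fejer_sum_bound[where e = "\<lambda>l. rademacher l x * rademacher l t", OF e assms(2)]
    by (simp add: flip_pattern_iff[OF assms(3)] indicator_def)
  moreover have b0: "0 \<le> ?b" by (intro mult_nonneg_nonneg sum_nonneg) auto
  moreover have "(2::real) ^ N \<le> real n" using assms(1)
    by (metis of_nat_le_iff of_nat_numeral of_nat_power)
  ultimately have "?a / real n \<le> ?b / 2 ^ N"
    by (intro frac_le) auto
  then show ?thesis
    by (simp add: fejer_kernel_def sum_divide_distrib[symmetric] sum_distrib_left)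
qed

lemma fejer_kernel_cong:
  assumes "n \<le> 2 ^ N" "u \<in> cell N t"
  shows "fejer_kernel n x u = fejer_kernel n x t"
  unfolding fejer_kernel_def using assms
  by (subst fejer_sum_cong[OF assms(1)]) (auto simp: mem_cell_iff)

section \<open>Fejer means of dyadic step functions\<close>

definition dyadic_step :: "nat \<Rightarrow> (real \<Rightarrow> real) \<Rightarrow> bool" where
  "dyadic_step T h \<longleftrightarrow> (\<forall>x\<in>{0..<1}. \<forall>y\<in>cell T x. h y = h x)"

lemma dyadic_stepD: "dyadic_step T h \<Longrightarrow> x \<in> {0..<1} \<Longrightarrow> y \<in> cell T x \<Longrightarrow> h y = h x"
  unfolding dyadic_step_def by blast

lemma dyadic_step_const [intro]: "dyadic_step T (\<lambda>_. c)"
  by (simp add: dyadic_step_def)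

lemma dyadic_step_comp2:
  "dyadic_step T f \<Longrightarrow> dyadic_step T' g \<Longrightarrow> dyadic_step (max T T') (\<lambda>x. F (f x) (g x))"
  unfolding dyadic_step_def
  by (intro ballI arg_cong2[where f = F]) (meson cell_mono max.cobounded1 max.cobounded2 subsetD)+

lemma dyadic_step_cell: "dyadic_step n (indicator (cell n t))"
  by (auto simp: dyadic_step_def mem_cell_iff indicator_def)

lemma dyadic_step_kernel: "n \<le> 2 ^ N \<Longrightarrow> dyadic_step N (fejer_kernel n x)"
  unfolding dyadic_step_def using fejer_kernel_cong by blast

lemma dyadic_step_kernel': "dyadic_step n (fejer_kernel n x)"
  by (rule dyadic_step_kernel) (simp add: less_imp_le)

lemma dyadic_step_sum_indicator:
  assumes "dyadic_step T h" "x \<in> {0..<1}"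
  shows "h x = (\<Sum>k<2 ^ T. h (real k / 2 ^ T) * indicator (dyadic_interval T k) x)"
proof -
  obtain k where k: "k < 2 ^ T" "cell T x = dyadic_interval T k"
    using cell_is_dyadic_interval by blast
  have x: "x \<in> dyadic_interval T k" using k assms cell_self by metis
  have "real k / 2 ^ T \<in> cell T x" using k left_endpoint_mem by metis
  then have hx: "h (real k / 2 ^ T) = h x" using assms dyadic_stepD by blast
  have "(\<Sum>k<2 ^ T. h (real k / 2 ^ T) * indicator (dyadic_interval T k) x)
      = (\<Sum>k'<2 ^ T. if k' = k then h (real k / 2 ^ T) else 0)"
    using x dyadic_interval_unique by (intro sum.cong) (auto simp: indicator_def)
  then show ?thesis using k hx by simp
qed

lemma dyadic_step_integrable:
  assumes "dyadic_step T h"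
  shows "integrable unit_leb h"
proof -
  interpret finite_measure unit_leb by (rule unit_leb_finite)
  have "integrable unit_leb (\<lambda>x. \<Sum>k<2 ^ T. h (real k / 2 ^ T) * indicator (dyadic_interval T k) x)"
    by (intro Bochner_Integration.integrable_sum integrable_mult_right)
       (auto intro!: integrable_real_indicator dyadic_interval_sets simp: emeasure_finite top.not_eq_extremum[symmetric])
  moreover have "\<And>x. x \<in> space unit_leb \<Longrightarrow>
      h x = (\<Sum>k<2 ^ T. h (real k / 2 ^ T) * indicator (dyadic_interval T k) x)"
    using dyadic_step_sum_indicator[OF assms] by simp
  ultimately show ?thesis
    by (subst Bochner_Integration.integrable_cong[OF refl]) auto
qed

lemma dyadic_step_measurable: "dyadic_step T h \<Longrightarrow> h \<in> borel_measurable unit_leb"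
  using dyadic_step_integrable by blast

lemma dyadic_step_bounded:
  assumes "dyadic_step T h"
  shows "\<exists>B\<ge>0. \<forall>x\<in>{0..<1}. \<bar>h x\<bar> \<le> B"
proof -
  have "\<bar>h x\<bar> \<le> (\<Sum>k<2 ^ T. \<bar>h (real k / 2 ^ T)\<bar>)" if "x \<in> {0..<1}" for x
    unfolding dyadic_step_sum_indicator[OF assms that]
    by (rule order_trans[OF sum_abs], rule sum_mono) (simp add: indicator_def abs_mult)
  then show ?thesis by (metis sum_nonneg abs_ge_zero)
qed

lemma integrable_step_mult:
  "dyadic_step T f \<Longrightarrow> dyadic_step T' g \<Longrightarrow> integrable unit_leb (\<lambda>x. f x * g x)"
  using dyadic_step_comp2[where F = "(*)"] dyadic_step_integrable by blast

lemma integrable_indicator_unit: "E \<in> sets unit_leb \<Longrightarrow> integrable unit_leb (indicator E :: real \<Rightarrow> real)"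
  using unit_leb_finite
  by (intro integrable_real_indicator) (auto simp: finite_measure.emeasure_finite top.not_eq_extremum[symmetric])

definition fejer_op :: "nat \<Rightarrow> (real \<Rightarrow> real) \<Rightarrow> real \<Rightarrow> real" where
  "fejer_op n h x = (LINT t|unit_leb. h t * fejer_kernel n x t)"

lemma integrable_fejer: "dyadic_step T h \<Longrightarrow> integrable unit_leb (\<lambda>t. h t * fejer_kernel n x t)"
  by (rule integrable_step_mult[OF _ dyadic_step_kernel'])

lemma obtain_dyadic_order:
  assumes "1 \<le> (n::nat)"
  obtains N where "2 ^ N \<le> n" "n < 2 ^ Suc N"
  using ex_power_ivl1[of 2 n] assms by auto

lemma kernel_integral_bound:
  assumes h: "dyadic_step T h" and B: "\<And>t. t \<in> {0..<1} \<Longrightarrow> \<bar>h t\<bar> \<le> B"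
    and N: "2 ^ N \<le> n" "n < 2 ^ Suc N"
  shows "\<bar>LINT u|unit_leb. indicator (cell M t) u * (h u * fejer_kernel n x u)\<bar>
     \<le> 2 * B * (\<Sum>i\<le>N. \<Sum>j\<le>i. 2 ^ (j + i) / 2 ^ N * measure unit_leb (flip_cell j i x \<inter> cell M t))"
proof -
  let ?E = "cell M t"
  have B0: "0 \<le> B" using B[of 0] by auto
  have int1: "integrable unit_leb (\<lambda>u. indicator ?E u * (h u * fejer_kernel n x u))"
    using dyadic_step_cell dyadic_step_comp2[OF h dyadic_step_kernel', where F = "(*)"]
    by (rule integrable_step_mult)
  have A: "flip_cell j i x \<inter> ?E \<in> sets unit_leb" for i j by auto
  have int2: "integrable unit_leb (\<lambda>u. \<Sum>i\<le>N. \<Sum>j\<le>i. 2 ^ (j + i) / 2 ^ N * indicator (flip_cell j i x \<inter> ?E) u :: real)"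
    by (intro Bochner_Integration.integrable_sum integrable_mult_right integrable_indicator_unit A)
  have "\<bar>LINT u|unit_leb. indicator ?E u * (h u * fejer_kernel n x u)\<bar>
      \<le> (LINT u|unit_leb. \<bar>indicator ?E u * (h u * fejer_kernel n x u)\<bar>)"
    by (rule integral_abs_bound)
  also have "\<dots> \<le> (LINT u|unit_leb. 2 * B * (\<Sum>i\<le>N. \<Sum>j\<le>i. 2 ^ (j + i) / 2 ^ N * indicator (flip_cell j i x \<inter> ?E) u))"
  proof (rule integral_mono)
    show "integrable unit_leb (\<lambda>u. \<bar>indicator ?E u * (h u * fejer_kernel n x u)\<bar>)"
      using int1 by (rule integrable_abs)
    show "integrable unit_leb (\<lambda>u. 2 * B * (\<Sum>i\<le>N. \<Sum>j\<le>i. 2 ^ (j + i) / 2 ^ N * indicator (flip_cell j i x \<inter> ?E) u))"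
      using int2 by (rule integrable_mult_right)
    fix u assume "u \<in> space unit_leb"
    then have u: "u \<in> {0..<1}" by simp
    show "\<bar>indicator ?E u * (h u * fejer_kernel n x u)\<bar>
      \<le> 2 * B * (\<Sum>i\<le>N. \<Sum>j\<le>i. 2 ^ (j + i) / 2 ^ N * indicator (flip_cell j i x \<inter> ?E) u)"
    proof (cases "u \<in> ?E")
      case True
      have "\<bar>h u * fejer_kernel n x u\<bar> \<le> B * (2 * (\<Sum>i\<le>N. \<Sum>j\<le>i. 2 ^ (j + i) / 2 ^ N * indicator (flip_cell j i x) u))"
        unfolding abs_mult by (intro mult_mono B u fejer_kernel_bound N B0) auto
      then show ?thesis using True by (simp add: indicator_inter_arith algebra_simps)
    qed (simp add: indicator_inter_arith)
  qed
  also have "\<dots> = 2 * B * (\<Sum>i\<le>N. \<Sum>j\<le>i. 2 ^ (j + i) / 2 ^ N * measure unit_leb (flip_cell j i x \<inter> ?E))"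
    using A[THEN sets.sets_into_space]
    by (simp add: Bochner_Integration.integral_sum Bochner_Integration.integrable_sum
        integrable_mult_right integrable_indicator_unit A Int_absorb2)
  finally show ?thesis .
qed

lemma sum_power2_le: "(\<Sum>j\<le>i. 2 ^ j) \<le> (2 * 2 ^ i :: real)"
  by (induction i) auto

text \<open>The kernels are bounded in \<open>L\<^sub>1\<close>: a flipped cell of level \<open>i\<close> has measure \<open>2 ^ - i\<close>,
  which leaves the geometric sums of \<open>2 ^ (j - N)\<close> over \<open>j \<le> i \<le> N\<close>.\<close>

lemma fejer_op_bounded:
  assumes h: "dyadic_step T h" and B: "\<And>t. t \<in> {0..<1} \<Longrightarrow> \<bar>h t\<bar> \<le> B" and n: "1 \<le> n"
  shows "\<bar>fejer_op n h x\<bar> \<le> 8 * B"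
proof -
  obtain N where N: "2 ^ N \<le> n" "n < 2 ^ Suc N" using n obtain_dyadic_order by blast
  have B0: "0 \<le> B" using B[of 0] by auto
  have "fejer_op n h x = (LINT u|unit_leb. indicator (cell 0 x) u * (h u * fejer_kernel n x u))"
    unfolding fejer_op_def by (intro Bochner_Integration.integral_cong) auto
  then have "\<bar>fejer_op n h x\<bar> \<le> 2 * B * (\<Sum>i\<le>N. \<Sum>j\<le>i. 2 ^ (j + i) / 2 ^ N * measure unit_leb (flip_cell j i x \<inter> cell 0 x))"
    using kernel_integral_bound[OF h B N, of 0 x x] by simp
  also have "(\<Sum>i\<le>N. \<Sum>j\<le>i. 2 ^ (j + i) / 2 ^ N * measure unit_leb (flip_cell j i x \<inter> cell 0 x))
      = (\<Sum>i\<le>N. \<Sum>j\<le>i. 2 ^ j) / 2 ^ N"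
    unfolding sum_divide_distrib
  proof (intro sum.cong refl)
    fix i j
    have "flip_cell j i x \<inter> cell 0 x = flip_cell j i x" by (auto simp: mem_flip_cell_iff)
    then show "2 ^ (j + i) / 2 ^ N * measure unit_leb (flip_cell j i x \<inter> cell 0 x) = 2 ^ j / 2 ^ N"
      by (simp add: power_add)
  qed
  also have "\<dots> \<le> (\<Sum>i\<le>N. 2 * 2 ^ i) / 2 ^ N"
    by (intro divide_right_mono sum_mono sum_power2_le) auto
  also have "\<dots> \<le> 4"
    using sum_power2_le[of N] by (simp add: sum_distrib_left[symmetric] field_simps)
  finally show ?thesis using B0 by (simp add: mult_left_mono)
qed

text \<open>Up to a constant, this dominates at \<open>x\<close> every Fejer mean of an atom of height 1 supported by
  \<open>cell n t\<close>: an atom is seen only from those larger cells which arise from one around it by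
  flipping at most one binary digit.\<close>

definition atom_shadow :: "nat \<Rightarrow> real \<Rightarrow> real \<Rightarrow> real" where
  "atom_shadow n t x = (\<Sum>i\<le>n. \<Sum>j\<le>i. 2 ^ (j + i) / 4 ^ n * indicator (flip_cell j i t) x)"

definition shadow :: "(nat \<times> real) set \<Rightarrow> real \<Rightarrow> real" where
  "shadow P x = (\<Sum>(n, t)\<in>P. atom_shadow n t x)"

lemma atom_shadow_nonneg: "0 \<le> atom_shadow n t x"
  unfolding atom_shadow_def by (intro sum_nonneg) auto

lemma atom_shadow_ge:
  assumes "i \<le> n" "A \<subseteq> {..i}"
  shows "(\<Sum>j\<in>A. 2 ^ (j + i) / 4 ^ n * indicator (flip_cell j i t) x) \<le> atom_shadow n t x"
proof -
  have "(\<Sum>j\<in>A. 2 ^ (j + i) / 4 ^ n * indicator (flip_cell j i t) x :: real)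
      \<le> (\<Sum>j\<le>i. 2 ^ (j + i) / 4 ^ n * indicator (flip_cell j i t) x)"
    using assms by (intro sum_mono2) auto
  also have "\<dots> \<le> atom_shadow n t x"
    unfolding atom_shadow_def using assms
    by (intro member_le_sum[of i "{..n}"]) (auto intro!: sum_nonneg)
  finally show ?thesis .
qed

lemma atom_shadow_on_cell:
  assumes "x \<in> cell n t" shows "1 \<le> atom_shadow n t x"
  using atom_shadow_ge[of n n "{n}" t x] assms
  by (simp add: flip_cell_diag power_add power_mult_distrib[symmetric])

text \<open>If \<open>n \<le> 2 ^ M\<close> the kernel is constant on the cell and the atom is annihilated. Otherwise
  the flipped cells of \<open>x\<close> which are finer than the atom give equal contributions for each level,
  and their number is compensated by the factor \<open>1 / 2 ^ N\<close> of the kernel.\<close>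

lemma fejer_atom_bound:
  assumes a: "dyadic_step T a" and B: "\<And>t. t \<in> {0..<1} \<Longrightarrow> \<bar>a t\<bar> \<le> B" and n: "1 \<le> n"
    and t: "t \<in> {0..<1}" and x: "x \<in> {0..<1}" "x \<notin> cell M t"
    and mean: "(LINT u|unit_leb. indicator (cell M t) u * a u) = 0"
  shows "\<bar>LINT u|unit_leb. indicator (cell M t) u * (a u * fejer_kernel n x u)\<bar> \<le> 4 * B * atom_shadow M t x"
proof (cases "n \<le> 2 ^ M")
  case True
  have "(LINT u|unit_leb. indicator (cell M t) u * (a u * fejer_kernel n x u))
      = (LINT u|unit_leb. (indicator (cell M t) u * a u) * fejer_kernel n x t)"
    by (intro Bochner_Integration.integral_cong)
       (auto simp: indicator_def fejer_kernel_cong[OF True])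
  then show ?thesis using mean B[of 0] by (simp add: atom_shadow_nonneg)
next
  case False
  have B0: "0 \<le> B" using B[of 0] by auto
  obtain N where N: "2 ^ N \<le> n" "n < 2 ^ Suc N" using n obtain_dyadic_order by blast
  have "(2::nat) ^ M < 2 ^ Suc N" using False N by linarith
  then have "M < Suc N" by (simp only: power_strict_increasing_iff)
  then have MN: "M \<le> N" by simp
  let ?m = "\<lambda>j i. measure unit_leb (flip_cell j i x \<inter> cell M t)"
  let ?F = "\<lambda>j i. 2 ^ (j + i) / 2 ^ N * ?m j i"
  interpret finite_measure unit_leb by (rule unit_leb_finite)
  have m1: "?m j i \<le> 1 / 2 ^ M" for j i
    using finite_measure_mono[of "flip_cell j i x \<inter> cell M t" "cell M t"] by simp
  have m2: "?m j i \<le> 1 / 2 ^ i" for j i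
    using finite_measure_mono[of "flip_cell j i x \<inter> cell M t" "flip_cell j i x"] by simp
  have pN: "(2::real) ^ M \<le> 2 ^ N" using MN by simp
  have coarse: "?F j i \<le> 2 ^ (j + i) / 4 ^ M * indicator (flip_cell j i t) x" if "i \<le> M" for i j
  proof (cases "x \<in> flip_cell j i t")
    case True
    have "?F j i \<le> 2 ^ (j + i) / 2 ^ M * (1 / 2 ^ M)"
      using pN m1 by (intro mult_mono divide_left_mono) auto
    also have "\<dots> = 2 ^ (j + i) / 4 ^ M"
      by (simp add: power_mult_distrib[symmetric])
    finally show ?thesis using True by simp
  next
    case False
    have "u \<notin> cell M t" if "u \<in> flip_cell j i x" for u
    proof
      assume u: "u \<in> cell M t"
      have "x \<in> flip_cell j i u" using that x flip_cell_sym by (metis mem_flip_cell_iff)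
      then show False using False flip_cell_coarser[OF u \<open>i \<le> M\<close>] by simp
    qed
    then have "flip_cell j i x \<inter> cell M t = {}" by blast
    then show ?thesis by simp
  qed
  have fine: "?F j i \<le> (if j < M then 2 ^ j / 2 ^ N * indicator (flip_cell j M t) x else 0)"
    if "M < i" for i j
  proof (cases "flip_cell j i x \<inter> cell M t = {}")
    case True
    then show ?thesis by simp
  next
    case False
    then obtain u where u: "u \<in> flip_cell j i x" "u \<in> cell M t" by blast
    have jM: "j < M"
    proof (rule ccontr)
      assume "\<not> j < M"
      then have "u \<in> cell M x" using u(1) that by (auto simp: mem_flip_cell_iff mem_cell_iff)
      then have "x \<in> cell M t" using u(2) x(1) by (auto simp: mem_cell_iff)
      then show False using x by simp
    qed
    have "u \<in> flip_cell j M x" using u(1) that by (auto simp: mem_flip_cell_iff)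
    then have "x \<in> flip_cell j M u" using x flip_cell_sym by (metis mem_flip_cell_iff)
    then have "x \<in> flip_cell j M t" using flip_cell_coarser[OF u(2)] by simp
    moreover have "?F j i \<le> 2 ^ (j + i) / 2 ^ N * (1 / 2 ^ i)"
      using m2 by (intro mult_left_mono) auto
    ultimately show ?thesis using jM by (simp add: power_add)
  qed
  have "(\<Sum>i\<le>M. \<Sum>j\<le>i. ?F j i) \<le> atom_shadow M t x"
    unfolding atom_shadow_def by (intro sum_mono coarse) auto
  moreover have "(\<Sum>i\<in>{M<..N}. \<Sum>j\<le>i. ?F j i) \<le> atom_shadow M t x"
  proof -
    let ?s = "\<Sum>j<M. 2 ^ j / 2 ^ N * indicator (flip_cell j M t) x :: real"
    have "(\<Sum>j\<le>i. ?F j i) \<le> ?s" if "i \<in> {M<..N}" for i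
    proof -
      have "(\<Sum>j\<le>i. ?F j i) \<le> (\<Sum>j\<le>i. if j < M then 2 ^ j / 2 ^ N * indicator (flip_cell j M t) x else 0)"
        using that by (intro sum_mono fine) auto
      also have "\<dots> = (\<Sum>j\<in>{..i} \<inter> {..<M}. 2 ^ j / 2 ^ N * indicator (flip_cell j M t) x)"
        by (subst sum.inter_restrict) (auto intro!: sum.cong)
      also have "{..i} \<inter> {..<M} = {..<M}" using that by auto
      finally show ?thesis .
    qed
    then have "(\<Sum>i\<in>{M<..N}. \<Sum>j\<le>i. ?F j i) \<le> real (card {M<..N}) * ?s"
      by (rule sum_bounded_above)
    also have "\<dots> = (\<Sum>j<M. (real (N - M) / 2 ^ N) * (2 ^ j * indicator (flip_cell j M t) x))"
      by (simp add: sum_distrib_left)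
    also have "\<dots> \<le> (\<Sum>j<M. (1 / 2 ^ M) * (2 ^ j * indicator (flip_cell j M t) x))"
    proof (intro sum_mono mult_right_mono)
      have "real (N - M) \<le> 2 ^ (N - M)" by (simp add: of_nat_less_two_power less_imp_le)
      moreover have "(2::real) ^ N = 2 ^ M * 2 ^ (N - M)" using MN by (simp add: power_add[symmetric])
      ultimately show "real (N - M) / 2 ^ N \<le> 1 / 2 ^ M"
        by (simp add: divide_simps del: of_nat_diff)
    qed auto
    also have "\<dots> = (\<Sum>j<M. 2 ^ (j + M) / 4 ^ M * indicator (flip_cell j M t) x)"
    proof (intro sum.cong refl)
      fix j
      have "(4::real) ^ M = 2 ^ M * 2 ^ M" by (simp add: power_mult_distrib[symmetric])
      then show "(1 / 2 ^ M) * (2 ^ j * indicator (flip_cell j M t) x) =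
          (2 ^ (j + M) / 4 ^ M * indicator (flip_cell j M t) x :: real)"
        by (simp add: power_add)
    qed
    also have "\<dots> \<le> atom_shadow M t x" by (rule atom_shadow_ge) auto
    finally show ?thesis .
  qed
  moreover have "(\<Sum>i\<le>N. \<Sum>j\<le>i. ?F j i) = (\<Sum>i\<le>M. \<Sum>j\<le>i. ?F j i) + (\<Sum>i\<in>{M<..N}. \<Sum>j\<le>i. ?F j i)"
    using MN by (subst sum.union_disjoint[symmetric]) (auto intro!: sum.cong)
  ultimately have "(\<Sum>i\<le>N. \<Sum>j\<le>i. ?F j i) \<le> 2 * atom_shadow M t x" by linarith
  then have "2 * B * (\<Sum>i\<le>N. \<Sum>j\<le>i. ?F j i) \<le> 2 * B * (2 * atom_shadow M t x)"
    using B0 by (intro mult_left_mono) auto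
  then show ?thesis using kernel_integral_bound[OF a B N, of M t x] by simp
qed

text \<open>This splits integrals of functions vanishing off a family of disjoint cells.\<close>

lemma disjoint_cells_decomposition:
  fixes y :: real
  assumes fin: "finite P" and disj: "disjoint_family_on (\<lambda>(m, t). cell m t) P"
    and supp: "u \<notin> (\<Union>(m, t)\<in>P. cell m t) \<Longrightarrow> y = 0"
  shows "y = (\<Sum>(m, t)\<in>P. indicator (cell m t) u * y)"
proof -
  have "indicator (\<Union>q\<in>P. (\<lambda>(m, t). cell m t) q) u = (\<Sum>q\<in>P. indicator ((\<lambda>(m, t). cell m t) q) u :: real)"
    by (rule indicator_UN_disjoint[OF fin disj])
  then have s: "(\<Sum>(m, t)\<in>P. indicator (cell m t) u :: real) = indicator (\<Union>(m, t)\<in>P. cell m t) u"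
    by (simp add: case_prod_beta')
  have "(\<Sum>(m, t)\<in>P. indicator (cell m t) u * y) = (\<Sum>(m, t)\<in>P. indicator (cell m t) u) * y"
    by (simp add: sum_distrib_right case_prod_beta')
  also have "\<dots> = y"
    unfolding s using supp by (cases "u \<in> (\<Union>(m, t)\<in>P. cell m t)") (simp_all only: indicator_simps mult_1 mult_zero_right not_False_eq_True simp_thms)
  finally show ?thesis by simp
qed

lemma fejer_atoms_bound:
  assumes a: "dyadic_step T a" and B: "\<And>t. t \<in> {0..<1} \<Longrightarrow> \<bar>a t\<bar> \<le> B" and n: "1 \<le> n"
    and fin: "finite P" and disj: "disjoint_family_on (\<lambda>(m, t). cell m t) P"
    and P: "\<And>m t. (m, t) \<in> P \<Longrightarrow> t \<in> {0..<1}"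
    and mean: "\<And>m t. (m, t) \<in> P \<Longrightarrow> (LINT u|unit_leb. indicator (cell m t) u * a u) = 0"
    and supp: "\<And>u. u \<in> {0..<1} \<Longrightarrow> u \<notin> (\<Union>(m, t)\<in>P. cell m t) \<Longrightarrow> a u = 0"
    and x: "x \<in> {0..<1}" "x \<notin> (\<Union>(m, t)\<in>P. cell m t)"
  shows "\<bar>fejer_op n a x\<bar> \<le> 4 * B * shadow P x"
proof -
  have int: "integrable unit_leb (\<lambda>u. indicator (cell m t) u * (a u * fejer_kernel n x u))" for m t
    using dyadic_step_cell dyadic_step_comp2[OF a dyadic_step_kernel', where F = "(*)"]
    by (rule integrable_step_mult)
  have "fejer_op n a x = (LINT u|unit_leb. (\<Sum>(m, t)\<in>P. indicator (cell m t) u * (a u * fejer_kernel n x u)))"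
    unfolding fejer_op_def
  proof (intro Bochner_Integration.integral_cong refl)
    fix u assume "u \<in> space unit_leb"
    then have "a u * fejer_kernel n x u = 0" if "u \<notin> (\<Union>(m, t)\<in>P. cell m t)"
      using supp[OF _ that] by simp
    then show "a u * fejer_kernel n x u = (\<Sum>(m, t)\<in>P. indicator (cell m t) u * (a u * fejer_kernel n x u))"
      by (rule disjoint_cells_decomposition[OF fin disj])
  qed
  also have "\<dots> = (\<Sum>q\<in>P. LINT u|unit_leb. (case q of (m, t) \<Rightarrow> indicator (cell m t) u * (a u * fejer_kernel n x u)))"
    by (rule Bochner_Integration.integral_sum) (use int in auto)
  finally have "\<bar>fejer_op n a x\<bar> \<le> (\<Sum>q\<in>P. \<bar>LINT u|unit_leb. (case q of (m, t) \<Rightarrow> indicator (cell m t) u * (a u * fejer_kernel n x u))\<bar>)"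
    by simp
  also have "\<dots> \<le> (\<Sum>q\<in>P. 4 * B * (case q of (m, t) \<Rightarrow> atom_shadow m t x))"
  proof (rule sum_mono)
    fix q assume q: "q \<in> P"
    obtain m t where [simp]: "q = (m, t)" by fastforce
    have "x \<notin> cell m t" using x q by auto
    then show "\<bar>LINT u|unit_leb. (case q of (m, t) \<Rightarrow> indicator (cell m t) u * (a u * fejer_kernel n x u))\<bar>
        \<le> 4 * B * (case q of (m, t) \<Rightarrow> atom_shadow m t x)"
      using fejer_atom_bound[OF a B n _ x(1), of t m] P mean q by simp
  qed
  finally show ?thesis by (simp add: shadow_def sum_distrib_left)
qed

section \<open>Calderon--Zygmund decomposition along stopping cells\<close>

definition cell_avg :: "nat \<Rightarrow> (real \<Rightarrow> real) \<Rightarrow> real \<Rightarrow> real" where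
  "cell_avg n h t = 2 ^ n * (LINT u|unit_leb. indicator (cell n t) u * h u)"

text \<open>The cells on which the stopping happens are the parents of cells with a large average: the
  average over a stopping cell is then still small.\<close>

definition has_large_child :: "nat \<Rightarrow> (real \<Rightarrow> real) \<Rightarrow> real \<Rightarrow> nat \<Rightarrow> real \<Rightarrow> bool" where
  "has_large_child T h c n t \<longleftrightarrow> n < T \<and> (\<exists>u\<in>cell n t. c < \<bar>cell_avg (Suc n) h u\<bar>)"

definition stops :: "nat \<Rightarrow> (real \<Rightarrow> real) \<Rightarrow> real \<Rightarrow> nat \<Rightarrow> real \<Rightarrow> bool" where
  "stops T h c n t \<longleftrightarrow> has_large_child T h c n t \<and> (\<forall>i<n. \<not> has_large_child T h c i t)"

definition stop_cells :: "nat \<Rightarrow> (real \<Rightarrow> real) \<Rightarrow> real \<Rightarrow> (nat \<times> real) set" where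
  "stop_cells T h c = (\<lambda>(n, k). (n, real k / 2 ^ n)) ` {(n, k). n < T \<and> k < 2 ^ n \<and> stops T h c n (real k / 2 ^ n)}"

text \<open>The conditional expectation of \<open>h\<close> along the stopping cells; nothing is changed elsewhere.\<close>

definition stopped :: "nat \<Rightarrow> (real \<Rightarrow> real) \<Rightarrow> real \<Rightarrow> real \<Rightarrow> real" where
  "stopped T h c t = (if \<exists>n. stops T h c n t then cell_avg (THE n. stops T h c n t) h t else h t)"

lemma cell_avg_cell: "u \<in> cell n t \<Longrightarrow> cell_avg n h u = cell_avg n h t"
  by (simp add: cell_avg_def cell_eq)

lemma integral_indicator_cell: "(LINT u|unit_leb. indicator (cell n t) u * (c::real)) = c / 2 ^ n"
  using sets.sets_into_space[OF cell_sets[of n t]] by (simp add: Int_absorb2)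

lemma cell_avg_top:
  assumes "dyadic_step T h" "t \<in> {0..<1}"
  shows "cell_avg T h t = h t"
proof -
  have "(LINT u|unit_leb. indicator (cell T t) u * h u) = (LINT u|unit_leb. indicator (cell T t) u * h t)"
    by (intro Bochner_Integration.integral_cong) (auto simp: indicator_def dyadic_stepD[OF assms])
  then show ?thesis unfolding cell_avg_def integral_indicator_cell by simp
qed

lemma integrable_cell_step: "dyadic_step T h \<Longrightarrow> integrable unit_leb (\<lambda>u. indicator (cell n t) u * h u)"
  by (rule integrable_step_mult[OF dyadic_step_cell])

lemma cell_avg_bounded:
  assumes h: "dyadic_step T h" and B: "\<And>t. t \<in> {0..<1} \<Longrightarrow> \<bar>h t\<bar> \<le> B"
  shows "\<bar>cell_avg n h t\<bar> \<le> B"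
proof -
  have "\<bar>LINT u|unit_leb. indicator (cell n t) u * h u\<bar> \<le> (LINT u|unit_leb. \<bar>indicator (cell n t) u * h u\<bar>)"
    by (rule integral_abs_bound)
  also have "\<dots> \<le> (LINT u|unit_leb. indicator (cell n t) u * B)"
    using integrable_cell_step[OF h] integrable_cell_step[OF dyadic_step_const]
    by (intro integral_mono integrable_abs) (auto simp: indicator_def B)
  also have "\<dots> = B / 2 ^ n" by (rule integral_indicator_cell)
  finally show ?thesis by (simp add: cell_avg_def abs_mult field_simps)
qed

lemma has_large_child_cell: "u \<in> cell n t \<Longrightarrow> has_large_child T h c n u \<longleftrightarrow> has_large_child T h c n t"
  by (simp add: has_large_child_def cell_eq)

lemma has_large_child_antimono: "has_large_child T h c' n t \<Longrightarrow> c \<le> c' \<Longrightarrow> has_large_child T h c n t"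
  by (force simp: has_large_child_def)

lemma stops_cell:
  assumes "u \<in> cell n t"
  shows "stops T h c n u \<longleftrightarrow> stops T h c n t"
proof -
  have "has_large_child T h c i u \<longleftrightarrow> has_large_child T h c i t" if "i \<le> n" for i
    using assms cell_mono[OF that] by (intro has_large_child_cell) blast
  then show ?thesis by (simp add: stops_def)
qed

lemma stops_unique: "stops T h c n t \<Longrightarrow> stops T h c m t \<Longrightarrow> n = m"
  unfolding stops_def using linorder_neqE_nat[of n m] by blast

lemma stops_exists:
  assumes "has_large_child T h c n t"
  shows "\<exists>m\<le>n. stops T h c m t"
proof (intro exI conjI)
  let ?m = "LEAST m. has_large_child T h c m t"
  show "?m \<le> n" using assms by (rule Least_le)
  show "stops T h c ?m t"
    unfolding stops_def using LeastI[of "\<lambda>m. has_large_child T h c m t", OF assms] not_less_Least by blast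
qed

lemma stops_less: "stops T h c n t \<Longrightarrow> n < T"
  by (simp add: stops_def has_large_child_def)

lemma stops_antimono: "stops T h c' n t \<Longrightarrow> c \<le> c' \<Longrightarrow> \<exists>m\<le>n. stops T h c m t"
  by (rule stops_exists, rule has_large_child_antimono[of T h c']) (auto simp: stops_def)

lemma stopped_eq: "stops T h c n t \<Longrightarrow> stopped T h c t = cell_avg n h t"
proof -
  assume n: "stops T h c n t"
  then have "(THE n. stops T h c n t) = n" by (intro the_equality) (auto dest: stops_unique)
  then show ?thesis using n by (auto simp: stopped_def)
qed

lemma stopped_off: "\<nexists>n. stops T h c n t \<Longrightarrow> stopped T h c t = h t"
  by (simp add: stopped_def)

lemma finite_stop_cells [simp]: "finite (stop_cells T h c)"
proof -
  have "{(n, k). n < T \<and> k < 2 ^ n \<and> stops T h c n (real k / 2 ^ n)} \<subseteq> (SIGMA n:{..<T}. {..<2 ^ n})"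
    by auto
  then have "finite {(n, k). n < T \<and> k < 2 ^ n \<and> stops T h c n (real k / 2 ^ n)}"
    by (rule finite_subset) auto
  then show ?thesis unfolding stop_cells_def by blast
qed

lemma stop_cellsD:
  assumes "(n, t) \<in> stop_cells T h c"
  shows "t \<in> {0..<1}" "stops T h c n t"
  using assms left_endpoint_unit by (auto simp: stop_cells_def)

lemma Union_stop_cells:
  assumes "t \<in> {0..<1}"
  shows "t \<in> (\<Union>(n, s)\<in>stop_cells T h c. cell n s) \<longleftrightarrow> (\<exists>n. stops T h c n t)"
proof
  assume "t \<in> (\<Union>(n, s)\<in>stop_cells T h c. cell n s)"
  then obtain n s where "(n, s) \<in> stop_cells T h c" "t \<in> cell n s" by blast
  then show "\<exists>n. stops T h c n t" using stop_cellsD(2) stops_cell by blast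
next
  assume "\<exists>n. stops T h c n t"
  then obtain n where n: "stops T h c n t" by blast
  obtain k where k: "k < 2 ^ n" "cell n t = dyadic_interval n k"
    using cell_is_dyadic_interval by blast
  have s: "real k / 2 ^ n \<in> cell n t" using k left_endpoint_mem by metis
  then have "(n, real k / 2 ^ n) \<in> stop_cells T h c"
    using n k stops_less[OF n] stops_cell[OF s] by (force simp: stop_cells_def)
  moreover have "t \<in> cell n (real k / 2 ^ n)" using cell_eq[OF s] assms by simp
  ultimately show "t \<in> (\<Union>(n, s)\<in>stop_cells T h c. cell n s)" by blast
qed

lemma disjoint_stop_cells: "disjoint_family_on (\<lambda>(n, t). cell n t) (stop_cells T h c)"
proof -
  have "(n, t) = (m, r)"
    if nt: "(n, t) \<in> stop_cells T h c" and mr: "(m, r) \<in> stop_cells T h c" and u: "u \<in> cell n t" "u \<in> cell m r"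
    for n m t r u
  proof -
    have "stops T h c n u" "stops T h c m u"
      using stop_cellsD(2)[OF nt] stop_cellsD(2)[OF mr] u stops_cell by blast+
    then have nm: "n = m" by (rule stops_unique)
    obtain k k' where k: "k < 2 ^ n" "t = real k / 2 ^ n" "k' < 2 ^ m" "r = real k' / 2 ^ m"
      using nt mr by (auto simp: stop_cells_def)
    have "dyadic_interval n k = cell n t" "dyadic_interval m k' = cell m r"
      using k dyadic_interval_eq_cell left_endpoint_mem by blast+
    then have "k = k'" using u nm dyadic_interval_unique[of u n] by simp
    then show ?thesis using k nm by simp
  qed
  then show ?thesis unfolding disjoint_family_on_def by fastforce
qed

lemma dyadic_step_stopped:
  assumes h: "dyadic_step T h"
  shows "dyadic_step T (stopped T h c)"
  unfolding dyadic_step_def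
proof (intro ballI)
  fix x y assume x: "x \<in> {0..<1}" and y: "y \<in> cell T x"
  have s: "stops T h c n y \<longleftrightarrow> stops T h c n x" for n
  proof (cases "n < T")
    case True
    then have "y \<in> cell n x" using y cell_mono[of n T x] by auto
    then show ?thesis by (rule stops_cell)
  qed (use stops_less in blast)
  show "stopped T h c y = stopped T h c x"
  proof (cases "\<exists>n. stops T h c n x")
    case True
    then obtain n where n: "stops T h c n x" by blast
    have "y \<in> cell n x" using y stops_less[OF n] cell_mono[of n T x] by auto
    then have "cell_avg n h y = cell_avg n h x" by (rule cell_avg_cell)
    then show ?thesis using n s[of n] stopped_eq[of T h c n] by simp
  next
    case False
    moreover from this have "\<nexists>n. stops T h c n y" using s by simp
    ultimately show ?thesis using dyadic_stepD[OF h x y] by (simp add: stopped_off)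
  qed
qed

text \<open>Before a cell stops, none of its ancestors has a child with a large average; since the cell is
  itself such a child, its own average is small. The average over \<open>{0..<1}\<close> is nobody's child and
  has to be assumed small.\<close>

lemma stopped_bounded:
  assumes h: "dyadic_step T h" and c0: "\<bar>cell_avg 0 h 0\<bar> \<le> c" and t: "t \<in> {0..<1}"
  shows "\<bar>stopped T h c t\<bar> \<le> c"
proof -
  have avg: "\<bar>cell_avg n h t\<bar> \<le> c" if "n \<le> T" "\<forall>i<n. \<not> has_large_child T h c i t" for n
  proof (cases n)
    case 0
    then show ?thesis using c0 by (simp add: cell_avg_def)
  next
    case (Suc m)
    then have "\<not> has_large_child T h c m t" "m < T" using that by auto
    then have "\<not> c < \<bar>cell_avg (Suc m) h t\<bar>"
      using cell_self[OF t, of m] unfolding has_large_child_def by blast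
    then show ?thesis using Suc by simp
  qed
  show ?thesis
  proof (cases "\<exists>n. stops T h c n t")
    case True
    then obtain n where n: "stops T h c n t" by blast
    then have "\<forall>i<n. \<not> has_large_child T h c i t" by (simp add: stops_def)
    then show ?thesis using avg[of n] stops_less[OF n] stopped_eq[OF n] by simp
  next
    case False
    then have "\<forall>i<T. \<not> has_large_child T h c i t" using stops_exists by blast
    then show ?thesis using avg[of T] cell_avg_top[OF h t] stopped_off[OF False] by simp
  qed
qed

lemma stopped_mean:
  assumes h: "dyadic_step T h" and n: "stops T h c n t"
  shows "(LINT u|unit_leb. indicator (cell n t) u * (h u - stopped T h c u)) = 0"
proof -
  have "stopped T h c u = cell_avg n h t" if "u \<in> cell n t" for u
    using stopped_eq[of T h c n u] n stops_cell[OF that] cell_avg_cell[OF that] by simp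
  then have "(LINT u|unit_leb. indicator (cell n t) u * (h u - stopped T h c u))
      = (LINT u|unit_leb. indicator (cell n t) u * h u - indicator (cell n t) u * cell_avg n h t)"
    by (intro Bochner_Integration.integral_cong refl)
       (auto simp: indicator_def)
  also have "\<dots> = (LINT u|unit_leb. indicator (cell n t) u * h u) - (LINT u|unit_leb. indicator (cell n t) u * cell_avg n h t)"
    by (intro Bochner_Integration.integral_diff integrable_cell_step[OF h] integrable_cell_step[OF dyadic_step_const])
  also have "\<dots> = 0" unfolding integral_indicator_cell by (simp add: cell_avg_def)
  finally show ?thesis .
qed

text \<open>Raising the level refines the stopping cells, so a stopping cell of the lower level is, up
  to a set where nothing is changed, a union of stopping cells of the higher level.\<close>

lemma stopped_mean_coarser:
  assumes h: "dyadic_step T h" and n: "stops T h c n t" and t: "t \<in> {0..<1}" and c: "c \<le> c'"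
  shows "(LINT u|unit_leb. indicator (cell n t) u * (h u - stopped T h c' u)) = 0"
proof -
  let ?b = "\<lambda>u. h u - stopped T h c' u"
  let ?P = "stop_cells T h c'"
  have b: "dyadic_step T ?b"
    using dyadic_step_comp2[OF h dyadic_step_stopped[OF h], of "(-)"] by simp
  have ind_b: "dyadic_step (max n T) (\<lambda>u. indicator (cell n t) u * ?b u)"
    using dyadic_step_comp2[OF dyadic_step_cell b, where F = "(*)"] by simp
  have z: "(LINT u|unit_leb. indicator (cell m s) u * (indicator (cell n t) u * ?b u)) = 0"
    if ms: "(m, s) \<in> ?P" for m s
  proof (cases "cell m s \<inter> cell n t = {}")
    case True
    then have "(LINT u|unit_leb. indicator (cell m s) u * (indicator (cell n t) u * ?b u)) = (LINT u|unit_leb. 0)"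
      by (intro Bochner_Integration.integral_cong) (auto simp: indicator_def)
    then show ?thesis by simp
  next
    case False
    then obtain u where u: "u \<in> cell m s" "u \<in> cell n t" by blast
    have "stops T h c' m u" using stop_cellsD(2)[OF ms] stops_cell[OF u(1)] by blast
    then obtain m' where m': "m' \<le> m" "stops T h c m' u" using stops_antimono[OF _ c] by blast
    have "stops T h c n u" using n stops_cell[OF u(2)] by blast
    then have "n \<le> m" using stops_unique[OF m'(2)] m'(1) by blast
    then have "cell m s \<subseteq> cell n t"
      using cell_eq[OF u(1)] cell_eq[OF u(2)] cell_mono by blast
    then have "(LINT u|unit_leb. indicator (cell m s) u * (indicator (cell n t) u * ?b u))
        = (LINT u|unit_leb. indicator (cell m s) u * ?b u)"
      by (intro Bochner_Integration.integral_cong) (auto simp: indicator_def)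
    then show ?thesis using stopped_mean[OF h stop_cellsD(2)[OF ms]] by simp
  qed
  have "(LINT u|unit_leb. indicator (cell n t) u * ?b u)
      = (LINT u|unit_leb. (\<Sum>(m, s)\<in>?P. indicator (cell m s) u * (indicator (cell n t) u * ?b u)))"
  proof (intro Bochner_Integration.integral_cong refl disjoint_cells_decomposition finite_stop_cells disjoint_stop_cells)
    fix u assume u: "u \<in> space unit_leb" "u \<notin> (\<Union>(m, t)\<in>?P. cell m t)"
    then show "indicator (cell n t) u * ?b u = 0"
      using Union_stop_cells[of u T h c'] stopped_off[of T h c' u] by simp
  qed
  also have "\<dots> = (\<Sum>q\<in>?P. LINT u|unit_leb. (case q of (m, s) \<Rightarrow> indicator (cell m s) u * (indicator (cell n t) u * ?b u)))"
    by (rule Bochner_Integration.integral_sum) (use integrable_cell_step[OF ind_b] in auto)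
  also have "\<dots> = 0" by (rule sum.neutral) (use z in auto)
  finally show ?thesis .
qed

lemma fejer_op_diff:
  assumes "dyadic_step T f" "dyadic_step T g"
  shows "fejer_op n (\<lambda>u. f u - g u) x = fejer_op n f x - fejer_op n g x"
  unfolding fejer_op_def left_diff_distrib
  by (intro Bochner_Integration.integral_diff integrable_fejer[OF assms(1)] integrable_fejer[OF assms(2)])

lemma shadow_ge_1:
  assumes "finite P" "x \<in> (\<Union>(n, t)\<in>P. cell n t)"
  shows "1 \<le> shadow P x"
proof -
  obtain n t where nt: "(n, t) \<in> P" "x \<in> cell n t" using assms by blast
  have "1 \<le> atom_shadow n t x" by (rule atom_shadow_on_cell) fact
  also have "\<dots> \<le> shadow P x"
    unfolding shadow_def
    using member_le_sum[OF nt(1), of "\<lambda>(n, t). atom_shadow n t x"] assms atom_shadow_nonneg by auto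
  finally show ?thesis .
qed

text \<open>The function \<open>h\<close> is the sum of the function stopped at level \<open>c\<close>, which is bounded by \<open>c\<close>,
  and of the differences of the functions stopped at consecutive levels \<open>c * 2 ^ l\<close>, which are sums
  of atoms of height \<open>3 * c * 2 ^ l\<close> on the stopping cells. The shadow of a family of cells is at
  least 1 on the cells themselves, so the first alternative covers the supports of all atoms.\<close>

lemma fejer_op_pointwise:
  assumes h: "dyadic_step T h" and c: "0 < c" and c0: "\<bar>cell_avg 0 h 0\<bar> \<le> c"
  shows "\<exists>L. \<forall>x\<in>{0..<1}. \<forall>n\<ge>1. 1 \<le> shadow (stop_cells T h c) x \<or>
     \<bar>fejer_op n h x\<bar> \<le> 8 * c + (\<Sum>l<L. 12 * c * 2 ^ l * shadow (stop_cells T h (c * 2 ^ l)) x)"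
proof -
  obtain B where B: "0 \<le> B" "\<And>t. t \<in> {0..<1} \<Longrightarrow> \<bar>h t\<bar> \<le> B"
    using dyadic_step_bounded[OF h] by blast
  obtain L where L: "B / c < 2 ^ L" using real_arch_pow[of 2 "B / c"] by auto
  then have Lc: "B \<le> c * 2 ^ L" using c by (simp add: field_simps)
  \<comment> \<open>At the level \<open>c * 2 ^ L\<close> nothing stops any more.\<close>
  let ?g = "\<lambda>l. stopped T h (c * 2 ^ l)"
  have gh: "?g L t = h t" for t
  proof (rule stopped_off)
    have "\<not> has_large_child T h (c * 2 ^ L) n t" for n
      using cell_avg_bounded[OF h B(2), of "Suc n"] Lc
      unfolding has_large_child_def by (meson not_less order_trans)
    then show "\<nexists>n. stops T h (c * 2 ^ L) n t" by (simp add: stops_def)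
  qed
  have gb: "\<bar>?g l t\<bar> \<le> c * 2 ^ l" if "t \<in> {0..<1}" for l t
  proof (rule stopped_bounded[OF h _ that])
    have "c * 1 \<le> c * 2 ^ l" using c by (intro mult_left_mono) auto
    then show "\<bar>cell_avg 0 h 0\<bar> \<le> c * 2 ^ l" using c0 by simp
  qed
  have gs: "dyadic_step T (?g l)" for l by (rule dyadic_step_stopped[OF h])
  let ?a = "\<lambda>l u. ?g (Suc l) u - ?g l u"
  have as: "dyadic_step T (?a l)" for l
    using dyadic_step_comp2[OF gs gs, where F = "(-)"] by (simp del: power_Suc)
  have step_le: "c * 2 ^ l \<le> c * 2 ^ Suc l" for l using c by (intro mult_left_mono) auto
  have main: "\<bar>fejer_op n (?a l) x\<bar> \<le> 12 * c * 2 ^ l * shadow (stop_cells T h (c * 2 ^ l)) x"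
    if x: "x \<in> {0..<1}" "\<nexists>n. stops T h c n x" and n: "1 \<le> n" for x n l
  proof -
    let ?P = "stop_cells T h (c * 2 ^ l)"
    have ab: "\<bar>?a l t\<bar> \<le> 3 * (c * 2 ^ l)" if "t \<in> {0..<1}" for t
      using gb[OF that, of l] gb[OF that, of "Suc l"] by simp
    have "c * 1 \<le> c * 2 ^ l" using c by (intro mult_left_mono) auto
    then have xP: "x \<notin> (\<Union>(m, t)\<in>?P. cell m t)"
      unfolding Union_stop_cells[OF x(1)] using x(2) stops_antimono[of T h "c * 2 ^ l" _ x c] by auto
    have supp: "?a l u = 0" if "u \<in> {0..<1}" "u \<notin> (\<Union>(m, t)\<in>?P. cell m t)" for u
    proof -
      have "\<nexists>n. stops T h (c * 2 ^ l) n u" using that(2) unfolding Union_stop_cells[OF that(1)] .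
      moreover from this have "\<nexists>n. stops T h (c * 2 ^ Suc l) n u"
        using stops_antimono[OF _ step_le] by blast
      ultimately show ?thesis using stopped_off[of T h _ u] by simp
    qed
    have mean: "(LINT u|unit_leb. indicator (cell m t) u * ?a l u) = 0" if mt: "(m, t) \<in> ?P" for m t
    proof -
      have i: "integrable unit_leb (\<lambda>u. indicator (cell m t) u * (h u - ?g k u))" for k
        using integrable_cell_step[OF dyadic_step_comp2[OF h gs, where F = "(-)"]] .
      have "(LINT u|unit_leb. indicator (cell m t) u * ?a l u)
          = (LINT u|unit_leb. indicator (cell m t) u * (h u - ?g l u) - indicator (cell m t) u * (h u - ?g (Suc l) u))"
        by (intro Bochner_Integration.integral_cong) (auto simp: algebra_simps)
      also have "\<dots> = (LINT u|unit_leb. indicator (cell m t) u * (h u - ?g l u))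
          - (LINT u|unit_leb. indicator (cell m t) u * (h u - ?g (Suc l) u))"
        by (intro Bochner_Integration.integral_diff i)
      also have "\<dots> = 0"
        using stopped_mean[OF h stop_cellsD(2)[OF mt]]
          stopped_mean_coarser[OF h stop_cellsD(2)[OF mt] stop_cellsD(1)[OF mt] step_le] by simp
      finally show ?thesis .
    qed
    have "\<bar>fejer_op n (?a l) x\<bar> \<le> 4 * (3 * (c * 2 ^ l)) * shadow ?P x"
      using as ab n finite_stop_cells disjoint_stop_cells stop_cellsD(1) mean supp x(1) xP
      by (rule fejer_atoms_bound)
    then show ?thesis by (simp add: mult.assoc)
  qed
  have tele: "fejer_op n (?g k) x = fejer_op n (?g 0) x + (\<Sum>l<k. fejer_op n (?a l) x)" for n k x
    by (induction k) (simp_all add: fejer_op_diff[OF gs gs] del: power_Suc)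
  show ?thesis
  proof (intro exI[of _ L] ballI allI impI)
    fix x :: real and n :: nat assume x: "x \<in> {0..<1}" and n: "1 \<le> n"
    show "1 \<le> shadow (stop_cells T h c) x \<or>
     \<bar>fejer_op n h x\<bar> \<le> 8 * c + (\<Sum>l<L. 12 * c * 2 ^ l * shadow (stop_cells T h (c * 2 ^ l)) x)"
    proof (cases "\<exists>n. stops T h c n x")
      case True
      then have "x \<in> (\<Union>(n, s)\<in>stop_cells T h c. cell n s)" unfolding Union_stop_cells[OF x] .
      then have "1 \<le> shadow (stop_cells T h c) x" by (rule shadow_ge_1[OF finite_stop_cells])
      then show ?thesis by (rule disjI1)
    next
      case False
      have "?g L = h" using gh by blast
      then have "fejer_op n h x = fejer_op n (?g 0) x + (\<Sum>l<L. fejer_op n (?a l) x)" using tele[of n L x] by simp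
      then have "\<bar>fejer_op n h x\<bar> \<le> \<bar>fejer_op n (?g 0) x\<bar> + (\<Sum>l<L. \<bar>fejer_op n (?a l) x\<bar>)"
        using sum_abs[of "\<lambda>l. fejer_op n (?a l) x" "{..<L}"] by linarith
      also have "\<dots> \<le> 8 * c + (\<Sum>l<L. 12 * c * 2 ^ l * shadow (stop_cells T h (c * 2 ^ l)) x)"
        using fejer_op_bounded[OF gs[of 0] gb[of _ 0] n, of x] by (intro add_mono sum_mono main[OF x False n]) auto
      finally show ?thesis by blast
    qed
  qed
qed

lemma stop_cell_has_large_child:
  assumes "(n, t) \<in> stop_cells T h c"
  obtains u where "u \<in> cell n t" "cell (Suc n) u \<subseteq> {x \<in> {0..<1}. \<exists>k\<le>T. c < \<bar>cell_avg k h x\<bar>}"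
proof -
  have "has_large_child T h c n t" using stop_cellsD(2)[OF assms] by (simp add: stops_def)
  then obtain u where u: "u \<in> cell n t" "c < \<bar>cell_avg (Suc n) h u\<bar>" "n < T"
    by (auto simp: has_large_child_def)
  have "cell (Suc n) u \<subseteq> {x \<in> {0..<1}. \<exists>k\<le>T. c < \<bar>cell_avg k h x\<bar>}"
  proof
    fix x assume x: "x \<in> cell (Suc n) u"
    then show "x \<in> {x \<in> {0..<1}. \<exists>k\<le>T. c < \<bar>cell_avg k h x\<bar>}"
      using u cell_avg_cell[OF x] subsetD[OF cell_subset_unit x] by (auto intro!: exI[of _ "Suc n"])
  qed
  then show ?thesis using u that by blast
qed

section \<open>Inequalities for powers and geometric sums\<close>

lemma powr_add_le:
  fixes x y r :: real
  assumes "0 \<le> x" "0 \<le> y" "0 < r" "r \<le> 1"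
  shows "(x + y) powr r \<le> x powr r + y powr r"
proof (cases "x + y = 0")
  case False
  then have s: "0 < x + y" using assms by simp
  have le: "z / (x + y) * (x + y) powr r \<le> z powr r" if "0 \<le> z" "z \<le> x + y" for z
  proof -
    have "z / (x + y) \<le> (z / (x + y)) powr r"
      using powr_mono'[of r 1 "z / (x + y)"] that s assms by (simp add: divide_simps)
    then have "z / (x + y) * (x + y) powr r \<le> (z / (x + y)) powr r * (x + y) powr r"
      by (rule mult_right_mono) simp
    also have "\<dots> = z powr r" using that s by (simp add: powr_mult[symmetric])
    finally show ?thesis .
  qed
  have "(x + y) powr r = x / (x + y) * (x + y) powr r + y / (x + y) * (x + y) powr r"
    using s by (simp add: add_divide_distrib[symmetric] distrib_right[symmetric])
  also have "\<dots> \<le> x powr r + y powr r"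
    using assms by (intro add_mono le) auto
  finally show ?thesis .
qed (use assms in auto)

lemma powr_sum_le:
  fixes f :: "'a \<Rightarrow> real"
  assumes "finite A" "\<And>a. a \<in> A \<Longrightarrow> 0 \<le> f a" "0 < r" "r \<le> 1"
  shows "(\<Sum>a\<in>A. f a) powr r \<le> (\<Sum>a\<in>A. f a powr r)"
  using assms(1,2)
proof (induction A rule: finite_induct)
  case (insert a A)
  have "(f a + sum f A) powr r \<le> f a powr r + sum f A powr r"
    using insert assms by (intro powr_add_le sum_nonneg) auto
  with insert show ?case by force
qed simp

lemma sum_powr_le:
  fixes f :: "'a \<Rightarrow> real"
  assumes "finite A" "\<And>a. a \<in> A \<Longrightarrow> 0 \<le> f a" "1 \<le> e"
  shows "(\<Sum>a\<in>A. f a powr e) \<le> (\<Sum>a\<in>A. f a) powr e"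
proof -
  let ?S = "sum f A"
  have split: "z powr e = z * z powr (e - 1)" if "0 \<le> z" for z :: real
    using that by (cases "z = 0") (simp_all add: powr_mult_base)
  have "(\<Sum>a\<in>A. f a powr e) \<le> (\<Sum>a\<in>A. f a * ?S powr (e - 1))"
  proof (rule sum_mono)
    fix a assume a: "a \<in> A"
    have "f a \<le> ?S" using a assms by (intro member_le_sum) auto
    then show "f a powr e \<le> f a * ?S powr (e - 1)"
      using assms a by (subst split) (auto intro!: mult_left_mono powr_mono2)
  qed
  also have "\<dots> = ?S powr e"
    using assms by (subst split) (auto simp: sum_distrib_right sum_nonneg)
  finally show ?thesis .
qed

definition geom_bound :: "real \<Rightarrow> real" where
  "geom_bound a = 1 / (1 - 2 powr - a)"

lemma geom_bound_pos: "0 < a \<Longrightarrow> 0 < geom_bound a"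
  by (simp add: geom_bound_def powr_less_one)

lemma geometric_sum_le:
  assumes "0 < a" "finite A"
  shows "(\<Sum>b\<in>A. 2 powr (- real b * a)) \<le> geom_bound a"
proof -
  have q: "norm (2 powr - a) < 1" using assms by (simp add: powr_less_one)
  have e: "2 powr (- real b * a) = (2 powr - a) ^ b" for b
    by (simp add: powr_realpow[symmetric] powr_powr mult.commute)
  have "(\<Sum>b\<in>A. (2 powr - a) ^ b) \<le> (\<Sum>b. (2 powr - a) ^ b)"
    by (rule sum_le_suminf[OF summable_geometric[OF q] assms(2)]) auto
  also have "\<dots> = geom_bound a" using suminf_geometric[OF q] by (simp add: geom_bound_def)
  finally show ?thesis unfolding e .
qed

text \<open>Sums over \<open>j \<le> i \<le> n\<close> are compared with products of sums over \<open>j\<close> and \<open>i - j\<close>.\<close>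

lemma triangular_sum_le:
  fixes F H :: "nat \<Rightarrow> real"
  assumes "\<And>j. 0 \<le> F j" "\<And>d. 0 \<le> H d" "(\<Sum>j\<in>J \<inter> {..n}. F j) \<le> A" "(\<Sum>d\<le>n. H d) \<le> B"
  shows "(\<Sum>(i, j)\<in>{(i, j). i \<le> n \<and> j \<le> i \<and> j \<in> J}. F j * H (i - j)) \<le> A * B"
proof -
  let ?S = "{(i, j). i \<le> n \<and> j \<le> i \<and> j \<in> J}"
  let ?f = "\<lambda>(i, j). (j, i - j :: nat)"
  have inj: "inj_on ?f ?S" by (auto simp: inj_on_def)
  have sub: "?f ` ?S \<subseteq> (J \<inter> {..n}) \<times> {..n}" by auto
  have "(\<Sum>(i, j)\<in>?S. F j * H (i - j)) = (\<Sum>(j, d)\<in>?f ` ?S. F j * H d)"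
    by (subst sum.reindex[OF inj]) (auto intro!: sum.cong)
  also have "\<dots> \<le> (\<Sum>(j, d)\<in>(J \<inter> {..n}) \<times> {..n}. F j * H d)"
    using assms by (intro sum_mono2 sub) auto
  also have "\<dots> = (\<Sum>j\<in>J \<inter> {..n}. F j) * (\<Sum>d\<le>n. H d)"
    by (simp add: sum_product sum.cartesian_product)
  also have "\<dots> \<le> A * B"
    using assms order_trans[OF sum_nonneg assms(3)] by (intro mult_mono) (auto intro: sum_nonneg)
  finally show ?thesis .
qed

lemma triangular_geometric_sum:
  assumes "0 < a" "0 < b"
  shows "(\<Sum>(i, j)\<in>{(i, j). i \<le> n \<and> j \<le> i \<and> j \<in> J}. 2 powr (- (real n - real j) * a - (real i - real j) * b))
     \<le> geom_bound a * geom_bound b"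
proof -
  have "(\<Sum>(i, j)\<in>{(i, j). i \<le> n \<and> j \<le> i \<and> j \<in> J}. 2 powr (- (real n - real j) * a - (real i - real j) * b))
      = (\<Sum>(i, j)\<in>{(i, j). i \<le> n \<and> j \<le> i \<and> j \<in> J}. 2 powr (- (real n - real j) * a) * 2 powr (- real (i - j) * b))"
    by (intro sum.cong) (auto simp: powr_add[symmetric] of_nat_diff)
  also have "\<dots> \<le> geom_bound a * geom_bound b"
  proof (rule triangular_sum_le)
    have "(\<Sum>j\<in>J \<inter> {..n}. 2 powr (- (real n - real j) * a)) = (\<Sum>b\<in>(\<lambda>j. n - j) ` (J \<inter> {..n}). 2 powr (- real b * a))"
      by (subst sum.reindex) (auto simp: inj_on_def of_nat_diff algebra_simps intro!: sum.cong)
    then show "(\<Sum>j\<in>J \<inter> {..n}. 2 powr (- (real n - real j) * a)) \<le> geom_bound a"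
      using geometric_sum_le[OF assms(1), of "(\<lambda>j. n - j) ` (J \<inter> {..n})"] by simp
    show "(\<Sum>d\<le>n. 2 powr (- real d * b)) \<le> geom_bound b"
      by (rule geometric_sum_le[OF assms(2)]) simp
  qed auto
  finally show ?thesis .
qed

text \<open>Chebyshev's inequality for the power \<open>r \<le> 1\<close>, which is subadditive.\<close>

lemma chebyshev_indicator_sum:
  assumes N: "finite_measure N" "sets N = sets unit_leb" and A: "finite A"
    and c: "\<And>a. a \<in> A \<Longrightarrow> 0 \<le> c a" and Q: "\<And>a. a \<in> A \<Longrightarrow> Q a \<in> sets unit_leb"
    and r: "0 < r" "r \<le> 1" and s: "0 < s"
  shows "measure N {x \<in> {0..<1}. s < (\<Sum>a\<in>A. c a * indicator (Q a) x)}
     \<le> s powr - r * (\<Sum>a\<in>A. c a powr r * measure N (Q a))"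
proof -
  interpret finite_measure N by fact
  have sp: "space N = {0..<1}" using sets_eq_imp_space_eq[OF N(2)] by simp
  define u where "u x = (\<Sum>a\<in>A. c a powr r * indicator (Q a) x)" for x :: real
  have Q': "Q a \<in> sets N" if "a \<in> A" for a using Q[OF that] N(2) by simp
  have i: "integrable N (indicator (Q a) :: real \<Rightarrow> real)" if "a \<in> A" for a
    using Q'[OF that] emeasure_finite by (intro integrable_real_indicator) (auto simp: top.not_eq_extremum[symmetric])
  have int: "integrable N u"
    unfolding u_def by (intro Bochner_Integration.integrable_sum integrable_mult_right i)
  have int_u: "(LINT x|N. u x) = (\<Sum>a\<in>A. c a powr r * measure N (Q a))"
  proof -
    have "(LINT x|N. u x) = (\<Sum>a\<in>A. LINT x|N. c a powr r * indicator (Q a) x)"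
      unfolding u_def by (rule Bochner_Integration.integral_sum) (auto intro!: integrable_mult_right i)
    also have "\<dots> = (\<Sum>a\<in>A. c a powr r * measure N (Q a))"
      using Q' sets.sets_into_space[of _ N] by (intro sum.cong) (auto simp: Int_absorb2)
    finally show ?thesis .
  qed
  have um: "u \<in> borel_measurable N" using int by blast
  have sub: "{x \<in> {0..<1}. s < (\<Sum>a\<in>A. c a * indicator (Q a) x)} \<subseteq> {x \<in> space N. s powr r \<le> u x}"
  proof
    fix x assume x: "x \<in> {x \<in> {0..<1}. s < (\<Sum>a\<in>A. c a * indicator (Q a) x)}"
    have "s powr r \<le> (\<Sum>a\<in>A. c a * indicator (Q a) x) powr r"
      using x r s by (intro powr_mono2) auto
    also have "\<dots> \<le> (\<Sum>a\<in>A. (c a * indicator (Q a) x) powr r)"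
      using A c r by (intro powr_sum_le) auto
    also have "\<dots> = u x" unfolding u_def by (intro sum.cong) (auto simp: indicator_def)
    finally show "x \<in> {x \<in> space N. s powr r \<le> u x}" using x sp by simp
  qed
  have "measure N {x \<in> {0..<1}. s < (\<Sum>a\<in>A. c a * indicator (Q a) x)} \<le> measure N {x \<in> space N. s powr r \<le> u x}"
    using um by (intro finite_measure_mono sub) measurable
  also have "\<dots> \<le> (LINT x|N. u x) / s powr r"
    using s by (intro integral_Markov_inequality_measure[OF int sets.empty_sets]) (auto simp: u_def intro!: sum_nonneg)
  finally show ?thesis unfolding int_u by (simp add: powr_minus field_simps)
qed

section \<open>Modulars of the variable exponent\<close>

text \<open>The modular of \<open>1 / m\<close> times the indicator of \<open>E\<close> is the measure of \<open>E\<close> with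
  density \<open>m powr - p x\<close>.\<close>

definition modular :: "(real \<Rightarrow> real) \<Rightarrow> real \<Rightarrow> real measure" where
  "modular p m = density unit_leb (\<lambda>x. ennreal (m powr - p x))"

text \<open>The bounds \<open>p0\<close> and \<open>p1\<close> hold everywhere, which can be achieved by changing the exponent on a
  null set. In the last condition \<open>a\<close> and \<open>b\<close> stand for the essential bounds on a dyadic interval of
  length \<open>2 ^ - n\<close>; it forces the oscillation \<open>b - a\<close> to be at most \<open>log 2 K / n\<close>.\<close>

locale dyadic_exponent =
  fixes p :: "real \<Rightarrow> real" and p0 p1 K :: real
  assumes measurable_p [measurable]: "p \<in> borel_measurable unit_leb"
    and p_ge: "p0 \<le> p x" and p_le: "p x \<le> p1"
    and p0_gt: "1 / 2 < p0"
    and gap: "1 / p0 - 1 / p1 < 1"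
    and K_ge: "1 \<le> K"
    and oscillation: "k < 2 ^ n \<Longrightarrow> \<exists>a b. a \<le> b \<and> (2 ^ n) powr (b - a) \<le> K \<and>
        (AE x in unit_leb. x \<in> dyadic_interval n k \<longrightarrow> a \<le> p x \<and> p x \<le> b)"
begin

lemma p0_le_p1: "p0 \<le> p1"
  using p_ge p_le order_trans by blast

lemma sets_modular [simp]: "sets (modular p m) = sets unit_leb"
  by (simp add: modular_def)

lemma space_modular [simp]: "space (modular p m) = {0..<1}"
  by (simp add: modular_def)

lemma emeasure_modular:
  assumes "E \<in> sets unit_leb"
  shows "emeasure (modular p m) E = (\<integral>\<^sup>+ x. ennreal (m powr - p x) * indicator E x \<partial>unit_leb)"
  unfolding modular_def using assms by (intro emeasure_density) measurable

lemma weight_le: "0 < m \<Longrightarrow> m powr - p x \<le> m powr - p0 + m powr - p1"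
proof (cases "m \<le> 1")
  case True
  assume "0 < m"
  then have "m powr - p x \<le> m powr - p1" using True p_le[of x] by (intro powr_mono') auto
  then show ?thesis by (simp add: add_increasing)
next
  case False
  then have "m powr - p x \<le> m powr - p0" using p_ge[of x] by (intro powr_mono) auto
  then show ?thesis by (simp add: add_increasing2)
qed

lemma finite_modular: "0 < m \<Longrightarrow> finite_measure (modular p m)"
proof (rule finite_measureI)
  assume m: "0 < m"
  have "emeasure (modular p m) (space (modular p m))
      = (\<integral>\<^sup>+ x. ennreal (m powr - p x) * indicator {0..<1} x \<partial>unit_leb)"
    by (subst emeasure_modular[symmetric]) (use sets.top[of unit_leb] in auto)
  also have "\<dots> \<le> (\<integral>\<^sup>+ x. ennreal (m powr - p0 + m powr - p1) \<partial>unit_leb)"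
    using ennreal_leI[OF weight_le[OF m]]
    by (intro nn_integral_mono) (auto simp: indicator_def simp del: ennreal_plus)
  also have "\<dots> = ennreal (m powr - p0 + m powr - p1) * emeasure unit_leb {0..<1}"
    by (simp add: nn_integral_const)
  also have "\<dots> < \<infinity>" by (simp add: emeasure_restrict_space ennreal_mult_less_top)
  finally show "emeasure (modular p m) (space (modular p m)) \<noteq> \<infinity>" by simp
qed

text \<open>All comparisons of modulars are instances of this one; Lebesgue measure is the case \<open>m = 1\<close>.\<close>

lemma modular_compare:
  assumes m: "0 < m" "0 < m'" and E: "E \<in> sets unit_leb" and w: "0 \<le> w"
    and le: "AE x in unit_leb. x \<in> E \<longrightarrow> m' powr - p x \<le> w * m powr - p x"
  shows "measure (modular p m') E \<le> w * measure (modular p m) E"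
proof -
  interpret A: finite_measure "modular p m" by (rule finite_modular[OF m(1)])
  interpret B: finite_measure "modular p m'" by (rule finite_modular[OF m(2)])
  have "emeasure (modular p m') E = (\<integral>\<^sup>+ x. ennreal (m' powr - p x) * indicator E x \<partial>unit_leb)"
    by (rule emeasure_modular[OF E])
  also have "\<dots> \<le> (\<integral>\<^sup>+ x. ennreal w * (ennreal (m powr - p x) * indicator E x) \<partial>unit_leb)"
  proof (rule nn_integral_mono_AE)
    show "AE x in unit_leb. ennreal (m' powr - p x) * indicator E x \<le> ennreal w * (ennreal (m powr - p x) * indicator E x)"
      using le by eventually_elim (auto simp: indicator_def ennreal_mult[symmetric] w intro!: ennreal_leI)
  qed
  also have "\<dots> = ennreal w * (\<integral>\<^sup>+ x. ennreal (m powr - p x) * indicator E x \<partial>unit_leb)"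
    by (rule nn_integral_cmult) (use E in measurable)
  also have "\<dots> = ennreal w * emeasure (modular p m) E"
    by (subst emeasure_modular[OF E]) simp
  finally show ?thesis
    by (simp add: A.emeasure_eq_measure B.emeasure_eq_measure ennreal_mult[symmetric] w)
qed

lemma modular_1: "measure (modular p 1) E = measure unit_leb E"
  by (simp add: modular_def density_1)

lemma modular_le_scaled:
  assumes m: "0 < m" and E: "E \<in> sets unit_leb" and d: "1 \<le> d"
  shows "measure (modular p (d * m)) E \<le> d powr - p0 * measure (modular p m) E"
proof (rule modular_compare)
  show "AE x in unit_leb. x \<in> E \<longrightarrow> (d * m) powr - p x \<le> d powr - p0 * m powr - p x"
    using d m p_ge by (auto intro!: AE_I2 mult_right_mono powr_mono simp: powr_mult)
qed (use assms in auto)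

lemma modular_ge_lebesgue:
  assumes m: "0 < m" "m \<le> 1" and E: "E \<in> sets unit_leb" and a: "AE x in unit_leb. x \<in> E \<longrightarrow> a \<le> p x"
  shows "measure unit_leb E \<le> m powr a * measure (modular p m) E"
  unfolding modular_1[symmetric]
proof (rule modular_compare)
  show "AE x in unit_leb. x \<in> E \<longrightarrow> 1 powr - p x \<le> m powr a * m powr - p x"
    using a
  proof eventually_elim
    case (elim x)
    show ?case
    proof
      assume "x \<in> E"
      then have "m powr 0 \<le> m powr (a - p x)" using elim m by (intro powr_mono') auto
      then show "1 powr - p x \<le> m powr a * m powr - p x" using m by (simp add: powr_add[symmetric])
    qed
  qed
qed (use assms in auto)

lemma modular_le_lebesgue:
  assumes m: "0 < m" "m \<le> 1" and E: "E \<in> sets unit_leb" and b: "AE x in unit_leb. x \<in> E \<longrightarrow> p x \<le> b"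
  shows "measure (modular p m) E \<le> m powr - b * measure unit_leb E"
  unfolding modular_1[symmetric]
proof (rule modular_compare)
  show "AE x in unit_leb. x \<in> E \<longrightarrow> m powr - p x \<le> m powr - b * 1 powr - p x"
    using b by eventually_elim (use m in \<open>auto intro!: powr_mono'\<close>)
qed (use assms in auto)

lemma modular_mono_m:
  assumes "0 < m" "m \<le> m'" "E \<in> sets unit_leb"
  shows "measure (modular p m') E \<le> measure (modular p m) E"
proof -
  have "m' powr - p x \<le> 1 * m powr - p x" for x
    using assms p_ge[of x] p0_gt by (simp add: powr_mono2')
  then show ?thesis using modular_compare[of m m' E 1] assms by simp
qed

end

section \<open>Weak-type estimate for the shadow of charged cells\<close>

text \<open>Every cell in \<open>P\<close> has a half that lies in the set \<open>\<Omega>\<close>, whose modular is at most 1. The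
  point is to control the neighbours of the cells by these halves, although the exponent there may
  be larger.\<close>

locale charged_cells = dyadic_exponent p p0 p1 K
  for p :: "real \<Rightarrow> real" and p0 p1 K :: real +
  fixes m :: real and \<Omega> :: "real set" and P :: "(nat \<times> real) set" and child :: "nat \<times> real \<Rightarrow> real"
  assumes m: "0 < m" "m \<le> 1"
    and \<Omega>: "\<Omega> \<in> sets unit_leb" "measure (modular p m) \<Omega> \<le> 1"
    and P: "finite P" "disjoint_family_on (\<lambda>(n, t). cell n t) P"
    and child_mem: "q \<in> P \<Longrightarrow> child q \<in> cell (fst q) (snd q)"
    and child_cell_sub: "q \<in> P \<Longrightarrow> cell (Suc (fst q)) (child q) \<subseteq> \<Omega>"
begin

abbreviation child_mass :: "nat \<times> real \<Rightarrow> real" where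
  "child_mass q \<equiv> measure (modular p m) (cell (Suc (fst q)) (child q))"

lemma child_cell_sub_cell: "q \<in> P \<Longrightarrow> cell (Suc (fst q)) (child q) \<subseteq> cell (fst q) (snd q)"
  using cell_mono[of "fst q" "Suc (fst q)" "child q"] cell_eq[OF child_mem] by auto

lemma sum_child_mass: "(\<Sum>q\<in>P. child_mass q) \<le> 1"
proof -
  interpret finite_measure "modular p m" by (rule finite_modular[OF m(1)])
  have "cell (fst q) (snd q) \<inter> cell (fst q') (snd q') = {}" if "q \<in> P" "q' \<in> P" "q \<noteq> q'" for q q'
    using disjoint_family_onD[OF P(2) that] by (simp add: case_prod_beta')
  then have "disjoint_family_on (\<lambda>q. cell (Suc (fst q)) (child q)) P"
    using child_cell_sub_cell unfolding disjoint_family_on_def by blast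
  then have "(\<Sum>q\<in>P. child_mass q) = measure (modular p m) (\<Union>q\<in>P. cell (Suc (fst q)) (child q))"
    using P(1) by (intro finite_measure_finite_Union[symmetric]) auto
  also have "\<dots> \<le> measure (modular p m) \<Omega>"
    using \<Omega> child_cell_sub by (intro finite_measure_mono) auto
  finally show ?thesis using \<Omega> by simp
qed

lemma child_mass_ge: "1 / 2 ^ Suc (fst q) \<le> m powr p0 * child_mass q"
  using modular_ge_lebesgue[OF m, of "cell (Suc (fst q)) (child q)" p0] p_ge by simp

lemma child_mass_le_1: "q \<in> P \<Longrightarrow> child_mass q \<le> 1"
  using sum_child_mass member_le_sum[of q P child_mass] P by simp

text \<open>The modular of a child is at most 1, which bounds \<open>m\<close> from below by its size.\<close>

lemma m_powr_le: "q \<in> P \<Longrightarrow> m powr - p0 \<le> 2 ^ Suc (fst q)"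
proof -
  assume q: "q \<in> P"
  have "1 / 2 ^ Suc (fst q) \<le> m powr p0 * child_mass q" by (rule child_mass_ge)
  also have "\<dots> \<le> m powr p0 * 1" using child_mass_le_1[OF q] by (intro mult_left_mono) auto
  finally show ?thesis using m by (simp add: powr_minus field_simps)
qed

lemma total_size_le: "(\<Sum>q\<in>P. 1 / 2 ^ fst q) \<le> 2 * m powr p0"
proof -
  have "(\<Sum>q\<in>P. 1 / 2 ^ fst q) \<le> (\<Sum>q\<in>P. 2 * m powr p0 * child_mass q)"
  proof (rule sum_mono)
    fix q
    show "1 / 2 ^ fst q \<le> 2 * m powr p0 * child_mass q" using child_mass_ge[of q] by simp
  qed
  also have "\<dots> = 2 * m powr p0 * (\<Sum>q\<in>P. child_mass q)" by (simp add: sum_distrib_left)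
  also have "\<dots> \<le> 2 * m powr p0 * 1" using sum_child_mass by (intro mult_left_mono) auto
  finally show ?thesis by simp
qed

text \<open>The shadow is split according to the position \<open>j\<close> of the flipped digit.\<close>

definition flips :: "nat set \<Rightarrow> nat \<Rightarrow> (nat \<times> nat) set" where
  "flips J n = {(i, j). i \<le> n \<and> j \<le> i \<and> j \<in> J}"

definition shadow_part :: "nat set \<Rightarrow> real \<Rightarrow> real" where
  "shadow_part J x = (\<Sum>(q, i, j)\<in>(SIGMA q:P. flips J (fst q)).
     2 ^ (j + i) / 4 ^ fst q * indicator (flip_cell j i (snd q)) x)"

lemma finite_flips [simp]: "finite (flips J n)"
  by (rule finite_subset[of _ "{..n} \<times> {..n}"]) (auto simp: flips_def)

lemma shadow_part_iterated:
  "shadow_part J x = (\<Sum>q\<in>P. \<Sum>(i, j)\<in>flips J (fst q). 2 ^ (j + i) / 4 ^ fst q * indicator (flip_cell j i (snd q)) x)"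
  unfolding shadow_part_def by (subst sum.Sigma[OF P(1)]) (auto simp: case_prod_beta')

lemma shadow_split: "shadow P x = shadow_part {..<j0} x + shadow_part {j0..} x"
proof -
  have "atom_shadow n t x = (\<Sum>(i, j)\<in>flips {..<j0} n. 2 ^ (j + i) / 4 ^ n * indicator (flip_cell j i t) x)
      + (\<Sum>(i, j)\<in>flips {j0..} n. 2 ^ (j + i) / 4 ^ n * indicator (flip_cell j i t) x)" for n t
  proof -
    have "atom_shadow n t x = (\<Sum>(i, j)\<in>(SIGMA i:{..n}. {..i}). 2 ^ (j + i) / 4 ^ n * indicator (flip_cell j i t) x)"
      unfolding atom_shadow_def by (subst sum.Sigma) auto
    also have "(SIGMA i:{..n}. {..i}) = flips {..<j0} n \<union> flips {j0..} n" by (auto simp: flips_def)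
    finally show ?thesis
      by (subst (asm) sum.union_disjoint) (auto simp: flips_def[of "{..<j0}"] flips_def[of "{j0..}"]
          intro: finite_subset[OF _ finite_flips[of UNIV n]] simp del: finite_flips simp: flips_def)
  qed
  then show ?thesis
    unfolding shadow_def shadow_part_iterated sum.distrib[symmetric] by (simp add: case_prod_beta')
qed

lemma coefficient_powr:
  "(2 ^ (j + i) / 4 ^ n) powr r = 2 powr ((real j + real i - 2 * real n) * r)"
proof -
  have "(2::real) ^ (j + i) / 4 ^ n = 2 powr (real j + real i - 2 * real n)"
  proof -
    have "(4::real) ^ n = 2 ^ n * 2 ^ n" by (simp add: power_mult_distrib[symmetric])
    then have "(2::real) ^ (j + i) / 4 ^ n = 2 powr real j * 2 powr real i / (2 powr real n * 2 powr real n)"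
      by (simp add: power_add powr_realpow)
    then show ?thesis by (simp add: powr_add[symmetric] powr_diff[symmetric] algebra_simps)
  qed
  then show ?thesis by (simp add: powr_powr)
qed

text \<open>Inside the cell of length \<open>2 ^ - j\<close> the exponent oscillates by at most \<open>log 2 K / j\<close>.
  Since \<open>m\<close> is bounded below by a power of the size of the child, a change of the exponent by
  this amount costs a power of \<open>2 ^ (n - j)\<close> with small exponent \<open>\<delta>\<close>.\<close>

lemma neighbour_mass:
  assumes q: "q \<in> P" and j: "1 \<le> j0" "j0 \<le> j" "j \<le> i" "i \<le> fst q"
    and \<delta>: "0 < \<delta>" "log 2 K \<le> real j0 * (p0 * \<delta>)"
  shows "measure (modular p m) (flip_cell j i (snd q)) \<le>
    K powr (1 / p0) * 2 powr (1 + \<delta>) * 2 powr ((real (fst q) - real i) + (real (fst q) - real j) * \<delta>) * child_mass q"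
proof -
  define n where "n = fst q"
  define t where "t = snd q"
  have n: "i \<le> n" using j by (simp add: n_def)
  obtain k where k: "k < 2 ^ j" "cell j t = dyadic_interval j k" using cell_is_dyadic_interval by blast
  obtain a b where ab: "a \<le> b" "(2 ^ j) powr (b - a) \<le> K"
    and osc: "AE x in unit_leb. x \<in> cell j t \<longrightarrow> a \<le> p x \<and> p x \<le> b"
    using oscillation[OF k(1)] k(2) by auto
  have flip_sub: "flip_cell j i t \<subseteq> cell j t" using j by (intro flip_cell_subset) auto
  have child_sub: "cell (Suc n) (child q) \<subseteq> cell j t"
    using child_cell_sub_cell[OF q] cell_mono[of j n t] j n by (auto simp: n_def t_def)
  have "measure (modular p m) (flip_cell j i t) \<le> m powr - b * measure unit_leb (flip_cell j i t)"
    by (rule modular_le_lebesgue[OF m flip_cell_sets]) (use osc flip_sub in \<open>auto elim!: eventually_mono\<close>)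
  then have w1: "measure (modular p m) (flip_cell j i t) \<le> m powr - b * (2 ^ Suc n / 2 ^ i) * (1 / 2 ^ Suc n)"
    by simp
  have "measure unit_leb (cell (Suc n) (child q)) \<le> m powr a * child_mass q"
    unfolding n_def[symmetric]
    by (rule modular_ge_lebesgue[OF m cell_sets]) (use osc child_sub in \<open>auto elim!: eventually_mono\<close>)
  then have w2: "1 / 2 ^ Suc n \<le> m powr a * child_mass q" by simp
  have "m powr - b * (2 ^ Suc n / 2 ^ i) * (1 / 2 ^ Suc n) \<le> m powr - b * (2 ^ Suc n / 2 ^ i) * (m powr a * child_mass q)"
    by (intro mult_left_mono w2) auto
  also have "\<dots> = (2 ^ Suc n / 2 ^ i) * m powr - (b - a) * child_mass q"
    using m by (simp add: powr_add[symmetric])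
  finally have w3: "measure (modular p m) (flip_cell j i t) \<le> (2 ^ Suc n / 2 ^ i) * m powr - (b - a) * child_mass q"
    using w1 by linarith
  define e where "e = (b - a) / p0"
  have e0: "0 \<le> e" using ab p0_gt by (simp add: e_def)
  have K0: "0 < K" using K_ge by simp
  have jb: "2 powr (real j * (b - a)) \<le> K"
    using ab(2) by (simp add: powr_realpow[symmetric] powr_powr)
  then have "real j * (b - a) \<le> log 2 K"
    using K0 by (simp add: le_log_iff)
  also have "\<dots> \<le> real j * (p0 * \<delta>)"
    using \<delta> j p0_gt by (meson order_trans mult_right_mono of_nat_mono mult_nonneg_nonneg less_imp_le
        less_trans zero_less_divide_1_iff zero_less_numeral)
  finally have "b - a \<le> p0 * \<delta>" using j by simp
  then have e_le: "e \<le> \<delta>" using p0_gt by (simp add: e_def field_simps)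
  have "m powr - (b - a) = (m powr - p0) powr e" using p0_gt by (simp add: powr_powr e_def)
  also have "\<dots> \<le> (2 ^ Suc n) powr e"
    using m_powr_le[OF q] e0 unfolding n_def by (intro powr_mono2) auto
  also have "\<dots> = 2 powr (real (Suc n) * e)" by (simp add: powr_realpow[symmetric] powr_powr del: power_Suc of_nat_Suc)
  also have "\<dots> = 2 powr (real j * e) * 2 powr ((real n + 1 - real j) * e)"
    by (simp add: powr_add[symmetric] algebra_simps)
  also have "\<dots> \<le> K powr (1 / p0) * 2 powr ((real n + 1 - real j) * \<delta>)"
  proof (intro mult_mono)
    have "2 powr (real j * e) = (2 powr (real j * (b - a))) powr (1 / p0)"
      by (simp add: powr_powr e_def)
    also have "\<dots> \<le> K powr (1 / p0)" using jb p0_gt by (intro powr_mono2) auto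
    finally show "2 powr (real j * e) \<le> K powr (1 / p0)" .
    show "2 powr ((real n + 1 - real j) * e) \<le> 2 powr ((real n + 1 - real j) * \<delta>)"
      using e_le j n by (intro powr_mono mult_left_mono) auto
  qed auto
  finally have w4: "m powr - (b - a) \<le> K powr (1 / p0) * 2 powr ((real n + 1 - real j) * \<delta>)" .
  have w5: "(2::real) ^ Suc n / 2 ^ i = 2 powr (real n + 1 - real i)"
    by (simp add: powr_diff powr_add powr_realpow)
  have "(2 ^ Suc n / 2 ^ i) * m powr - (b - a) * child_mass q
      \<le> 2 powr (real n + 1 - real i) * (K powr (1 / p0) * 2 powr ((real n + 1 - real j) * \<delta>)) * child_mass q"
    unfolding w5 by (intro mult_right_mono mult_left_mono w4) auto
  also have "\<dots> = K powr (1 / p0) * 2 powr (1 + \<delta>) * 2 powr ((real n - real i) + (real n - real j) * \<delta>) * child_mass q"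
    by (simp add: powr_add[symmetric] algebra_simps)
  finally show ?thesis using w3 by (simp add: n_def t_def)
qed

text \<open>The factor from the change of the exponent is absorbed because \<open>2 * r > 1\<close> leaves a geometric
  decay in \<open>n - j\<close>; the decay in \<open>i - j\<close> comes from \<open>r < 1\<close>.\<close>

lemma fine_part_bound:
  assumes r: "1 / 2 < r" "r < 1" and j0: "1 \<le> j0"
    and \<delta>: "0 < \<delta>" "\<delta> < 2 * r - 1" "log 2 K \<le> real j0 * (p0 * \<delta>)" and s: "0 < s"
  shows "measure (modular p m) {x \<in> {0..<1}. s < shadow_part {j0..} x}
    \<le> s powr - r * (K powr (1 / p0) * 2 powr (1 + \<delta>) * (geom_bound (2 * r - 1 - \<delta>) * geom_bound (1 - r)))"
proof -
  let ?I = "SIGMA q:P. flips {j0..} (fst q)"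
  let ?c = "\<lambda>(q :: nat \<times> real, i, j). 2 ^ (j + i) / 4 ^ fst q :: real"
  let ?Q = "\<lambda>(q :: nat \<times> real, i, j). flip_cell j i (snd q)"
  let ?C = "K powr (1 / p0) * 2 powr (1 + \<delta>)"
  let ?G = "geom_bound (2 * r - 1 - \<delta>) * geom_bound (1 - r)"
  have part: "shadow_part {j0..} x = (\<Sum>a\<in>?I. ?c a * indicator (?Q a) x)" for x
    unfolding shadow_part_def by (intro sum.cong) auto
  have G0: "0 \<le> ?G" using r \<delta> geom_bound_pos[of "2 * r - 1 - \<delta>"] geom_bound_pos[of "1 - r"] by simp
  have "measure (modular p m) {x \<in> {0..<1}. s < shadow_part {j0..} x}
      \<le> s powr - r * (\<Sum>a\<in>?I. ?c a powr r * measure (modular p m) (?Q a))"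
    unfolding part using r s P(1)
    by (intro chebyshev_indicator_sum finite_modular m finite_SigmaI) auto
  also have "(\<Sum>a\<in>?I. ?c a powr r * measure (modular p m) (?Q a))
      = (\<Sum>q\<in>P. \<Sum>(i, j)\<in>flips {j0..} (fst q). (2 ^ (j + i) / 4 ^ fst q) powr r * measure (modular p m) (flip_cell j i (snd q)))"
    by (subst sum.Sigma[OF P(1)]) (auto simp: case_prod_beta')
  also have "\<dots> \<le> (\<Sum>q\<in>P. ?C * ?G * child_mass q)"
  proof (rule sum_mono)
    fix q assume q: "q \<in> P"
    let ?n = "fst q"
    have "(\<Sum>(i, j)\<in>flips {j0..} ?n. (2 ^ (j + i) / 4 ^ ?n) powr r * measure (modular p m) (flip_cell j i (snd q)))
        \<le> (\<Sum>(i, j)\<in>flips {j0..} ?n. ?C * child_mass q * 2 powr (- (real ?n - real j) * (2 * r - 1 - \<delta>) - (real i - real j) * (1 - r)))"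
    proof (rule sum_mono)
      fix a assume "a \<in> flips {j0..} ?n"
      then obtain i j where a: "a = (i, j)" "j0 \<le> j" "j \<le> i" "i \<le> ?n" by (auto simp: flips_def)
      have "(2 ^ (j + i) / 4 ^ ?n) powr r * measure (modular p m) (flip_cell j i (snd q))
          \<le> 2 powr ((real j + real i - 2 * real ?n) * r) *
            (?C * 2 powr ((real ?n - real i) + (real ?n - real j) * \<delta>) * child_mass q)"
        unfolding coefficient_powr by (intro mult_left_mono neighbour_mass[OF q j0 a(2,3,4) \<delta>(1,3)]) auto
      also have "\<dots> = ?C * child_mass q * (2 powr ((real j + real i - 2 * real ?n) * r) * 2 powr ((real ?n - real i) + (real ?n - real j) * \<delta>))"
        by simp
      also have "2 powr ((real j + real i - 2 * real ?n) * r) * 2 powr ((real ?n - real i) + (real ?n - real j) * \<delta>)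
          = 2 powr (- (real ?n - real j) * (2 * r - 1 - \<delta>) - (real i - real j) * (1 - r))"
        by (simp add: powr_add[symmetric] algebra_simps)
      finally show "(case a of (i, j) \<Rightarrow> (2 ^ (j + i) / 4 ^ ?n) powr r * measure (modular p m) (flip_cell j i (snd q)))
        \<le> (case a of (i, j) \<Rightarrow> ?C * child_mass q * 2 powr (- (real ?n - real j) * (2 * r - 1 - \<delta>) - (real i - real j) * (1 - r)))"
        by (simp add: a)
    qed
    also have "\<dots> = ?C * child_mass q * (\<Sum>(i, j)\<in>flips {j0..} ?n. 2 powr (- (real ?n - real j) * (2 * r - 1 - \<delta>) - (real i - real j) * (1 - r)))"
      by (simp add: sum_distrib_left case_prod_beta')
    also have "\<dots> \<le> ?C * child_mass q * ?G"
      unfolding flips_def using r \<delta> by (intro mult_left_mono triangular_geometric_sum) auto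
    finally show "(\<Sum>(i, j)\<in>flips {j0..} ?n. (2 ^ (j + i) / 4 ^ ?n) powr r * measure (modular p m) (flip_cell j i (snd q)))
        \<le> ?C * ?G * child_mass q" by (simp add: mult_ac)
  qed
  also have "\<dots> = ?C * ?G * (\<Sum>q\<in>P. child_mass q)" by (simp add: sum_distrib_left)
  also have "\<dots> \<le> ?C * ?G * 1"
    using G0 by (intro mult_left_mono sum_child_mass) auto
  finally show ?thesis by (simp add: mult_left_mono)
qed

text \<open>For the finitely many flips of a leading digit the exponents at a cell and at its neighbour
  are unrelated, and Lebesgue measure is used; the bound for the height of this part makes up for
  the loss.\<close>

lemma coarse_part_bound:
  assumes r: "1 / 2 < r" "r < 1" and s: "0 < s"
  shows "measure unit_leb {x \<in> {0..<1}. s < shadow_part {..<j0} x}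
    \<le> s powr - r * (real j0 * 2 ^ j0 * geom_bound (1 - r) * (2 * m powr p0) powr (2 * r))"
proof -
  let ?I = "SIGMA q:P. flips {..<j0} (fst q)"
  let ?c = "\<lambda>(q :: nat \<times> real, i, j). 2 ^ (j + i) / 4 ^ fst q :: real"
  let ?Q = "\<lambda>(q :: nat \<times> real, i, j). flip_cell j i (snd q)"
  let ?C = "real j0 * 2 ^ j0 * geom_bound (1 - r)"
  have part: "shadow_part {..<j0} x = (\<Sum>a\<in>?I. ?c a * indicator (?Q a) x)" for x
    unfolding shadow_part_def by (intro sum.cong) auto
  have C0: "0 \<le> ?C" using r geom_bound_pos[of "1 - r"] by simp
  have "measure unit_leb {x \<in> {0..<1}. s < shadow_part {..<j0} x}
      \<le> s powr - r * (\<Sum>a\<in>?I. ?c a powr r * measure unit_leb (?Q a))"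
    unfolding part using r s P(1)
    by (intro chebyshev_indicator_sum unit_leb_finite finite_SigmaI) auto
  also have "(\<Sum>a\<in>?I. ?c a powr r * measure unit_leb (?Q a))
      = (\<Sum>q\<in>P. \<Sum>(i, j)\<in>flips {..<j0} (fst q). (2 ^ (j + i) / 4 ^ fst q) powr r * (1 / 2 ^ i))"
    by (subst sum.Sigma[OF P(1)]) (auto simp: case_prod_beta')
  also have "\<dots> \<le> (\<Sum>q\<in>P. ?C * (1 / 2 ^ fst q) powr (2 * r))"
  proof (rule sum_mono)
    fix q :: "nat \<times> real"
    let ?n = "fst q"
    have "(\<Sum>(i, j)\<in>flips {..<j0} ?n. (2 ^ (j + i) / 4 ^ ?n) powr r * (1 / 2 ^ i))
        \<le> (\<Sum>(i, j)\<in>flips {..<j0} ?n. (1 / 2 ^ ?n) powr (2 * r) * (2 ^ j0 * 2 powr (- real (i - j) * (1 - r))))"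
    proof (rule sum_mono)
      fix a assume "a \<in> flips {..<j0} ?n"
      then obtain i j where a: "a = (i, j)" "j < j0" "j \<le> i" "i \<le> ?n" by (auto simp: flips_def)
      have n: "(1 / 2 ^ ?n) powr (2 * r) = 2 powr (- 2 * real ?n * r)"
      proof -
        have "(1::real) / 2 ^ ?n = 2 powr - real ?n" by (simp add: powr_minus powr_realpow divide_inverse)
        then show ?thesis by (simp add: powr_powr mult_ac)
      qed
      have i: "(1::real) / 2 ^ i = 2 powr - real i" by (simp add: powr_minus powr_realpow divide_inverse)
      have "(2 ^ (j + i) / 4 ^ ?n) powr r * (1 / 2 ^ i)
          = 2 powr (- 2 * real ?n * r) * (2 powr (real j * (2 * r - 1)) * 2 powr (- real (i - j) * (1 - r)))"
        unfolding coefficient_powr i using a by (simp add: powr_add[symmetric] of_nat_diff algebra_simps)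
      also have "\<dots> \<le> 2 powr (- 2 * real ?n * r) * (2 ^ j0 * 2 powr (- real (i - j) * (1 - r)))"
      proof (intro mult_left_mono mult_right_mono)
        have "real j * (2 * r - 1) \<le> real j0 * 1" using a r by (intro mult_mono) auto
        then have "2 powr (real j * (2 * r - 1)) \<le> 2 powr real j0" by (intro powr_mono) auto
        then show "2 powr (real j * (2 * r - 1)) \<le> 2 ^ j0" by (simp add: powr_realpow)
      qed auto
      finally show "(case a of (i, j) \<Rightarrow> (2 ^ (j + i) / 4 ^ ?n) powr r * (1 / 2 ^ i))
          \<le> (case a of (i, j) \<Rightarrow> (1 / 2 ^ ?n) powr (2 * r) * (2 ^ j0 * 2 powr (- real (i - j) * (1 - r))))"
        unfolding n a(1) by (simp only: prod.case)
    qed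
    also have "\<dots> = (1 / 2 ^ ?n) powr (2 * r) * (\<Sum>(i, j)\<in>flips {..<j0} ?n. 2 ^ j0 * 2 powr (- real (i - j) * (1 - r)))"
      by (simp add: sum_distrib_left case_prod_beta')
    also have "\<dots> \<le> (1 / 2 ^ ?n) powr (2 * r) * (real j0 * 2 ^ j0 * geom_bound (1 - r))"
      unfolding flips_def
    proof (intro mult_left_mono triangular_sum_le)
      have "card ({..<j0} \<inter> {..?n}) \<le> j0" using card_mono[of "{..<j0}" "{..<j0} \<inter> {..?n}"] by simp
      then show "(\<Sum>j\<in>{..<j0} \<inter> {..?n}. 2 ^ j0) \<le> real j0 * 2 ^ j0" by simp
      show "(\<Sum>d\<le>?n. 2 powr (- real d * (1 - r))) \<le> geom_bound (1 - r)"
        using r by (intro geometric_sum_le) auto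
    qed auto
    finally show "(\<Sum>(i, j)\<in>flips {..<j0} ?n. (2 ^ (j + i) / 4 ^ ?n) powr r * (1 / 2 ^ i)) \<le> ?C * (1 / 2 ^ ?n) powr (2 * r)"
      by (simp add: mult_ac)
  qed
  also have "\<dots> = ?C * (\<Sum>q\<in>P. (1 / 2 ^ fst q) powr (2 * r))" by (simp add: sum_distrib_left)
  also have "\<dots> \<le> ?C * (\<Sum>q\<in>P. 1 / 2 ^ fst q) powr (2 * r)"
    using C0 r P(1) by (intro mult_left_mono sum_powr_le) auto
  also have "\<dots> \<le> ?C * (2 * m powr p0) powr (2 * r)"
    using C0 r total_size_le by (intro mult_left_mono powr_mono2) (auto intro!: sum_nonneg)
  finally show ?thesis by (simp add: mult_left_mono)
qed

lemma coarse_part_le: "shadow_part {..<j0} x \<le> 2 ^ j0 * 4 * m powr p0"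
proof -
  have "shadow_part {..<j0} x \<le> (\<Sum>q\<in>P. 2 ^ j0 * 2 * (1 / 2 ^ fst q))"
    unfolding shadow_part_iterated
  proof (rule sum_mono)
    fix q :: "nat \<times> real"
    let ?n = "fst q"
    have "(\<Sum>(i, j)\<in>flips {..<j0} ?n. 2 ^ (j + i) / 4 ^ ?n * indicator (flip_cell j i (snd q)) x)
        \<le> (\<Sum>(i, j)\<in>flips {..<j0} ?n. 2 ^ (j + i) / 4 ^ ?n :: real)"
      by (intro sum_mono) (auto simp: indicator_def)
    also have "\<dots> \<le> (\<Sum>(i, j)\<in>{..?n} \<times> {..<j0}. 2 ^ (j + i) / 4 ^ ?n :: real)"
      by (intro sum_mono2) (auto simp: flips_def)
    also have "\<dots> = (\<Sum>i\<le>?n. 2 ^ i) * (\<Sum>j<j0. 2 ^ j) / 4 ^ ?n"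
      unfolding sum_product sum.cartesian_product[symmetric] sum_divide_distrib
      by (intro sum.cong refl) (simp add: power_add)
    also have "\<dots> \<le> (2 * 2 ^ ?n) * 2 ^ j0 / 4 ^ ?n"
    proof (intro divide_right_mono mult_mono sum_power2_le)
      show "(\<Sum>j<j0. 2 ^ j) \<le> (2 ^ j0 :: real)" by (induction j0) auto
    qed (auto intro!: sum_nonneg)
    also have "\<dots> = 2 ^ j0 * 2 * (1 / 2 ^ ?n)"
    proof -
      have "(4::real) ^ ?n = 2 ^ ?n * 2 ^ ?n" by (simp add: power_mult_distrib[symmetric])
      then show ?thesis by simp
    qed
    finally show "(\<Sum>(i, j)\<in>flips {..<j0} ?n. 2 ^ (j + i) / 4 ^ ?n * indicator (flip_cell j i (snd q)) x)
        \<le> (2 ^ j0 * 2 * (1 / 2 ^ ?n) :: real)" .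
  qed
  also have "\<dots> = 2 ^ j0 * 2 * (\<Sum>q\<in>P. 1 / 2 ^ fst q)" by (simp only: sum_distrib_left)
  also have "\<dots> \<le> 2 ^ j0 * 2 * (2 * m powr p0)"
    by (intro mult_left_mono total_size_le) auto
  finally show ?thesis by simp
qed

end

section \<open>Level sets of the maximal Fejer operator\<close>

lemma shadow_sets: "{x \<in> {0..<1}. s < shadow P x} \<in> sets unit_leb"
proof -
  have "shadow P \<in> borel_measurable unit_leb"
    unfolding shadow_def atom_shadow_def case_prod_beta' by measurable
  then have "{x \<in> space unit_leb. s < shadow P x} \<in> sets unit_leb" by measurable
  then show ?thesis by simp
qed

lemma (in charged_cells) shadow_part_sets: "{x \<in> {0..<1}. s < shadow_part J x} \<in> sets unit_leb"
proof -
  have "shadow_part J \<in> borel_measurable unit_leb"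
    unfolding shadow_part_def case_prod_beta' by measurable
  then have "{x \<in> space unit_leb. s < shadow_part J x} \<in> sets unit_leb" by measurable
  then show ?thesis by simp
qed

context dyadic_exponent
begin

text \<open>Near \<open>\<theta> = 1\<close> the two conditions \<open>p0 > 1 / 2\<close> and \<open>1 / p0 - 1 / p1 < 1\<close> are still
  satisfied by the exponent \<open>\<theta> * p\<close>; the last inequality expresses them together.\<close>

lemma exponent_room:
  "\<exists>\<theta>. 0 < \<theta> \<and> \<theta> < 1 \<and> (\<forall>\<pi>\<in>{p0, p1}. 1 / 2 < \<theta> * min 1 \<pi> \<and> \<theta> * min 1 \<pi> < 1
      \<and> \<theta> * min 1 \<pi> \<le> \<theta> * \<pi> \<and> \<pi> \<le> p0 * (\<theta> * \<pi> + \<theta> * min 1 \<pi>))"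
proof -
  have p0: "0 < p0" and p1: "0 < p1" and p01: "p0 \<le> p1" using p0_gt p0_le_p1 by auto
  have c1: "1 / (2 * min 1 p0) < 1" using p0_gt by (simp add: min_def)
  have key: "1 < p0 * (1 + min 1 p1 / p1)"
  proof (cases "p1 \<le> 1")
    case True
    then show ?thesis using p0_gt p1 by simp
  next
    case False
    have "p0 * (1 / p0 - 1 / p1) < p0 * 1" by (rule mult_strict_left_mono[OF gap p0])
    then show ?thesis using False p0 p1 by (simp add: algebra_simps)
  qed
  then have c2: "1 / (p0 * (1 + min 1 p1 / p1)) < 1" by simp
  obtain \<theta> where \<theta>: "max (1 / (2 * min 1 p0)) (1 / (p0 * (1 + min 1 p1 / p1))) < \<theta>" "\<theta> < 1"
    using dense[of "max (1 / (2 * min 1 p0)) (1 / (p0 * (1 + min 1 p1 / p1)))" 1] c1 c2 by auto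
  have "0 < 1 / (2 * min 1 p0)" using p0 by simp
  then have \<theta>0: "0 < \<theta>" using \<theta>(1) by linarith
  have h0: "1 / 2 < \<theta> * min 1 p0"
  proof -
    have "1 / (2 * min 1 p0) < \<theta>" using \<theta>(1) by simp
    then show ?thesis using p0 by (simp add: divide_less_eq mult_ac)
  qed
  have "min 1 p0 \<le> min 1 p1" using p01 by auto
  then have "\<theta> * min 1 p0 \<le> \<theta> * min 1 p1" using \<theta>0 by (intro mult_left_mono) auto
  then have h1: "1 / 2 < \<theta> * min 1 p1" using h0 by linarith
  have lt1: "\<theta> * min 1 \<pi> < 1" if "0 < \<pi>" for \<pi>
  proof -
    have "\<theta> * min 1 \<pi> \<le> \<theta> * 1" using \<theta>0 by (intro mult_left_mono) auto
    then show ?thesis using \<theta>(2) by simp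
  qed
  have g0: "p0 \<le> p0 * (\<theta> * p0 + \<theta> * min 1 p0)"
  proof -
    have "\<theta> * min 1 p0 \<le> \<theta> * p0" using \<theta>0 by (intro mult_left_mono) auto
    then have "1 \<le> \<theta> * p0 + \<theta> * min 1 p0" using h0 by linarith
    then have "p0 * 1 \<le> p0 * (\<theta> * p0 + \<theta> * min 1 p0)" using p0 by (intro mult_left_mono) auto
    then show ?thesis by simp
  qed
  have g1: "p1 \<le> p0 * (\<theta> * p1 + \<theta> * min 1 p1)"
  proof -
    have "1 / (p0 * (1 + min 1 p1 / p1)) < \<theta>" using \<theta>(1) by simp
    then have "1 < \<theta> * (p0 * (1 + min 1 p1 / p1))" using key by (subst (asm) divide_less_eq) auto
    then have "p1 * 1 \<le> p1 * (\<theta> * (p0 * (1 + min 1 p1 / p1)))" using p1 by (intro mult_left_mono) auto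
    also have "\<dots> = p0 * (\<theta> * p1 + \<theta> * min 1 p1)" using p1 by (simp add: field_simps)
    finally show ?thesis by simp
  qed
  show ?thesis
    using \<theta>0 \<theta>(2) h0 h1 lt1[OF p0] lt1[OF p1] g0 g1 by (intro exI[of _ \<theta>]) (auto intro!: mult_left_mono)
qed

text \<open>The quasi-norm of \<open>{s < shadow P}\<close> is at most \<open>D * s powr - \<theta>\<close> times that of \<open>\<Omega>\<close>. An atom of
  height \<open>c * 2 ^ l\<close> matters at level \<open>c\<close> only where its shadow exceeds about \<open>s = 2 ^ - l\<close>, so
  \<open>\<theta> < 1\<close> is a gain over the growth of the heights. For \<open>s \<le> 1\<close> the weight
  \<open>(s powr - \<theta> * m) powr - p x\<close> is at most \<open>s powr r * m powr - p x\<close> whenever \<open>r \<le> \<theta> * p0\<close>, which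
  allows Chebyshev's inequality with a constant power \<open>r \<le> 1\<close> even where \<open>p x\<close> is large.\<close>

lemma shadow_weak_type:
  "\<exists>\<theta> D. 0 < \<theta> \<and> \<theta> < 1 \<and> 1 \<le> D \<and>
    (\<forall>m \<Omega> P child s. charged_cells p p0 p1 K m \<Omega> P child \<and> 0 < s \<and> s \<le> 1 \<longrightarrow>
      measure (modular p (D * (s powr - \<theta> * m))) {x \<in> {0..<1}. s < shadow P x} \<le> 1)"
proof -
  obtain \<theta> where \<theta>: "0 < \<theta>" "\<theta> < 1" and room: "\<And>\<pi>. \<pi> \<in> {p0, p1} \<Longrightarrow> 1 / 2 < \<theta> * min 1 \<pi> \<and>
      \<theta> * min 1 \<pi> < 1 \<and> \<theta> * min 1 \<pi> \<le> \<theta> * \<pi> \<and> \<pi> \<le> p0 * (\<theta> * \<pi> + \<theta> * min 1 \<pi>)"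
    using exponent_room by metis
  have p0: "0 < p0" using p0_gt by simp
  define r where "r \<pi> = \<theta> * min 1 \<pi>" for \<pi>
  have r: "1 / 2 < r \<pi>" "r \<pi> < 1" "r \<pi> \<le> \<theta> * \<pi>" "\<pi> \<le> p0 * (\<theta> * \<pi> + r \<pi>)" if "\<pi> \<in> {p0, p1}" for \<pi>
    using room[OF that] by (auto simp: r_def)
  define \<delta> where "\<delta> = (2 * r p0 - 1) / 2"
  have \<delta>: "0 < \<delta>" "\<delta> < 2 * r p0 - 1" using r[of p0] by (auto simp: \<delta>_def)
  \<comment> \<open>Beyond the digit \<open>j0\<close> the oscillation of the exponent costs only the exponent \<open>\<delta>\<close>.\<close>
  obtain j1 :: nat where j1: "log 2 K / (p0 * \<delta>) \<le> real j1" using real_arch_simple by blast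
  define j0 where "j0 = Suc j1"
  have "log 2 K / (p0 * \<delta>) \<le> real j0" using j1 by (simp add: j0_def)
  then have j0: "1 \<le> j0" "log 2 K \<le> real j0 * (p0 * \<delta>)"
    using p0 \<delta>(1) by (simp_all add: pos_divide_le_eq j0_def)
  define C1 where "C1 = 2 powr r p0 * (K powr (1 / p0) * 2 powr (1 + \<delta>) * (geom_bound (2 * r p0 - 1 - \<delta>) * geom_bound (1 - r p0)))"
  define A :: real where "A = 2 ^ j0 * 8"
  define Q where "Q \<pi> = real j0 * 2 ^ j0 * geom_bound (1 - r \<pi>)" for \<pi>
  define C2 where "C2 \<pi> = 2 powr r \<pi> * Q \<pi> * 2 powr (2 * r \<pi>) * A powr (\<theta> * \<pi> - r \<pi>)" for \<pi>
  have Q0: "0 \<le> Q \<pi>" if "\<pi> \<in> {p0, p1}" for \<pi>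
    using r[OF that] geom_bound_pos[of "1 - r \<pi>"] by (simp add: Q_def)
  have C20: "0 \<le> C2 \<pi>" if "\<pi> \<in> {p0, p1}" for \<pi> using Q0[OF that] by (simp add: C2_def)
  define C where "C = C1 + (C2 p0 + C2 p1)"
  \<comment> \<open>Scaling by \<open>D\<close> divides a modular by at least \<open>D powr p0\<close>.\<close>
  define D where "D = max 1 C powr (1 / p0)"
  have D1: "1 \<le> D" using p0 by (simp add: D_def ge_one_powr_ge_zero)
  have main: "measure (modular p (s powr - \<theta> * m)) {x \<in> {0..<1}. s < shadow P x} \<le> C"
    if cc: "charged_cells p p0 p1 K m \<Omega> P child" and s: "0 < s" "s \<le> 1" for m \<Omega> P child s
  proof -
    interpret charged_cells p p0 p1 K m \<Omega> P child by (rule cc)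
    define m' where "m' = s powr - \<theta> * m"
    have m': "0 < m'" using m s by (simp add: m'_def)
    have m'_powr: "m' powr - a = s powr (\<theta> * a) * m powr - a" for a
      using m s by (simp add: m'_def powr_mult powr_powr)
    interpret M': finite_measure "modular p m'" by (rule finite_modular[OF m'])
    define V where "V = {x \<in> {0..<1}. s / 2 < shadow_part {j0..} x}"
    define E where "E = {x \<in> {0..<1}. s / 2 < shadow_part {..<j0} x}"
    have V: "V \<in> sets unit_leb" and E: "E \<in> sets unit_leb"
      unfolding V_def E_def by (rule shadow_part_sets)+
    have half: "(s / 2) powr - a = 2 powr a * s powr - a" for a
      using s by (simp add: powr_divide powr_minus field_simps)
    have "{x \<in> {0..<1}. s < shadow P x} \<subseteq> V \<union> E"
      unfolding V_def E_def shadow_split[of _ j0] by auto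
    then have split: "measure (modular p m') {x \<in> {0..<1}. s < shadow P x} \<le> measure (modular p m') V + measure (modular p m') E"
      using V E by (intro order_trans[OF M'.finite_measure_mono measure_Un_le]) auto
    have bV: "measure (modular p m') V \<le> C1"
    proof -
      have "measure (modular p m') V \<le> s powr r p0 * measure (modular p m) V"
      proof (rule modular_compare[OF m(1) m' V])
        show "AE x in unit_leb. x \<in> V \<longrightarrow> m' powr - p x \<le> s powr r p0 * m powr - p x"
        proof (intro AE_I2 impI)
          fix x
          have "\<theta> * p0 \<le> \<theta> * p x" using \<theta> p_ge by (intro mult_left_mono) auto
          then have "r p0 \<le> \<theta> * p x" using r(3)[of p0] by simp
          then show "m' powr - p x \<le> s powr r p0 * m powr - p x"
            unfolding m'_powr using s by (intro mult_right_mono powr_mono') auto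
        qed
      qed simp
      also have "\<dots> \<le> s powr r p0 * ((s / 2) powr - r p0 *
          (K powr (1 / p0) * 2 powr (1 + \<delta>) * (geom_bound (2 * r p0 - 1 - \<delta>) * geom_bound (1 - r p0))))"
        unfolding V_def using s r[of p0] \<delta> j0 by (intro mult_left_mono fine_part_bound) auto
      also have "\<dots> = C1"
        unfolding half C1_def using s by (simp add: powr_minus)
      finally show ?thesis .
    qed
    have bE: "measure (modular p m') E \<le> C2 p0 + C2 p1"
    proof (cases "E = {}")
      case True
      then show ?thesis using C20 by simp
    next
      case False
      then obtain x where "s / 2 < shadow_part {..<j0} x" by (auto simp: E_def)
      then have sA: "s \<le> A * m powr p0" using coarse_part_le[of j0 x] by (simp add: A_def)
      \<comment> \<open>The weight is largest for one of the extreme exponents \<open>p0\<close> and \<open>p1\<close>, and each of them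
        gets its own power \<open>r \<pi>\<close> in Chebyshev's inequality.\<close>
      have piece: "m' powr - \<pi> * measure unit_leb E \<le> C2 \<pi>" if \<pi>: "\<pi> \<in> {p0, p1}" for \<pi>
      proof -
        have "measure unit_leb E \<le> (s / 2) powr - r \<pi> * (Q \<pi> * (2 * m powr p0) powr (2 * r \<pi>))"
          unfolding E_def Q_def using r[OF \<pi>] s by (intro coarse_part_bound) auto
        then have "m' powr - \<pi> * measure unit_leb E \<le> m' powr - \<pi> * ((s / 2) powr - r \<pi> * (Q \<pi> * (2 * m powr p0) powr (2 * r \<pi>)))"
          by (intro mult_left_mono) auto
        also have "\<dots> = 2 powr r \<pi> * Q \<pi> * 2 powr (2 * r \<pi>) * (s powr (\<theta> * \<pi>) * s powr - r \<pi>) * (m powr - \<pi> * m powr (p0 * (2 * r \<pi>)))"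
          unfolding m'_powr half using m by (simp add: powr_mult powr_powr)
        also have "s powr (\<theta> * \<pi>) * s powr - r \<pi> = s powr (\<theta> * \<pi> - r \<pi>)" by (simp add: powr_add[symmetric])
        also have "2 powr r \<pi> * Q \<pi> * 2 powr (2 * r \<pi>) * s powr (\<theta> * \<pi> - r \<pi>) * (m powr - \<pi> * m powr (p0 * (2 * r \<pi>)))
            \<le> 2 powr r \<pi> * Q \<pi> * 2 powr (2 * r \<pi>) * (A * m powr p0) powr (\<theta> * \<pi> - r \<pi>) * (m powr - \<pi> * m powr (p0 * (2 * r \<pi>)))"
          using sA s r[OF \<pi>] Q0[OF \<pi>] by (intro mult_right_mono mult_left_mono powr_mono2) auto
        also have "\<dots> = C2 \<pi> * m powr (p0 * (\<theta> * \<pi> + r \<pi>) - \<pi>)"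
          unfolding C2_def using m by (simp add: powr_mult powr_powr A_def powr_add[symmetric] algebra_simps)
        also have "\<dots> \<le> C2 \<pi> * m powr 0"
          using m r(4)[OF \<pi>] C20[OF \<pi>] by (intro mult_left_mono powr_mono') auto
        finally show ?thesis using m by simp
      qed
      have "measure (modular p m') E \<le> (m' powr - p0 + m' powr - p1) * measure (modular p 1) E"
        by (rule modular_compare[OF _ m' E]) (use weight_le[OF m'] in auto)
      also have "\<dots> = m' powr - p0 * measure unit_leb E + m' powr - p1 * measure unit_leb E"
        by (simp add: modular_1 distrib_right)
      also have "\<dots> \<le> C2 p0 + C2 p1" by (intro add_mono piece) auto
      finally show ?thesis .
    qed
    show ?thesis using split bV bE unfolding m'_def C_def by linarith
  qed
  have "measure (modular p (D * (s powr - \<theta> * m))) {x \<in> {0..<1}. s < shadow P x} \<le> 1"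
    if cc: "charged_cells p p0 p1 K m \<Omega> P child" and s: "0 < s" "s \<le> 1" for m \<Omega> P child s
  proof -
    have m0: "0 < m" using cc by (simp add: charged_cells_def charged_cells_axioms_def)
    have "measure (modular p (D * (s powr - \<theta> * m))) {x \<in> {0..<1}. s < shadow P x}
        \<le> D powr - p0 * measure (modular p (s powr - \<theta> * m)) {x \<in> {0..<1}. s < shadow P x}"
      using m0 s by (intro modular_le_scaled shadow_sets D1) auto
    also have "\<dots> \<le> D powr - p0 * C"
      by (intro mult_left_mono main[OF cc s]) auto
    also have "\<dots> \<le> D powr - p0 * max 1 C" by (intro mult_left_mono) auto
    also have "D powr - p0 = 1 / max 1 C"
      using p0 by (simp add: D_def powr_powr powr_minus divide_inverse)
    finally show ?thesis by (auto split: if_splits)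
  qed
  then show ?thesis using \<theta> D1 by blast
qed

lemma large_average_sets:
  assumes "dyadic_step T h"
  shows "{x \<in> {0..<1}. \<exists>k\<le>T. c < \<bar>cell_avg k h x\<bar>} \<in> sets unit_leb"
proof -
  have [measurable]: "cell_avg k h \<in> borel_measurable unit_leb" for k
    by (rule dyadic_step_measurable[of k]) (auto simp: dyadic_step_def cell_avg_cell)
  have "{x \<in> space unit_leb. \<exists>k\<le>T. c < \<bar>cell_avg k h x\<bar>} \<in> sets unit_leb" by measurable
  then show ?thesis by simp
qed

text \<open>If the sum of \<open>2 ^ l * shadow\<close> over the levels exceeds 1, then one of the terms exceeds a fixed
  multiple of \<open>2 powr (- \<epsilon> * l)\<close>, and the weak-type estimate applies to it. The exponent \<open>\<kappa>\<close> is
  slightly larger than \<open>(1 + \<epsilon>) * \<theta>\<close>, so that the modulars of these sets form a geometric series;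
  \<open>\<kappa> < 1\<close> is what makes the Lorentz quasi-norm summable over the levels.\<close>

lemma fejer_level_sets:
  "\<exists>\<kappa> C. 0 < \<kappa> \<and> \<kappa> < 1 \<and> 1 \<le> C \<and> (\<forall>T h c m. dyadic_step T h \<and> 0 < c \<and> 0 < m \<and>
     (\<forall>l. measure (modular p (m * 2 powr - (\<kappa> * real l))) {x \<in> {0..<1}. \<exists>k\<le>T. c * 2 ^ l < \<bar>cell_avg k h x\<bar>} \<le> 1) \<longrightarrow>
     measure (modular p (C * m)) {x \<in> {0..<1}. \<exists>n\<ge>1. 20 * c < \<bar>fejer_op n h x\<bar>} \<le> 1)"
proof -
  obtain \<theta> D where \<theta>: "0 < \<theta>" "\<theta> < 1" and D: "1 \<le> D"
    and weak: "\<And>m \<Omega> P child s. charged_cells p p0 p1 K m \<Omega> P child \<Longrightarrow> 0 < s \<Longrightarrow> s \<le> 1 \<Longrightarrow>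
      measure (modular p (D * (s powr - \<theta> * m))) {x \<in> {0..<1}. s < shadow P x} \<le> 1"
    using shadow_weak_type by blast
  have p0: "0 < p0" using p0_gt by simp
  define \<epsilon> where "\<epsilon> = (1 - \<theta>) / 2"
  define \<epsilon>' where "\<epsilon>' = (1 - \<theta>) / 4"
  define \<kappa> where "\<kappa> = (1 + \<epsilon>) * \<theta> + \<epsilon>'"
  have \<epsilon>: "0 < \<epsilon>" "0 < \<epsilon>'" using \<theta> by (auto simp: \<epsilon>_def \<epsilon>'_def)
  have \<kappa>0: "0 < \<kappa>" using \<theta> \<epsilon> by (simp add: \<kappa>_def add_pos_pos)
  have "\<epsilon> * \<theta> \<le> \<epsilon> * 1" using \<theta> \<epsilon> by (intro mult_left_mono) auto
  then have "\<kappa> \<le> \<theta> + \<epsilon> + \<epsilon>'" by (simp add: \<kappa>_def distrib_right)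
  also have "\<dots> < 1" using \<theta> by (simp add: \<epsilon>_def \<epsilon>'_def field_simps)
  finally have \<kappa>1: "\<kappa> < 1" .
  define c0 where "c0 = 1 / geom_bound \<epsilon>"
  have c0: "0 < c0" "c0 < 1" using \<epsilon> by (auto simp: c0_def geom_bound_def powr_less_one)
  define s where "s l = c0 * 2 powr (- (1 + \<epsilon>) * real l)" for l :: nat
  have s0: "0 < s l" and s1: "s l \<le> 1" for l
  proof -
    show "0 < s l" using c0 by (simp add: s_def)
    have "2 powr (- (1 + \<epsilon>) * real l) \<le> 2 powr 0" using \<epsilon> by (intro powr_mono mult_nonpos_nonneg) auto
    then have "c0 * 2 powr (- (1 + \<epsilon>) * real l) \<le> 1 * 1" using c0 by (intro mult_mono) auto
    then show "s l \<le> 1" by (simp add: s_def)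
  qed
  define G where "G = geom_bound (\<epsilon>' * p0)"
  have G1: "1 \<le> G" using \<epsilon> p0 by (simp add: G_def geom_bound_def powr_less_one)
  define D2 where "D2 = G powr (1 / p0)"
  have D21: "1 \<le> D2" using G1 p0 by (simp add: D2_def ge_one_powr_ge_zero)
  define C where "C = D * c0 powr - \<theta> * D2"
  have "c0 powr 0 \<le> c0 powr - \<theta>" using c0 \<theta> by (intro powr_mono') auto
  then have c0\<theta>: "1 \<le> c0 powr - \<theta>" using c0 by simp
  have "1 * 1 * 1 \<le> D * c0 powr - \<theta> * D2" using D c0\<theta> D21 by (intro mult_mono) auto
  then have C1: "1 \<le> C" by (simp add: C_def)
  have main: "measure (modular p (C * m)) {x \<in> {0..<1}. \<exists>n\<ge>1. 20 * c < \<bar>fejer_op n h x\<bar>} \<le> 1"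
    if h: "dyadic_step T h" and c: "0 < c" and m: "0 < m" and hyp: "\<And>l. measure (modular p (m * 2 powr - (\<kappa> * real l)))
        {x \<in> {0..<1}. \<exists>k\<le>T. c * 2 ^ l < \<bar>cell_avg k h x\<bar>} \<le> 1" for T h c m
  \<comment> \<open>The modular of any set is at most 1 for \<open>m \<ge> 1\<close>. For \<open>m < 1\<close> the hypothesis at \<open>l = 0\<close> excludes
    that the average over \<open>{0..<1}\<close> is large, as the level set would be everything.\<close>
  proof (cases "1 \<le> m")
    case True
    interpret unit: finite_measure unit_leb by (rule unit_leb_finite)
    have "1 * 1 \<le> C * m" using True C1 by (intro mult_mono) auto
    let ?S = "{x \<in> {0..<1}. \<exists>n\<ge>1. 20 * c < \<bar>fejer_op n h x\<bar>}"
    show ?thesis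
    proof (cases "?S \<in> sets unit_leb")
      case True
      have "measure (modular p (C * m)) ?S \<le> measure (modular p 1) ?S"
        using \<open>1 * 1 \<le> C * m\<close> by (intro modular_mono_m True) auto
      also have "\<dots> \<le> measure unit_leb {0..<1}"
        unfolding modular_1 using sets.top[of unit_leb] by (intro unit.finite_measure_mono) auto
      finally show ?thesis using measure_cell[of 0 0] by simp
    next
      case False
      then show ?thesis by (simp add: measure_notin_sets)
    qed
  next
    case False
    then have m1: "m < 1" by simp
    define \<Omega> where "\<Omega> l = {x \<in> {0..<1}. \<exists>k\<le>T. c * 2 ^ l < \<bar>cell_avg k h x\<bar>}" for l :: nat
    have \<Omega>s: "\<Omega> l \<in> sets unit_leb" for l unfolding \<Omega>_def by (rule large_average_sets[OF h])
    have avg0: "\<bar>cell_avg 0 h 0\<bar> \<le> c"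
    proof (rule ccontr)
      assume "\<not> \<bar>cell_avg 0 h 0\<bar> \<le> c"
      then have "\<Omega> 0 = {0..<1}" by (auto simp: \<Omega>_def cell_avg_def intro!: exI[of _ 0])
      then have "measure (modular p m) {0..<1} \<le> 1" using hyp[of 0] m by (simp add: \<Omega>_def)
      then have "m powr p0 * measure (modular p m) {0..<1} \<le> m powr p0 * 1"
        by (intro mult_left_mono) auto
      moreover have "measure unit_leb (cell 0 0) \<le> m powr p0 * measure (modular p m) (cell 0 0)"
        using m m1 p_ge by (intro modular_ge_lebesgue) auto
      then have "1 \<le> m powr p0 * measure (modular p m) {0..<1}"
        using measure_cell[of 0 0] by (simp del: measure_cell)
      moreover have "m powr p0 < 1" using m m1 p0 by (simp add: powr01_less_one)
      ultimately show False by simp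
    qed
    obtain L where L: "\<And>x n. x \<in> {0..<1} \<Longrightarrow> 1 \<le> n \<Longrightarrow> 1 \<le> shadow (stop_cells T h c) x \<or>
        \<bar>fejer_op n h x\<bar> \<le> 8 * c + (\<Sum>l<L. 12 * c * 2 ^ l * shadow (stop_cells T h (c * 2 ^ l)) x)"
      using fejer_op_pointwise[OF h c avg0] by blast
    define E where "E l = {x \<in> {0..<1}. s l < shadow (stop_cells T h (c * 2 ^ l)) x}" for l :: nat
    have Es: "E l \<in> sets unit_leb" for l unfolding E_def by (rule shadow_sets)
    have cover: "{x \<in> {0..<1}. \<exists>n\<ge>1. 20 * c < \<bar>fejer_op n h x\<bar>} \<subseteq> (\<Union>l\<in>{..L}. E l)"
    proof
      fix x assume "x \<in> {x \<in> {0..<1}. \<exists>n\<ge>1. 20 * c < \<bar>fejer_op n h x\<bar>}"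
      then obtain n where x: "x \<in> {0..<1}" and n: "1 \<le> n" "20 * c < \<bar>fejer_op n h x\<bar>" by auto
      show "x \<in> (\<Union>l\<in>{..L}. E l)"
      proof (cases "1 \<le> shadow (stop_cells T h c) x")
        case True
        then have "x \<in> E 0" using x c0 by (simp add: E_def s_def)
        then show ?thesis by blast
      next
        case False
        let ?V = "\<lambda>l. shadow (stop_cells T h (c * 2 ^ l)) x"
        have "20 * c < 8 * c + (\<Sum>l<L. 12 * c * 2 ^ l * ?V l)"
          using L[OF x n(1)] False n(2) by linarith
        also have "(\<Sum>l<L. 12 * c * 2 ^ l * ?V l) = 12 * c * (\<Sum>l<L. 2 ^ l * ?V l)"
          by (simp add: sum_distrib_left mult.assoc)
        finally have big: "1 < (\<Sum>l<L. 2 ^ l * ?V l)" using c by simp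
        have "\<exists>l<L. s l < ?V l"
        proof (rule ccontr)
          assume "\<not> (\<exists>l<L. s l < ?V l)"
          then have "(\<Sum>l<L. 2 ^ l * ?V l) \<le> (\<Sum>l<L. 2 ^ l * s l)"
            by (intro sum_mono mult_left_mono) (meson lessThan_iff not_less, simp)
          also have "\<dots> = (\<Sum>l<L. c0 * 2 powr (- real l * \<epsilon>))"
            by (intro sum.cong refl) (simp add: s_def powr_realpow[symmetric] powr_add[symmetric] algebra_simps)
          also have "\<dots> = c0 * (\<Sum>l<L. 2 powr (- real l * \<epsilon>))" by (simp add: sum_distrib_left)
          also have "\<dots> \<le> c0 * geom_bound \<epsilon>"
            using c0 \<epsilon> by (intro mult_left_mono geometric_sum_le) auto
          also have "\<dots> = 1" using geom_bound_pos[OF \<epsilon>(1)] by (simp add: c0_def)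
          finally show False using big by simp
        qed
        then show ?thesis using x by (force simp: E_def)
      qed
    qed
    have piece: "measure (modular p (C * m)) (E l) \<le> D2 powr - p0 * 2 powr (- real l * (\<epsilon>' * p0))" for l
    proof -
      define ml where "ml = m * 2 powr - (\<kappa> * real l)"
      have "2 powr - (\<kappa> * real l) \<le> 2 powr 0" using \<kappa>0 by (intro powr_mono) auto
      then have "m * 2 powr - (\<kappa> * real l) \<le> 1 * 1" using m m1 by (intro mult_mono) auto
      then have ml: "0 < ml" "ml \<le> 1" using m by (auto simp: ml_def)
      let ?P = "stop_cells T h (c * 2 ^ l)"
      have "\<exists>u. u \<in> cell (fst q) (snd q) \<and> cell (Suc (fst q)) u \<subseteq> \<Omega> l" if "q \<in> ?P" for q
      proof -
        have "(fst q, snd q) \<in> ?P" using that by simp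
        then obtain u where "u \<in> cell (fst q) (snd q)"
            "cell (Suc (fst q)) u \<subseteq> {x \<in> {0..<1}. \<exists>k\<le>T. c * 2 ^ l < \<bar>cell_avg k h x\<bar>}"
          by (rule stop_cell_has_large_child)
        then show ?thesis unfolding \<Omega>_def by blast
      qed
      then have "\<forall>q. \<exists>u. q \<in> ?P \<longrightarrow> u \<in> cell (fst q) (snd q) \<and> cell (Suc (fst q)) u \<subseteq> \<Omega> l"
        by blast
      from choice[OF this] obtain child where
        child: "\<And>q. q \<in> ?P \<Longrightarrow> child q \<in> cell (fst q) (snd q) \<and> cell (Suc (fst q)) (child q) \<subseteq> \<Omega> l"
        by blast
      have "charged_cells p p0 p1 K ml (\<Omega> l) ?P child"
      proof (intro charged_cells.intro charged_cells_axioms.intro)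
        show "dyadic_exponent p p0 p1 K" by (rule dyadic_exponent_axioms)
        show "measure (modular p ml) (\<Omega> l) \<le> 1" unfolding ml_def \<Omega>_def by (rule hyp)
      qed (use ml \<Omega>s child disjoint_stop_cells in auto)
      then have 1: "measure (modular p (D * (s l powr - \<theta> * ml))) (E l) \<le> 1"
        unfolding E_def by (rule weak[OF _ s0 s1])
      have "s l powr - \<theta> = c0 powr - \<theta> * 2 powr ((1 + \<epsilon>) * real l * \<theta>)"
        using c0 by (simp add: s_def powr_mult powr_powr algebra_simps)
      then have "s l powr - \<theta> * ml = c0 powr - \<theta> * m * (2 powr ((1 + \<epsilon>) * real l * \<theta>) * 2 powr - (\<kappa> * real l))"
        by (simp add: ml_def)
      also have "2 powr ((1 + \<epsilon>) * real l * \<theta>) * 2 powr - (\<kappa> * real l) = 2 powr (- (\<epsilon>' * real l))"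
        by (simp add: powr_add[symmetric] \<kappa>_def algebra_simps)
      finally have sm: "D * (s l powr - \<theta> * ml) = D * (c0 powr - \<theta> * m * 2 powr (- (\<epsilon>' * real l)))" by simp
      have Cm: "C * m = (D2 * 2 powr (\<epsilon>' * real l)) * (D * (s l powr - \<theta> * ml))"
        unfolding sm by (simp add: C_def powr_minus)
      have "1 * 1 \<le> D2 * 2 powr (\<epsilon>' * real l)"
        using D21 \<epsilon> by (intro mult_mono) (auto intro!: ge_one_powr_ge_zero)
      then have "measure (modular p (C * m)) (E l)
          \<le> (D2 * 2 powr (\<epsilon>' * real l)) powr - p0 * measure (modular p (D * (s l powr - \<theta> * ml))) (E l)"
        unfolding Cm using D s0[of l] ml by (intro modular_le_scaled Es) (auto intro!: mult_pos_pos)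
      also have "\<dots> \<le> (D2 * 2 powr (\<epsilon>' * real l)) powr - p0 * 1"
        by (intro mult_left_mono 1) auto
      also have "\<dots> = D2 powr - p0 * 2 powr (- real l * (\<epsilon>' * p0))"
        using D21 by (simp add: powr_mult powr_powr mult_ac)
      finally show ?thesis .
    qed
    interpret M: finite_measure "modular p (C * m)" by (rule finite_modular) (use C1 m in auto)
    have "measure (modular p (C * m)) {x \<in> {0..<1}. \<exists>n\<ge>1. 20 * c < \<bar>fejer_op n h x\<bar>} \<le> measure (modular p (C * m)) (\<Union>l\<in>{..L}. E l)"
      using Es by (intro M.finite_measure_mono cover) auto
    also have "\<dots> \<le> (\<Sum>l\<le>L. measure (modular p (C * m)) (E l))"
      using Es by (intro M.finite_measure_subadditive_finite) auto
    also have "\<dots> \<le> (\<Sum>l\<le>L. D2 powr - p0 * 2 powr (- real l * (\<epsilon>' * p0)))"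
      by (intro sum_mono piece)
    also have "\<dots> = D2 powr - p0 * (\<Sum>l\<le>L. 2 powr (- real l * (\<epsilon>' * p0)))" by (simp add: sum_distrib_left)
    also have "\<dots> \<le> D2 powr - p0 * G"
      unfolding G_def using \<epsilon> p0 by (intro mult_left_mono geometric_sum_le) auto
    also have "\<dots> = 1" using p0 G1 by (simp add: D2_def powr_powr powr_minus)
    finally show ?thesis .
  qed
  show ?thesis using \<kappa>0 \<kappa>1 C1 main by blast
qed

end

section \<open>Dyadic martingales as step functions\<close>

lemma space_dyadic_algebra [simp]: "space (dyadic_algebra n) = {0..<1}"
  unfolding dyadic_algebra_def using dyadic_interval_subset_unit by (intro space_measure_of) blast

lemma sets_dyadic_algebra:
  "sets (dyadic_algebra n) = sigma_sets {0..<1} {dyadic_interval n k | k. k < 2 ^ n}"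
  unfolding dyadic_algebra_def using dyadic_interval_subset_unit by (intro sets_measure_of) blast

lemma dyadic_interval_in_algebra: "k < 2 ^ n \<Longrightarrow> dyadic_interval n k \<in> sets (dyadic_algebra n)"
  unfolding sets_dyadic_algebra by blast

lemma subalgebra_dyadic: "subalgebra unit_leb (dyadic_algebra n)"
proof -
  have "sigma_sets (space unit_leb) {dyadic_interval n k | k. k < 2 ^ n} \<subseteq> sets unit_leb"
    by (rule sets.sigma_sets_subset) (use dyadic_interval_sets in blast)
  then show ?thesis by (simp add: subalgebra_def sets_dyadic_algebra)
qed

text \<open>Being a union of cells is preserved by complements and countable unions.\<close>

lemma dyadic_algebra_saturated:
  assumes "A \<in> sets (dyadic_algebra n)" "x \<in> {0..<1}" "y \<in> cell n x"
  shows "x \<in> A \<longleftrightarrow> y \<in> A"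
  using assms(1) unfolding sets_dyadic_algebra
proof (induction rule: sigma_sets.induct)
  case (Basic a)
  then obtain k where k: "k < 2 ^ n" "a = dyadic_interval n k" by blast
  then have "a = cell n (real k / 2 ^ n)" using dyadic_interval_eq_cell left_endpoint_mem by blast
  then show ?case using assms(2,3) by (auto simp: mem_cell_iff)
next
  case (Compl a)
  then show ?case using assms(2,3) cell_subset_unit by blast
qed auto

lemma dyadic_step_iff_measurable: "dyadic_step n g \<longleftrightarrow> g \<in> borel_measurable (dyadic_algebra n)"
proof
  assume g: "g \<in> borel_measurable (dyadic_algebra n)"
  show "dyadic_step n g"
    unfolding dyadic_step_def
  proof (intro ballI)
    fix x y assume xy: "x \<in> {0..<1}" "y \<in> cell n x"
    have "g -` {g x} \<inter> space (dyadic_algebra n) \<in> sets (dyadic_algebra n)"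
      by (rule measurable_sets[OF g]) simp
    from dyadic_algebra_saturated[OF this xy] show "g y = g x" using xy by auto
  qed
next
  assume g: "dyadic_step n g"
  have "(\<lambda>x. \<Sum>k<2 ^ n. g (real k / 2 ^ n) * indicator (dyadic_interval n k) x) \<in> borel_measurable (dyadic_algebra n)"
    by (intro borel_measurable_sum borel_measurable_times borel_measurable_const borel_measurable_indicator dyadic_interval_in_algebra) auto
  then show "g \<in> borel_measurable (dyadic_algebra n)"
    by (subst measurable_cong[OF dyadic_step_sum_indicator[OF g]]) auto
qed

lemma martingale_step: "dyadic_martingale f \<Longrightarrow> dyadic_step n (f n)"
  unfolding dyadic_step_iff_measurable dyadic_martingale_def by blast

text \<open>The martingale property holds only almost everywhere; integrating against step functions turns it
  into identities for cell averages, which hold everywhere.\<close>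

lemma martingale_integral:
  assumes f: "dyadic_martingale f" and g: "dyadic_step n g" and nT: "n \<le> T"
  shows "(LINT x|unit_leb. g x * f T x) = (LINT x|unit_leb. g x * f n x)"
proof -
  interpret finite_measure unit_leb by (rule unit_leb_finite)
  interpret S: finite_measure_subalgebra unit_leb "dyadic_algebra n"
    by unfold_locales (rule subalgebra_dyadic)
  have fT: "dyadic_step T (f T)" and fn: "dyadic_step n (f n)" using martingale_step[OF f] by auto
  have "(LINT x|unit_leb. g x * real_cond_exp unit_leb (dyadic_algebra n) (f T) x) = (LINT x|unit_leb. g x * f T x)"
    using g by (intro S.real_cond_exp_intg(2) integrable_step_mult[OF g fT] dyadic_step_measurable[OF fT])
       (simp add: dyadic_step_iff_measurable)
  moreover have "(LINT x|unit_leb. g x * real_cond_exp unit_leb (dyadic_algebra n) (f T) x) = (LINT x|unit_leb. g x * f n x)"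
  proof (rule integral_cong_AE)
    have "AE x in unit_leb. real_cond_exp unit_leb (dyadic_algebra n) (f T) x = f n x"
      using f nT by (auto simp: dyadic_martingale_def)
    then show "AE x in unit_leb. g x * real_cond_exp unit_leb (dyadic_algebra n) (f T) x = g x * f n x"
      by eventually_elim simp
  qed (use dyadic_step_measurable[OF g] dyadic_step_measurable[OF fn] in measurable)
  ultimately show ?thesis by simp
qed

lemma martingale_cell_avg:
  assumes f: "dyadic_martingale f" and "n \<le> T" "x \<in> {0..<1}"
  shows "cell_avg n (f T) x = f n x"
proof -
  have "cell_avg n (f T) x = cell_avg n (f n) x"
    unfolding cell_avg_def martingale_integral[OF f dyadic_step_cell assms(2)] ..
  also have "\<dots> = f n x" by (rule cell_avg_top[OF martingale_step[OF f] assms(3)])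
  finally show ?thesis .
qed

lemma walsh_eq_walsh_sign: "walsh k x = walsh_sign (\<lambda>l. rademacher l x) k"
  by (simp add: walsh_def walsh_sign_def)

lemma dyadic_step_walsh: "k < 2 ^ N \<Longrightarrow> dyadic_step N (walsh k)"
  unfolding dyadic_step_def walsh_eq_walsh_sign
  by (intro ballI walsh_sign_cong[of k N]) (auto simp: mem_cell_iff)

lemma walsh_coeff_eq:
  assumes f: "dyadic_martingale f" and k: "k < 2 ^ T"
  shows "walsh_coeff f k = (LINT x|unit_leb. f T x * walsh k x)"
proof -
  have eq: "(LINT x|unit_leb. f N x * walsh k x) = (LINT x|unit_leb. f T x * walsh k x)" if "T \<le> N" for N
    using martingale_integral[OF f dyadic_step_walsh[OF k] that] by (simp only: mult.commute)
  have "(\<lambda>N. LINT x|unit_leb. f N x * walsh k x) \<longlonglongrightarrow> (LINT x|unit_leb. f T x * walsh k x)"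
    by (rule tendsto_eventually, rule eventually_sequentiallyI, erule eq)
  then show ?thesis unfolding walsh_coeff_def by (rule limI)
qed

text \<open>A Fejer mean of order \<open>n \<le> 2 ^ T\<close> only involves Walsh coefficients below \<open>2 ^ T\<close>, which are those
  of the step function \<open>f T\<close>.\<close>

lemma fejer_mean_eq:
  assumes f: "dyadic_martingale f" and n: "n \<le> 2 ^ T"
  shows "fejer_mean f n x = fejer_op n (f T) x"
proof -
  have int: "integrable unit_leb (\<lambda>t. f T t * walsh k t * walsh k x)" if "k < 2 ^ T" for k
    by (intro integrable_mult_left integrable_step_mult[OF martingale_step[OF f] dyadic_step_walsh[OF that]])
  have kT: "k < 2 ^ T" if "m \<in> {1..n}" "k < m" for m k using that n by simp
  have "(\<Sum>m=1..n. walsh_partial_sum f m x)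
      = (\<Sum>m=1..n. \<Sum>k<m. LINT t|unit_leb. f T t * walsh k t * walsh k x)"
    unfolding walsh_partial_sum_def using kT by (intro sum.cong refl) (auto simp: walsh_coeff_eq[OF f])
  also have "\<dots> = (\<Sum>m=1..n. LINT t|unit_leb. (\<Sum>k<m. f T t * walsh k t * walsh k x))"
    using int kT by (intro sum.cong refl Bochner_Integration.integral_sum[symmetric]) auto
  also have "\<dots> = (LINT t|unit_leb. (\<Sum>m=1..n. \<Sum>k<m. f T t * walsh k t * walsh k x))"
    using int kT by (intro Bochner_Integration.integral_sum[symmetric] Bochner_Integration.integrable_sum) auto
  also have "\<dots> = (LINT t|unit_leb. f T t * fejer_sum (\<lambda>l. rademacher l x * rademacher l t) n)"
    by (intro Bochner_Integration.integral_cong refl)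
       (simp add: fejer_sum_def dirichlet_sum_def walsh_eq_walsh_sign walsh_sign_def prod.distrib sum_distrib_left mult_ac)
  finally show ?thesis by (simp add: fejer_mean_def fejer_op_def fejer_kernel_def)
qed

lemma dyadic_step_fejer_op: "dyadic_step n (fejer_op n h)"
proof -
  have "fejer_kernel n y t = fejer_kernel n x t" if "y \<in> cell n x" for x y t
    unfolding fejer_kernel_def using that
    by (subst fejer_sum_cong[where N = n and e = "\<lambda>l. rademacher l y * rademacher l t"
          and e' = "\<lambda>l. rademacher l x * rademacher l t"]) (auto simp: mem_cell_iff less_imp_le)
  then show ?thesis unfolding dyadic_step_def fejer_op_def by simp
qed

lemma measurable_fejer_mean: "dyadic_martingale f \<Longrightarrow> fejer_mean f n \<in> borel_measurable unit_leb"
  using fejer_mean_eq[of f n n] dyadic_step_measurable[OF dyadic_step_fejer_op[of n "f n"]]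
  by (subst measurable_cong[of _ _ "fejer_op n (f n)"]) (auto simp: less_imp_le)

lemma fejer_max_sets:
  assumes "dyadic_martingale f"
  shows "{x \<in> {0..<1}. c < fejer_max f x} \<in> sets unit_leb"
proof -
  note [measurable] = measurable_fejer_mean[OF assms]
  have "fejer_max f \<in> borel_measurable unit_leb" unfolding fejer_max_def by measurable
  then have "{x \<in> space unit_leb. c < fejer_max f x} \<in> sets unit_leb" by measurable
  then show ?thesis by simp
qed

lemma martingale_max_sets:
  assumes "dyadic_martingale f"
  shows "{x \<in> {0..<1}. c < martingale_max f x} \<in> sets unit_leb"
proof -
  note [measurable] = dyadic_step_measurable[OF martingale_step[OF assms]]
  have "martingale_max f \<in> borel_measurable unit_leb" unfolding martingale_max_def by measurable
  then have "{x \<in> space unit_leb. c < martingale_max f x} \<in> sets unit_leb" by measurable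
  then show ?thesis by simp
qed

section \<open>Quasi-norms of level sets\<close>

context dyadic_exponent
begin

lemma var_norm_indicator:
  assumes "E \<in> sets unit_leb"
  shows "var_norm p (indicator E) = Inf {ennreal l | l. 0 < l \<and> measure (modular p l) E \<le> 1}"
proof -
  have "(\<integral>\<^sup>+ x. ennpowr (indicator E x / ennreal l) (p x) \<partial>unit_leb) = ennreal (measure (modular p l) E)"
    if l: "0 < l" for l
  proof -
    interpret finite_measure "modular p l" by (rule finite_modular[OF l])
    have "ennpowr (indicator E x / ennreal l) (p x) = ennreal (l powr - p x) * indicator E x" for x
    proof (cases "x \<in> E")
      case True
      have "1 / ennreal l = ennreal (1 / l)" using divide_ennreal[of 1 l] l by simp
      then show ?thesis using True l by (simp add: ennpowr_def inverse_powr powr_minus divide_inverse)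
    qed (simp add: ennpowr_def)
    then show ?thesis using emeasure_modular[OF assms, of l] by (simp add: emeasure_eq_measure)
  qed
  then have "{ennreal l | l. 0 < l \<and> (\<integral>\<^sup>+ x. ennpowr (indicator E x / ennreal l) (p x) \<partial>unit_leb) \<le> 1}
      = {ennreal l | l. 0 < l \<and> measure (modular p l) E \<le> 1}"
    by (intro Collect_cong ex_cong1) (auto simp: ennreal_le_1)
  then show ?thesis by (simp add: var_norm_def)
qed

lemma var_norm_le:
  "E \<in> sets unit_leb \<Longrightarrow> 0 < l \<Longrightarrow> measure (modular p l) E \<le> 1 \<Longrightarrow> var_norm p (indicator E) \<le> ennreal l"
  unfolding var_norm_indicator by (intro Inf_lower) blast

lemma modular_le_1:
  assumes E: "E \<in> sets unit_leb" and less: "var_norm p (indicator E) < ennreal l"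
  shows "measure (modular p l) E \<le> 1"
proof -
  obtain l' where l': "0 < l'" "measure (modular p l') E \<le> 1" "ennreal l' < ennreal l"
    using less unfolding var_norm_indicator[OF E] Inf_less_iff by blast
  then have "l' \<le> l" by (simp add: ennreal_less_iff)
  then show ?thesis using modular_mono_m[OF l'(1) _ E] l'(2) order_trans by blast
qed

lemma var_norm_le_1:
  assumes E: "E \<in> sets unit_leb"
  shows "var_norm p (indicator E) \<le> 1"
proof -
  interpret finite_measure unit_leb by (rule unit_leb_finite)
  have "measure unit_leb E \<le> measure unit_leb (cell 0 0)"
    using E sets.sets_into_space[OF E] by (intro finite_measure_mono) auto
  also have "\<dots> = 1" by (subst measure_cell) simp
  finally have "measure (modular p 1) E \<le> 1" by (simp add: modular_1)
  from var_norm_le[OF E _ this] show ?thesis by simp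
qed

lemma var_norm_mono:
  assumes E: "E \<in> sets unit_leb" "E' \<in> sets unit_leb" and sub: "E \<subseteq> E'"
  shows "var_norm p (indicator E) \<le> var_norm p (indicator E')"
  unfolding var_norm_indicator[OF E(1)] var_norm_indicator[OF E(2)]
proof (intro Inf_superset_mono Collect_mono impI, elim exE conjE)
  fix z l assume l: "z = ennreal l" "0 < l" "measure (modular p l) E' \<le> 1"
  interpret finite_measure "modular p l" by (rule finite_modular[OF l(2)])
  have "measure (modular p l) E \<le> measure (modular p l) E'"
    using E sub by (intro finite_measure_mono) auto
  then show "\<exists>l. z = ennreal l \<and> 0 < l \<and> measure (modular p l) E \<le> 1" using l by auto
qed

definition level_norm :: "(real \<Rightarrow> ennreal) \<Rightarrow> real \<Rightarrow> ennreal" where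
  "level_norm g c = var_norm p (indicator {x \<in> {0..<1}. ennreal c < g x})"

text \<open>For each \<open>T\<close> the estimate for level sets applies to the step function \<open>f T\<close> and the Fejer means
  of order at most \<open>2 ^ T\<close>, with a constant independent of \<open>T\<close>; these level sets increase with
  \<open>T\<close>, so the bound of their modulars passes to the limit.\<close>

lemma level_norm_comparison:
  "\<exists>\<kappa> C. 0 < \<kappa> \<and> \<kappa> < 1 \<and> 1 \<le> C \<and> (\<forall>f c m. dyadic_martingale f \<and> 0 < c \<and> 0 < m \<and>
     (\<forall>l. level_norm (martingale_max f) (c * 2 ^ l) < ennreal (m * 2 powr - (\<kappa> * real l))) \<longrightarrow>
     level_norm (fejer_max f) (20 * c) \<le> ennreal (C * m))"
proof -
  obtain \<kappa> C where \<kappa>: "0 < \<kappa>" "\<kappa> < 1" and C: "1 \<le> C" and all: "\<forall>T h c m. dyadic_step T h \<and> 0 < c \<and> 0 < m \<and>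
     (\<forall>l. measure (modular p (m * 2 powr - (\<kappa> * real l))) {x \<in> {0..<1}. \<exists>k\<le>T. c * 2 ^ l < \<bar>cell_avg k h x\<bar>} \<le> 1) \<longrightarrow>
     measure (modular p (C * m)) {x \<in> {0..<1}. \<exists>n\<ge>1. 20 * c < \<bar>fejer_op n h x\<bar>} \<le> 1"
    using fejer_level_sets by (elim exE conjE)
  have level: "measure (modular p (C * m)) {x \<in> {0..<1}. \<exists>n\<ge>1. 20 * c < \<bar>fejer_op n h x\<bar>} \<le> 1"
    if "dyadic_step T h" "0 < c" "0 < m"
      "\<And>l. measure (modular p (m * 2 powr - (\<kappa> * real l))) {x \<in> {0..<1}. \<exists>k\<le>T. c * 2 ^ l < \<bar>cell_avg k h x\<bar>} \<le> 1" for T h c m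
    by (rule all[THEN spec[of _ T], THEN spec[of _ h], THEN spec[of _ c], THEN spec[of _ m], THEN mp])
       (intro conjI allI that)
  have "level_norm (fejer_max f) (20 * c) \<le> ennreal (C * m)"
    if f: "dyadic_martingale f" and c: "0 < c" and m: "0 < m"
      and hyp: "\<And>l. level_norm (martingale_max f) (c * 2 ^ l) < ennreal (m * 2 powr - (\<kappa> * real l))" for f c m
  proof -
    have Cm: "0 < C * m" using C m by simp
    interpret M: finite_measure "modular p (C * m)" by (rule finite_modular[OF Cm])
    note [measurable] = dyadic_step_measurable[OF dyadic_step_fejer_op] measurable_fejer_mean[OF f]
    define E where "E T = {x \<in> {0..<1}. \<exists>n\<in>{1..2 ^ T}. 20 * c < \<bar>fejer_mean f n x\<bar>}" for T :: nat
    have E_le: "measure (modular p (C * m)) (E T) \<le> 1" for T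
    proof -
      have "measure (modular p (m * 2 powr - (\<kappa> * real l))) {x \<in> {0..<1}. \<exists>k\<le>T. c * 2 ^ l < \<bar>cell_avg k (f T) x\<bar>} \<le> 1" for l
      proof -
        let ?\<Omega> = "{x \<in> {0..<1}. ennreal (c * 2 ^ l) < martingale_max f x}"
        interpret Ml: finite_measure "modular p (m * 2 powr - (\<kappa> * real l))" by (rule finite_modular) (use m in simp)
        have "{x \<in> {0..<1}. \<exists>k\<le>T. c * 2 ^ l < \<bar>cell_avg k (f T) x\<bar>} \<subseteq> ?\<Omega>"
          using c martingale_cell_avg[OF f] by (auto simp: martingale_max_def less_SUP_iff ennreal_less_iff)
        then have "measure (modular p (m * 2 powr - (\<kappa> * real l))) {x \<in> {0..<1}. \<exists>k\<le>T. c * 2 ^ l < \<bar>cell_avg k (f T) x\<bar>}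
            \<le> measure (modular p (m * 2 powr - (\<kappa> * real l))) ?\<Omega>"
          using martingale_max_sets[OF f] by (intro Ml.finite_measure_mono) auto
        also have "\<dots> \<le> 1"
          using hyp[of l] martingale_max_sets[OF f] unfolding level_norm_def by (intro modular_le_1)
        finally show ?thesis .
      qed
      then have "measure (modular p (C * m)) {x \<in> {0..<1}. \<exists>n\<ge>1. 20 * c < \<bar>fejer_op n (f T) x\<bar>} \<le> 1"
        by (rule level[OF martingale_step[OF f] c m])
      moreover have "measure (modular p (C * m)) (E T)
          \<le> measure (modular p (C * m)) {x \<in> {0..<1}. \<exists>n\<ge>1. 20 * c < \<bar>fejer_op n (f T) x\<bar>}"
      proof (rule M.finite_measure_mono)
        show "E T \<subseteq> {x \<in> {0..<1}. \<exists>n\<ge>1. 20 * c < \<bar>fejer_op n (f T) x\<bar>}"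
          by (auto simp: E_def fejer_mean_eq[OF f, where T = T])
        have "{x \<in> space unit_leb. \<exists>n\<ge>1. 20 * c < \<bar>fejer_op n (f T) x\<bar>} \<in> sets unit_leb" by measurable
        then show "{x \<in> {0..<1}. \<exists>n\<ge>1. 20 * c < \<bar>fejer_op n (f T) x\<bar>} \<in> sets (modular p (C * m))" by simp
      qed
      ultimately show ?thesis by linarith
    qed
    have Es: "E T \<in> sets unit_leb" for T
    proof -
      have "{x \<in> space unit_leb. \<exists>n\<in>{1..2 ^ T}. 20 * c < \<bar>fejer_mean f n x\<bar>} \<in> sets unit_leb" by measurable
      then show ?thesis by (simp add: E_def)
    qed
    have "incseq E"
    proof (rule incseq_SucI, rule subsetI)
      fix T x assume "x \<in> E T"
      then obtain n where "x \<in> {0..<1}" "1 \<le> n" "n \<le> 2 ^ T" "20 * c < \<bar>fejer_mean f n x\<bar>" by (auto simp: E_def)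
      moreover from this have "n \<le> 2 ^ Suc T" by simp
      ultimately show "x \<in> E (Suc T)" unfolding E_def by force
    qed
    then have "(\<lambda>T. measure (modular p (C * m)) (E T)) \<longlonglongrightarrow> measure (modular p (C * m)) (\<Union>T. E T)"
      using Es by (intro M.finite_Lim_measure_incseq) auto
    then have le1: "measure (modular p (C * m)) (\<Union>T. E T) \<le> 1"
      by (rule LIMSEQ_le_const2) (use E_le in auto)
    have "(\<Union>T. E T) = {x \<in> {0..<1}. ennreal (20 * c) < fejer_max f x}"
    proof (intro set_eqI iffI)
      fix x assume "x \<in> (\<Union>T. E T)"
      then show "x \<in> {x \<in> {0..<1}. ennreal (20 * c) < fejer_max f x}"
        using c by (auto simp: E_def fejer_max_def less_SUP_iff ennreal_less_iff)
    next
      fix x assume "x \<in> {x \<in> {0..<1}. ennreal (20 * c) < fejer_max f x}"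
      then obtain n where n: "x \<in> {0..<1}" "1 \<le> n" "20 * c < \<bar>fejer_mean f n x\<bar>"
        using c by (auto simp: fejer_max_def less_SUP_iff ennreal_less_iff)
      have "n \<in> {1..2 ^ n}" using n(2) by (simp add: less_imp_le)
      then have "x \<in> E n" using n unfolding E_def by blast
      then show "x \<in> (\<Union>T. E T)" by blast
    qed
    then show ?thesis
      unfolding level_norm_def using le1 Es fejer_max_sets[OF f] by (intro var_norm_le Cm) auto
  qed
  then show ?thesis using \<kappa> C by (intro exI[of _ \<kappa>] exI[of _ C]) auto
qed

end

section \<open>Summation over the levels\<close>

lemma ennreal_finite_ex: "S \<noteq> \<top> \<Longrightarrow> \<exists>z\<ge>0. S = ennreal z"
  by (cases S) auto

lemma suminf_ennreal_ge: "f l \<le> (\<Sum>l. f l :: ennreal)" for f :: "nat \<Rightarrow> ennreal"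
  using sum_le_suminf[of f "{l}"] by (simp add: summableI)

text \<open>If \<open>w\<close> and \<open>v\<close> are the quasi-norms of the level sets, an estimate of \<open>v\<close> by the
  supremum of \<open>2 powr (\<kappa> * l) * w (c * 2 ^ l)\<close> is integrated after replacing the supremum by a
  sum and rescaling each term.\<close>

lemma level_integral_comparison:
  fixes w v :: "real \<Rightarrow> real"
  assumes a: "0 < a" and C: "0 < C" and \<kappa>: "\<kappa> < 1"
    and w: "\<And>c. 0 \<le> w c" and v: "\<And>c. 0 \<le> v c" and [measurable]: "w \<in> borel_measurable borel"
    and le: "\<And>c m. 0 < c \<Longrightarrow> 0 < m \<Longrightarrow> (\<And>l. w (c * 2 ^ l) < m * 2 powr - (\<kappa> * real l)) \<Longrightarrow> v (20 * c) \<le> C * m"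
  shows "(\<integral>\<^sup>+ c. ennreal (c powr (a - 1) * v c powr a) * indicator {0<..} c \<partial>lborel)
     \<le> ennreal (C powr a * 20 powr a * geom_bound ((1 - \<kappa>) * a)) *
       (\<integral>\<^sup>+ c. ennreal (c powr (a - 1) * w c powr a) * indicator {0<..} c \<partial>lborel)"
proof -
  let ?g = "\<lambda>l c. ennreal (C powr a * 2 powr (\<kappa> * a * real l) * w (c / 20 * 2 ^ l) powr a)"
  have pointwise: "ennreal (v c powr a) \<le> (\<Sum>l. ?g l c)" if c: "0 < c" for c
  proof (cases "(\<Sum>l. ?g l c) = \<top>")
    case False
    then obtain z where z: "0 \<le> z" "(\<Sum>l. ?g l c) = ennreal z" using ennreal_finite_ex by blast
    have "v c \<le> z powr (1 / a) + \<eta>" if \<eta>: "0 < \<eta>" for \<eta>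
    proof -
      \<comment> \<open>The hypothesis wants strict inequalities, hence the \<open>\<eta>\<close>.\<close>
      define m where "m = (z powr (1 / a) + \<eta>) / C"
      have m: "0 < m" using C \<eta> by (simp add: m_def add_nonneg_pos)
      have "w (c / 20 * 2 ^ l) < m * 2 powr - (\<kappa> * real l)" for l
      proof -
        have "?g l c \<le> ennreal z" using suminf_ennreal_ge[of "\<lambda>l. ?g l c" l] z by simp
        then have "C powr a * 2 powr (\<kappa> * a * real l) * w (c / 20 * 2 ^ l) powr a \<le> z" using z by simp
        then have "(C powr a * 2 powr (\<kappa> * a * real l) * w (c / 20 * 2 ^ l) powr a) powr (1 / a) \<le> z powr (1 / a)"
          using a by (intro powr_mono2) auto
        then have "C * 2 powr (\<kappa> * real l) * w (c / 20 * 2 ^ l) \<le> z powr (1 / a)"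
          using a C w by (simp add: powr_mult powr_powr)
        also have "\<dots> < C * m" using C \<eta> by (simp add: m_def)
        finally have "2 powr (\<kappa> * real l) * w (c / 20 * 2 ^ l) < m" using C by (simp add: mult.assoc)
        then show ?thesis by (simp add: powr_minus field_simps)
      qed
      then have "v (20 * (c / 20)) \<le> C * m" using c m by (intro le) auto
      then show ?thesis using C by (simp add: m_def)
    qed
    then have "v c \<le> z powr (1 / a)" by (rule field_le_epsilon)
    then have "v c powr a \<le> (z powr (1 / a)) powr a" using a v by (intro powr_mono2) auto
    also have "\<dots> = z" using a z by (simp add: powr_powr)
    finally show ?thesis using z by (simp add: ennreal_leI)
  qed simp
  define \<phi> where "\<phi> c = ennreal (c powr (a - 1) * w c powr a) * indicator {0<..} c" for c
  have \<phi>_meas[measurable]: "\<phi> \<in> borel_measurable borel" unfolding \<phi>_def by measurable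
  define b where "b l = C powr a * 20 powr a * 2 powr (- real l * ((1 - \<kappa>) * a))" for l :: nat
  have summand: "ennreal (c powr (a - 1)) * ?g l c * indicator {0<..} c = ennreal (b l * (2 ^ l / 20)) * \<phi> (c * (2 ^ l / 20))" for l c
  proof (cases "0 < c")
    case True
    define k :: real where "k = 2 ^ l / 20"
    have k: "0 < k" by (simp add: k_def)
    have kp: "k powr a = 2 powr (real l * a) / 20 powr a"
      by (simp add: k_def powr_divide powr_realpow[symmetric] powr_powr)
    have "b l * k * ((c * k) powr (a - 1) * w (c * k) powr a)
        = c powr (a - 1) * (b l * (k * k powr (a - 1))) * w (c * k) powr a"
      using True k by (simp add: powr_mult)
    also have "k * k powr (a - 1) = k powr a" using k by (subst powr_mult_base) auto
    also have "b l * k powr a = C powr a * 2 powr (\<kappa> * a * real l)"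
      unfolding kp b_def by (simp add: powr_add[symmetric] algebra_simps)
    finally have eq: "b l * k * ((c * k) powr (a - 1) * w (c * k) powr a)
        = c powr (a - 1) * (C powr a * 2 powr (\<kappa> * a * real l)) * w (c * k) powr a" .
    have "c / 20 * 2 ^ l = c * k" by (simp add: k_def)
    then show ?thesis
      unfolding k_def[symmetric] \<phi>_def using True k eq[symmetric]
      by (simp add: ennreal_mult[symmetric] b_def mult_ac)
  qed (auto simp: \<phi>_def zero_less_mult_iff)
  have scale: "(\<integral>\<^sup>+ c. ennreal (b l * (2 ^ l / 20)) * \<phi> (c * (2 ^ l / 20)) \<partial>lborel) = ennreal (b l) * (\<integral>\<^sup>+ c. \<phi> c \<partial>lborel)" for l
  proof -
    have "(\<integral>\<^sup>+ c. \<phi> c \<partial>lborel) = ennreal (2 ^ l / 20) * (\<integral>\<^sup>+ c. \<phi> (0 + (2 ^ l / 20) * c) \<partial>lborel)"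
      by (subst nn_integral_real_affine[OF \<phi>_meas, of "2 ^ l / 20" 0]) auto
    moreover have "(\<integral>\<^sup>+ c. ennreal (b l * (2 ^ l / 20)) * \<phi> (c * (2 ^ l / 20)) \<partial>lborel)
        = ennreal (b l * (2 ^ l / 20)) * (\<integral>\<^sup>+ c. \<phi> (c * (2 ^ l / 20)) \<partial>lborel)"
      by (rule nn_integral_cmult) measurable
    moreover have "ennreal (b l * (2 ^ l / 20)) = ennreal (b l) * ennreal (2 ^ l / 20)"
      by (rule ennreal_mult) (auto simp: b_def)
    ultimately show ?thesis by (simp only: add_0 mult.commute[of "2 ^ l / 20 :: real"] mult.assoc)
  qed
  have "(\<integral>\<^sup>+ c. ennreal (c powr (a - 1) * v c powr a) * indicator {0<..} c \<partial>lborel)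
      \<le> (\<integral>\<^sup>+ c. (\<Sum>l. ennreal (c powr (a - 1)) * ?g l c * indicator {0<..} c) \<partial>lborel)"
  proof (rule nn_integral_mono)
    fix c :: real
    show "ennreal (c powr (a - 1) * v c powr a) * indicator {0<..} c \<le> (\<Sum>l. ennreal (c powr (a - 1)) * ?g l c * indicator {0<..} c)"
    proof (cases "0 < c")
      case True
      have "ennreal (c powr (a - 1)) * ennreal (v c powr a) \<le> ennreal (c powr (a - 1)) * (\<Sum>l. ?g l c)"
        by (rule mult_left_mono[OF pointwise[OF True]]) simp
      then show ?thesis using True by (simp add: ennreal_mult)
    qed simp
  qed
  also have "\<dots> = (\<Sum>l. \<integral>\<^sup>+ c. ennreal (b l * (2 ^ l / 20)) * \<phi> (c * (2 ^ l / 20)) \<partial>lborel)"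
    unfolding summand by (rule nn_integral_suminf) measurable
  also have "\<dots> = (\<Sum>l. ennreal (b l)) * (\<integral>\<^sup>+ c. \<phi> c \<partial>lborel)"
    unfolding scale by simp
  also have "(\<Sum>l. ennreal (b l)) = ennreal (C powr a * 20 powr a * geom_bound ((1 - \<kappa>) * a))"
  proof (rule suminf_ennreal_eq)
    have q: "norm (2 powr - ((1 - \<kappa>) * a)) < 1" using \<kappa> a by (simp add: powr_less_one)
    have "(\<lambda>l. (2 powr - ((1 - \<kappa>) * a)) ^ l) sums geom_bound ((1 - \<kappa>) * a)"
      unfolding geom_bound_def by (rule geometric_sums[OF q])
    then have "(\<lambda>l. C powr a * 20 powr a * (2 powr - ((1 - \<kappa>) * a)) ^ l) sums (C powr a * 20 powr a * geom_bound ((1 - \<kappa>) * a))"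
      by (rule sums_mult)
    moreover have "(2 powr - ((1 - \<kappa>) * a)) ^ l = 2 powr (- real l * ((1 - \<kappa>) * a))" for l
      by (simp add: powr_realpow[symmetric] powr_powr mult.commute)
    ultimately show "b sums (C powr a * 20 powr a * geom_bound ((1 - \<kappa>) * a))" unfolding b_def by simp
  qed (simp add: b_def)
  finally show ?thesis unfolding \<phi>_def .
qed

lemma ennpowr_mono: "0 < a \<Longrightarrow> x \<le> y \<Longrightarrow> ennpowr x a \<le> ennpowr y a"
  by (auto simp: ennpowr_def top_unique less_top[symmetric] intro!: ennreal_leI powr_mono2 enn2real_mono)

lemma ennpowr_mult_le:
  assumes "0 < a" "0 \<le> c"
  shows "ennpowr (ennreal c * x) a \<le> ennreal (c powr a) * ennpowr x a"
proof (cases "x = \<infinity>")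
  case True
  then show ?thesis
    using assms by (cases "c = 0") (simp_all add: ennpowr_def ennreal_mult_eq_top_iff ennreal_eq_0_iff not_le)
next
  case False
  then obtain y where y: "0 \<le> y" "x = ennreal y" using ennreal_finite_ex[of x] by auto
  then show ?thesis using assms by (simp add: ennpowr_def ennreal_mult[symmetric] powr_mult)
qed

context dyadic_exponent
begin

lemma level_norm_real:
  assumes sets: "\<And>c. {x \<in> {0..<1}. ennreal c < g x} \<in> sets unit_leb"
  shows "level_norm g c = ennreal (enn2real (level_norm g c))"
    and "(\<lambda>c. enn2real (level_norm g c)) \<in> borel_measurable borel"
proof -
  have le1: "level_norm g c \<le> 1" for c unfolding level_norm_def by (rule var_norm_le_1[OF sets])
  have fin: "level_norm g c < \<top>" for c
    by (rule le_less_trans[OF le1]) simp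
  then show "level_norm g c = ennreal (enn2real (level_norm g c))" by simp
  have "mono (\<lambda>c. - enn2real (level_norm g c))"
  proof (rule monoI)
    fix c d :: real assume "c \<le> d"
    then have "{x \<in> {0..<1}. ennreal d < g x} \<subseteq> {x \<in> {0..<1}. ennreal c < g x}"
      by (auto intro: le_less_trans ennreal_leI)
    then have "level_norm g d \<le> level_norm g c" unfolding level_norm_def by (intro var_norm_mono sets)
    then show "- enn2real (level_norm g c) \<le> - enn2real (level_norm g d)" using fin by (simp add: enn2real_mono)
  qed
  then have "(\<lambda>c. - enn2real (level_norm g c)) \<in> borel_measurable borel" by (rule borel_measurable_mono)
  then have "(\<lambda>c. - (- enn2real (level_norm g c))) \<in> borel_measurable borel" by measurable
  then show "(\<lambda>c. enn2real (level_norm g c)) \<in> borel_measurable borel" by simp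
qed

lemma lorentz_norm_integral:
  assumes sets: "\<And>c. {x \<in> {0..<1}. ennreal c < g x} \<in> sets unit_leb"
    and q: "0 < q" "q \<noteq> \<infinity>" and a: "a = enn2real q"
  shows "lorentz_norm p q g = ennpowr
    (\<integral>\<^sup>+ c. ennreal (c powr (a - 1) * enn2real (level_norm g c) powr a) * indicator {0<..} c \<partial>lborel) (1 / a)"
proof -
  have "ennreal (c powr a) * ennpowr (level_norm g c) a / ennreal c * indicator {0<..} c
      = ennreal (c powr (a - 1) * enn2real (level_norm g c) powr a) * indicator {0<..} c" for c
  proof (cases "0 < c")
    case True
    have "level_norm g c \<noteq> \<infinity>" by (subst level_norm_real(1)[OF sets]) simp
    then have "ennreal (c powr a) * ennpowr (level_norm g c) a / ennreal c
        = ennreal (c powr a * enn2real (level_norm g c) powr a) / ennreal c"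
      by (simp add: ennpowr_def ennreal_mult)
    also have "\<dots> = ennreal (c powr a * enn2real (level_norm g c) powr a / c)"
      using True by (intro divide_ennreal) auto
    also have "c powr a * enn2real (level_norm g c) powr a / c = c powr (a - 1) * enn2real (level_norm g c) powr a"
      using True by (simp add: powr_diff)
    finally show ?thesis using True by simp
  qed simp
  then show ?thesis using q(2) by (simp add: lorentz_norm_def level_norm_def a)
qed

text \<open>For \<open>q = \<infinity>\<close> the factors \<open>2 powr (\<kappa> * l)\<close> are compensated by the level \<open>c * 2 ^ l\<close> in the
  supremum, for finite \<open>q\<close> by the rescaling of the integral.\<close>

lemma fejer_max_bounded:
  assumes q: "0 < q"
  shows "\<exists>C\<ge>0. \<forall>f\<in>hardy_space p q. lorentz_norm p q (fejer_max f) \<le> ennreal C * hardy_norm p q f"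
proof -
  obtain \<kappa> C where \<kappa>: "0 < \<kappa>" "\<kappa> < 1" and C: "1 \<le> C" and all: "\<forall>f c m. dyadic_martingale f \<and> 0 < c \<and> 0 < m \<and>
     (\<forall>l. level_norm (martingale_max f) (c * 2 ^ l) < ennreal (m * 2 powr - (\<kappa> * real l))) \<longrightarrow>
     level_norm (fejer_max f) (20 * c) \<le> ennreal (C * m)"
    using level_norm_comparison by (elim exE conjE)
  have level: "level_norm (fejer_max f) (20 * c) \<le> ennreal (C * m)"
    if "dyadic_martingale f" "0 < c" "0 < m"
      "\<And>l. level_norm (martingale_max f) (c * 2 ^ l) < ennreal (m * 2 powr - (\<kappa> * real l))" for f c m
    by (rule all[THEN spec[of _ f], THEN spec[of _ c], THEN spec[of _ m], THEN mp])
       (intro conjI allI that)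
  have C0: "0 < C" using C by simp
  show ?thesis
  proof (cases "q = \<infinity>")
    case True
    have "lorentz_norm p q (fejer_max f) \<le> ennreal (20 * C) * hardy_norm p q f" if "f \<in> hardy_space p q" for f
    proof -
      have f: "dyadic_martingale f" and fin: "hardy_norm p q f < \<infinity>" using that by (auto simp: hardy_space_def)
      have N: "hardy_norm p q f = (SUP c\<in>{0<..}. ennreal c * level_norm (martingale_max f) c)"
        using True by (simp add: hardy_norm_def lorentz_norm_def level_norm_def)
      have "hardy_norm p q f \<noteq> \<top>" using fin by simp
      then obtain \<nu> where \<nu>: "0 \<le> \<nu>" "hardy_norm p q f = ennreal \<nu>" by (blast dest: ennreal_finite_ex)
      note W = level_norm_real(1)[OF martingale_max_sets[OF f]]
      have W_le: "c * enn2real (level_norm (martingale_max f) c) \<le> \<nu>" if "0 < c" for c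
      proof -
        have "ennreal c * level_norm (martingale_max f) c \<le> ennreal \<nu>"
          unfolding \<nu>(2)[symmetric] N using that by (intro SUP_upper) auto
        then have "ennreal (c * enn2real (level_norm (martingale_max f) c)) \<le> ennreal \<nu>"
          using that W[of c] by (simp add: ennreal_mult)
        then show ?thesis using \<nu> by simp
      qed
      have "ennreal c * level_norm (fejer_max f) c \<le> ennreal (20 * C * \<nu>)" if c: "0 < c" for c
      proof -
        note F = level_norm_real(1)[OF fejer_max_sets[OF f]]
        let ?F = "enn2real (level_norm (fejer_max f) c)"
        have "?F \<le> C * (20 * \<nu> / c) + \<eta>" if \<eta>: "0 < \<eta>" for \<eta>
        proof -
          define m where "m = 20 * \<nu> / c + \<eta> / C"
          have m: "0 < m" using C0 \<eta> \<nu> c by (simp add: m_def add_nonneg_pos)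
          have "level_norm (martingale_max f) (c / 20 * 2 ^ l) < ennreal (m * 2 powr - (\<kappa> * real l))" for l
          proof -
            let ?d = "c / 20 * 2 ^ l"
            have d: "0 < ?d" using c by simp
            have p2: "2 powr - real l = (1 :: real) / 2 ^ l" by (simp add: powr_minus powr_realpow divide_inverse)
            have "enn2real (level_norm (martingale_max f) ?d) \<le> \<nu> / ?d"
              using W_le[OF d] d by (subst pos_le_divide_eq) (auto simp: mult.commute)
            also have "\<nu> / ?d = 20 * \<nu> / c * 2 powr - real l" unfolding p2 using c by simp
            also have "\<dots> < m * 2 powr - real l"
              unfolding m_def using C0 \<eta> by (intro mult_strict_right_mono) auto
            also have "\<dots> \<le> m * 2 powr - (\<kappa> * real l)"
              using m \<kappa> by (intro mult_left_mono powr_mono) (auto simp: mult_left_le_one_le)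
            finally show ?thesis by (subst W) (simp add: ennreal_less_iff)
          qed
          then have "level_norm (fejer_max f) (20 * (c / 20)) \<le> ennreal (C * m)"
            using c m by (intro level f) auto
          then have "ennreal ?F \<le> ennreal (C * m)" using F[of c] by simp
          then have "?F \<le> C * m" using C0 m by (subst (asm) ennreal_le_iff) auto
          then show ?thesis using C0 by (simp add: m_def distrib_left)
        qed
        then have "?F \<le> C * (20 * \<nu> / c)" by (rule field_le_epsilon)
        then have "c * ?F \<le> 20 * C * \<nu>" using c by (simp add: field_simps)
        then have "ennreal (c * ?F) \<le> ennreal (20 * C * \<nu>)" by (rule ennreal_leI)
        moreover have "ennreal c * level_norm (fejer_max f) c = ennreal (c * ?F)"
          using c by (subst F) (simp add: ennreal_mult)
        ultimately show ?thesis by simp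
      qed
      then have "lorentz_norm p q (fejer_max f) \<le> ennreal (20 * C * \<nu>)"
        using True by (auto simp: lorentz_norm_def level_norm_def intro!: SUP_least)
      also have "\<dots> = ennreal (20 * C) * hardy_norm p q f"
        unfolding \<nu>(2) using C0 \<nu> by (intro ennreal_mult) auto
      finally show ?thesis .
    qed
    then show ?thesis using C0 by (intro exI[of _ "20 * C"]) auto
  next
    case False
    define a where "a = enn2real q"
    have a: "0 < a" using q False by (simp add: a_def enn2real_positive_iff less_top[symmetric])
    define B where "B = C powr a * 20 powr a * geom_bound ((1 - \<kappa>) * a)"
    have B0: "0 \<le> B" using \<kappa> a geom_bound_pos[of "(1 - \<kappa>) * a"] by (simp add: B_def)
    have "lorentz_norm p q (fejer_max f) \<le> ennreal (B powr (1 / a)) * hardy_norm p q f" if "f \<in> hardy_space p q" for f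
    proof -
      have f: "dyadic_martingale f" using that by (auto simp: hardy_space_def)
      note W = level_norm_real[OF martingale_max_sets[OF f]]
      note F = level_norm_real[OF fejer_max_sets[OF f]]
      have "(\<integral>\<^sup>+ c. ennreal (c powr (a - 1) * enn2real (level_norm (fejer_max f) c) powr a) * indicator {0<..} c \<partial>lborel)
        \<le> ennreal B * (\<integral>\<^sup>+ c. ennreal (c powr (a - 1) * enn2real (level_norm (martingale_max f) c) powr a) * indicator {0<..} c \<partial>lborel)"
        unfolding B_def
      proof (rule level_integral_comparison[OF a C0 \<kappa>(2) _ _ W(2)])
        fix c m :: real
        assume cm: "0 < c" "0 < m" and less: "\<And>l. enn2real (level_norm (martingale_max f) (c * 2 ^ l)) < m * 2 powr - (\<kappa> * real l)"
        have "level_norm (martingale_max f) (c * 2 ^ l) < ennreal (m * 2 powr - (\<kappa> * real l))" for l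
          by (subst W(1)) (use less in \<open>simp add: ennreal_less_iff\<close>)
        then have "level_norm (fejer_max f) (20 * c) \<le> ennreal (C * m)" by (rule level[OF f cm])
        then have "ennreal (enn2real (level_norm (fejer_max f) (20 * c))) \<le> ennreal (C * m)" using F(1) by simp
        then show "enn2real (level_norm (fejer_max f) (20 * c)) \<le> C * m" using C0 cm by simp
      qed auto
      then have "lorentz_norm p q (fejer_max f) \<le> ennpowr (ennreal B *
          (\<integral>\<^sup>+ c. ennreal (c powr (a - 1) * enn2real (level_norm (martingale_max f) c) powr a) * indicator {0<..} c \<partial>lborel)) (1 / a)"
        unfolding lorentz_norm_integral[OF fejer_max_sets[OF f] q False a_def] using a by (intro ennpowr_mono) auto
      also have "\<dots> \<le> ennreal (B powr (1 / a)) * hardy_norm p q f"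
        unfolding hardy_norm_def lorentz_norm_integral[OF martingale_max_sets[OF f] q False a_def]
        using a B0 by (intro ennpowr_mult_le) auto
      finally show ?thesis .
    qed
    then show ?thesis by (intro exI[of _ "B powr (1 / a)"]) auto
  qed
qed

end

section \<open>Essential bounds of the exponent\<close>

lemma p_minus_AE:
  assumes "A \<in> sets unit_leb"
  shows "AE x in unit_leb. x \<in> A \<longrightarrow> p_minus p A \<le> ereal (p x)"
proof -
  have "AE x in restrict_space unit_leb A. p_minus p A \<le> ereal (p x)"
    using esssup_AE[of "\<lambda>x. - ereal (p x)" "restrict_space unit_leb A"]
    by eventually_elim (metis ereal_uminus_le_reorder p_minus_def)
  then show ?thesis
    by (subst (asm) AE_restrict_space_iff)
       (use assms sets.sets_into_space[OF assms] in \<open>simp_all add: Int_absorb2\<close>)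
qed

lemma p_plus_AE:
  assumes "A \<in> sets unit_leb"
  shows "AE x in unit_leb. x \<in> A \<longrightarrow> ereal (p x) \<le> p_plus p A"
proof -
  have "AE x in restrict_space unit_leb A. ereal (p x) \<le> p_plus p A"
    using esssup_AE[of "\<lambda>x. ereal (p x)" "restrict_space unit_leb A"] by (simp add: p_plus_def)
  then show ?thesis
    by (subst (asm) AE_restrict_space_iff)
       (use assms sets.sets_into_space[OF assms] in \<open>simp_all add: Int_absorb2\<close>)
qed

lemma p_minus_ge:
  assumes p: "p \<in> borel_measurable unit_leb" and A: "A \<in> sets unit_leb" and b: "AE x in unit_leb. c \<le> p x"
  shows "ereal c \<le> p_minus p A"
proof -
  have "esssup (restrict_space unit_leb A) (\<lambda>x. - ereal (p x)) \<le> - ereal c"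
  proof (rule esssup_I)
    have "(\<lambda>x. - ereal (p x)) \<in> borel_measurable unit_leb" using p by simp
    then show "(\<lambda>x. - ereal (p x)) \<in> borel_measurable (restrict_space unit_leb A)"
      by (rule measurable_restrict_space1)
    show "AE x in restrict_space unit_leb A. - ereal (p x) \<le> - ereal c"
      using A sets.sets_into_space[OF A] b by (subst AE_restrict_space_iff) (auto simp: Int_absorb2 elim: eventually_mono)
  qed
  then have "- (- ereal c) \<le> - esssup (restrict_space unit_leb A) (\<lambda>x. - ereal (p x))"
    by (simp only: ereal_minus_le_minus)
  then show ?thesis by (simp only: p_minus_def ereal_uminus_uminus)
qed

lemma p_plus_le:
  assumes p: "p \<in> borel_measurable unit_leb" and A: "A \<in> sets unit_leb" and b: "AE x in unit_leb. p x \<le> c"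
  shows "p_plus p A \<le> ereal c"
  unfolding p_plus_def
proof (rule esssup_I)
  have "(\<lambda>x. ereal (p x)) \<in> borel_measurable unit_leb" using p by simp
  then show "(\<lambda>x. ereal (p x)) \<in> borel_measurable (restrict_space unit_leb A)"
    by (rule measurable_restrict_space1)
  show "AE x in restrict_space unit_leb A. ereal (p x) \<le> ereal c"
    using A sets.sets_into_space[OF A] b by (subst AE_restrict_space_iff) (auto simp: Int_absorb2 elim: eventually_mono)
qed

lemma lorentz_norm_cong_AE:
  assumes "AE x in unit_leb. p x = p' x"
  shows "lorentz_norm p q g = lorentz_norm p' q g"
proof -
  have "var_norm p g = var_norm p' g" for g
  proof -
    have "(\<integral>\<^sup>+ x. ennpowr (g x / ennreal l) (p x) \<partial>unit_leb) = (\<integral>\<^sup>+ x. ennpowr (g x / ennreal l) (p' x) \<partial>unit_leb)" for l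
      using assms by (intro nn_integral_cong_AE) (auto elim: eventually_mono)
    then show ?thesis by (simp add: var_norm_def)
  qed
  then show ?thesis by (simp add: lorentz_norm_def)
qed

section \<open>Boundedness of the maximal Fejer operator\<close>

theorem theorem5p40:
  fixes p :: "real \<Rightarrow> real" and q :: ennreal and K :: real
  assumes p_meas: "p \<in> borel_measurable (lebesgue_on {0..<1})"
    and p_pos: "\<And>x. x \<in> {0..<1} \<Longrightarrow> 0 < p x"
    and p_minus_pos: "0 < p_minus p {0..<1}"
    and p_minus_le_plus: "p_minus p {0..<1} \<le> p_plus p {0..<1}"
    and p_plus_finite: "p_plus p {0..<1} < \<infinity>"
    and K_ge: "1 \<le> K"
    and dyadic_cond: "\<And>n k. k < 2 ^ n \<Longrightarrow>
       measure (lebesgue_on {0..<1}) (dyadic_interval n k) powr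
         real_of_ereal (p_minus p (dyadic_interval n k) - p_plus p (dyadic_interval n k)) \<le> K"
    and gap: "1 / p_minus p {0..<1} - 1 / p_plus p {0..<1} < 1"
    and p_minus_half: "ereal (1 / 2) < p_minus p {0..<1}" "p_minus p {0..<1} < \<infinity>"
    and q_pos: "0 < q"
  shows "\<exists>C::real. \<forall>f \<in> hardy_space p q.
           lorentz_norm p q (fejer_max f) \<le> ennreal C * hardy_norm p q f"
proof -
  obtain p0 where p0: "p_minus p {0..<1} = ereal p0"
    using p_minus_pos p_minus_half(2) by (cases "p_minus p {0..<1}") auto
  obtain p1 where p1: "p_plus p {0..<1} = ereal p1"
    using p_minus_le_plus p_plus_finite p0 by (cases "p_plus p {0..<1}") auto
  have p0_gt: "1 / 2 < p0" using p_minus_half(1) p0 by simp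
  have p01: "p0 \<le> p1" using p_minus_le_plus p0 p1 by simp
  have unit: "{0..<1} \<in> sets unit_leb" using sets.top[of unit_leb] by simp
  have lo: "AE x in unit_leb. p0 \<le> p x" using p_minus_AE[OF unit, of p] AE_space by eventually_elim (auto simp: p0)
  have hi: "AE x in unit_leb. p x \<le> p1" using p_plus_AE[OF unit, of p] AE_space by eventually_elim (auto simp: p1)
  \<comment> \<open>Truncation makes the essential bounds hold everywhere and changes no quasi-norm.\<close>
  define p' where "p' x = max p0 (min p1 (p x))" for x
  have p'_eq: "AE x in unit_leb. p x = p' x"
    using lo hi by eventually_elim (auto simp: p'_def)
  have "dyadic_exponent p' p0 p1 K"
  proof
    show "p' \<in> borel_measurable unit_leb" unfolding p'_def using p_meas by measurable
    show "p0 \<le> p' x" "p' x \<le> p1" for x using p01 by (auto simp: p'_def)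
    show "1 / 2 < p0" by (rule p0_gt)
    show "1 / p0 - 1 / p1 < 1" using gap p0_gt p01 by (simp add: p0 p1 one_ereal_def)
    show "1 \<le> K" by (rule K_ge)
  next
    fix k n :: nat assume k: "k < 2 ^ n"
    let ?J = "dyadic_interval n k"
    have J: "?J \<in> sets unit_leb" by (rule dyadic_interval_sets[OF k])
    note minus = p_minus_AE[OF J, of p] and plus = p_plus_AE[OF J, of p]
    \<comment> \<open>A point of the interval between the essential bounds shows that these are finite and ordered.\<close>
    have "\<not> (AE x in unit_leb. x \<notin> ?J)"
    proof
      assume "AE x in unit_leb. x \<notin> ?J"
      then have "emeasure unit_leb ?J = 0"
        using J sets.sets_into_space[OF J] by (subst (asm) AE_iff_measurable[OF J]) auto
      then show False using measure_dyadic_interval[OF k] by (simp add: measure_def)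
    qed
    then obtain y where y: "p_minus p ?J \<le> ereal (p y)" "ereal (p y) \<le> p_plus p ?J"
      using minus plus by (smt (verit) eventually_mono eventually_elim2)
    have "ereal p0 \<le> p_minus p ?J" by (rule p_minus_ge[OF p_meas J lo])
    then obtain a where a: "p_minus p ?J = ereal a" using y(1) by (cases "p_minus p ?J") auto
    have "p_plus p ?J \<le> ereal p1" by (rule p_plus_le[OF p_meas J hi])
    then obtain b where b: "p_plus p ?J = ereal b" using y(2) by (cases "p_plus p ?J") auto
    have ab: "a \<le> b" using y a b by simp
    have "(1 / 2 ^ n) powr (a - b) \<le> K"
      using dyadic_cond[OF k] by (simp add: measure_dyadic_interval[OF k] a b)
    moreover have "(1 / 2 ^ n :: real) powr (a - b) = (2 ^ n) powr (b - a)"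
      by (simp add: powr_divide powr_diff)
    ultimately have osc: "(2 ^ n) powr (b - a) \<le> K" by simp
    have "AE x in unit_leb. x \<in> ?J \<longrightarrow> a \<le> p' x \<and> p' x \<le> b"
      using minus plus p'_eq by eventually_elim (auto simp: a b)
    then show "\<exists>a b. a \<le> b \<and> (2 ^ n) powr (b - a) \<le> K \<and> (AE x in unit_leb. x \<in> ?J \<longrightarrow> a \<le> p' x \<and> p' x \<le> b)"
      using ab osc by blast
  qed
  then obtain C where "\<forall>f\<in>hardy_space p' q. lorentz_norm p' q (fejer_max f) \<le> ennreal C * hardy_norm p' q f"
    using dyadic_exponent.fejer_max_bounded[OF _ q_pos] by blast
  moreover have "lorentz_norm p q g = lorentz_norm p' q g" for g by (rule lorentz_norm_cong_AE[OF p'_eq])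
  ultimately show ?thesis by (auto simp: hardy_space_def hardy_norm_def)
qed

end
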